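(* Let $X(n)$ be the self-repelling random walk with directed edges on $\mathbb{Z}$ governed by the weight function $w$, with $\Lambda^{\pm}_{j,r}(k)$, $\lambda^{\pm}_{j,r}$, $\rho^{\pm}_{j,r}$ as defined in the context. Let $x\in\mathbb{R}$ and $h\in(0,\infty)$ be fixed. Then, for each choice of the sign $\pm$, $$A^{-1}\lambda^{\pm}_{\lfloor Ax\rfloor,\lfloor Ah\rfloor}\longrightarrow -|x|-2h\quad\text{in probability},$$ $$A^{-1}\rho^{\pm}_{\lfloor Ax\rfloor,\lfloor Ah\rfloor}\longrightarrow |x|+2h\quad\text{in probability},$$ and $$\sup_{y\in\mathbb{R}}\left|A^{-1}\Lambda^{\pm}_{\lfloor Ax\rfloor,\lfloor Ah\rfloor}(\lfloor Ay\rfloor)-\left(|x|-|y|+2h\right)_+\right|\longrightarrow 0\quad\text{in probability}$$ as $A\to\infty$.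
   Context: Notation: $\mathbb{Z}_+=\{0,1,2,\dots\}$; $(a)_+=\max(a,0)$. Weight function: $w:\mathbb{Z}\to(0,\infty)$ satisfies $w(z+1)\ge w(z)$ for all $z\in\mathbb{Z}$ and $\lim_{z\to\infty}(w(z)-w(-z))>0$ (i.e. $w$ is non-decreasing and non-constant). The walk: $X(n)$, $n\in\mathbb{Z}_+$, is a nearest neighbour random walk on $\mathbb{Z}$ with $X(0)=0$. Its local times on oriented edges are $$\ell^{\pm}(n,k)=\#\{0\le j\le n-1: X(j)=k,\ X(j+1)=k\pm1\},\qquad (n,k)\in\mathbb{Z}_+\times\mathbb{Z}.$$ With $\mathcal{F}_n$ the history of the walk up to time $n$, i.e. the $\sigma$-algebra generated by $X(0),\dots,X(n)$, the law of the walk is given by $$\mathbf{P}\big(X(n+1)=X(n)\pm1\mid\mathcal{F}_n\big)=\frac{w(\mp D_n)}{w(D_n)+w(-D_n)},\qquad D_n=\ell^+(n,X(n))-\ell^-(n,X(n)).$$ Local time on the unoriented edge $\langle k,k+1\rangle$: $\ell(n,k)=\ell^+(n,k)+\ell^-(n,k+1)$. Inverse local times: for $j\in\mathbb{Z}$, $r\in\mathbb{Z}_+$, $T^{\pm}_{j,r}=\min\{n\ge0:\ell^{\pm}(n,j)\ge r\}$ (equal to $\infty$ if there is no such $n$). Stopped local time process: $\Lambda^{\pm}_{j,r}(k)=\ell(T^{\pm}_{j,r},k)$, $k\in\mathbb{Z}$. Leftmost and rightmost visited edges: $\lambda^{\pm}_{j,r}=\inf\{k\in\mathbb{Z}:\Lambda^{\pm}_{j,r}(k)>0\}$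 and $\rho^{\pm}_{j,r}=\sup\{k\in\mathbb{Z}:\Lambda^{\pm}_{j,r}(k)>0\}$. *)

theory Defs
  imports "HOL-Probability.Probability"
begin

text \<open>
  The path functionals take a trajectory \<open>\<xi> :: nat \<Rightarrow> int\<close>. A sign \<open>\<plusminus>\<close> is
  represented by an integer \<open>s \<in> {1, -1}\<close>.
\<close>

definition oriented_local_time :: "(nat \<Rightarrow> int) \<Rightarrow> int \<Rightarrow> nat \<Rightarrow> int \<Rightarrow> nat" where
  "oriented_local_time \<xi> s n k = card {i. i < n \<and> \<xi> i = k \<and> \<xi> (Suc i) = k + s}"

definition edge_local_time :: "(nat \<Rightarrow> int) \<Rightarrow> nat \<Rightarrow> int \<Rightarrow> nat" where
  "edge_local_time \<xi> n k = oriented_local_time \<xi> 1 n k + oriented_local_time \<xi> (-1) n (k + 1)"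

definition inverse_local_time :: "(nat \<Rightarrow> int) \<Rightarrow> int \<Rightarrow> int \<Rightarrow> nat \<Rightarrow> enat" where
  "inverse_local_time \<xi> s j r = (INF n \<in> {n. r \<le> oriented_local_time \<xi> s n j}. enat n)"

text \<open>
  If the inverse local time is infinite, the local time is the total number of crossings
  of the edge during the whole (infinite) trajectory, which may itself be infinite.
\<close>

definition stopped_local_time :: "(nat \<Rightarrow> int) \<Rightarrow> int \<Rightarrow> int \<Rightarrow> nat \<Rightarrow> int \<Rightarrow> enat" where
  "stopped_local_time \<xi> s j r k =
     (case inverse_local_time \<xi> s j r of
        enat n \<Rightarrow> enat (edge_local_time \<xi> n k)
      | \<infinity> \<Rightarrow> (SUP n. enat (edge_local_time \<xi> n k)))"

text \<open>
  The infimum and supremum are taken in the extended reals: \<open>INF\<close> of the empty set is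
  \<open>\<infinity>\<close> and \<open>SUP\<close> of the empty set is \<open>-\<infinity>\<close>.
\<close>

definition leftmost_edge :: "(nat \<Rightarrow> int) \<Rightarrow> int \<Rightarrow> int \<Rightarrow> nat \<Rightarrow> ereal" where
  "leftmost_edge \<xi> s j r =
     (INF k \<in> {k. stopped_local_time \<xi> s j r k > 0}. ereal (real_of_int k))"

definition rightmost_edge :: "(nat \<Rightarrow> int) \<Rightarrow> int \<Rightarrow> int \<Rightarrow> nat \<Rightarrow> ereal" where
  "rightmost_edge \<xi> s j r =
     (SUP k \<in> {k. stopped_local_time \<xi> s j r k > 0}. ereal (real_of_int k))"

definition local_drift :: "(nat \<Rightarrow> int) \<Rightarrow> nat \<Rightarrow> int" where
  "local_drift \<xi> n =
     int (oriented_local_time \<xi> 1 n (\<xi> n)) - int (oriented_local_time \<xi> (-1) n (\<xi> n))"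

definition history :: "'a measure \<Rightarrow> (nat \<Rightarrow> 'a \<Rightarrow> int) \<Rightarrow> nat \<Rightarrow> 'a measure" where
  "history M X n = sigma (space M) {X i -` B \<inter> space M | i B. i \<le> n}"

text \<open>
  The limit in \<open>w_nonconst\<close> is taken in the extended reals, because \<open>w\<close> may be unbounded.
\<close>

locale self_repelling_walk = prob_space M
  for M :: "'a measure" and w :: "int \<Rightarrow> real" and X :: "nat \<Rightarrow> 'a \<Rightarrow> int" +
  assumes w_pos: "w z > 0"
    and w_mono: "w z \<le> w (z + 1)"
    and w_nonconst: "\<exists>L::ereal. ((\<lambda>z. ereal (w z - w (- z))) \<longlongrightarrow> L) at_top \<and> L > 0"
    and X_measurable: "X n \<in> measurable M (count_space UNIV)"
    and X_start: "AE \<omega> in M. X 0 \<omega> = 0"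
    and X_nearest_neighbour: "AE \<omega> in M. \<bar>X (Suc n) \<omega> - X n \<omega>\<bar> = 1"
    and X_step: "s \<in> {1, -1} \<Longrightarrow>
      AE \<omega> in M.
        real_cond_exp M (history M X n)
          (indicat_real {\<omega> \<in> space M. X (Suc n) \<omega> = X n \<omega> + s}) \<omega> =
        (let D = local_drift (\<lambda>i. X i \<omega>) n in w (- s * D) / (w D + w (- D)))"

text \<open>
  Convergence in probability, as the real parameter tends to infinity, of extended
  real-valued variables to a constant. Measurability is demanded explicitly, since
  \<^const>\<open>measure\<close> vanishes on non-measurable sets.
\<close>

definition converges_in_probability :: "'a measure \<Rightarrow> (real \<Rightarrow> 'a \<Rightarrow> ereal) \<Rightarrow> real \<Rightarrow> bool" where
  "converges_in_probability M Y c \<longleftrightarrow>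
     (\<forall>\<^sub>F A in at_top. Y A \<in> borel_measurable M) \<and>
     (\<forall>\<epsilon>>0. ((\<lambda>A. measure M {\<omega> \<in> space M. \<bar>Y A \<omega> - ereal c\<bar> > ereal \<epsilon>}) \<longlongrightarrow> 0) at_top)"

end

theory Submission
  imports Defs
begin

text \<open>
  The proof is a Ray-Knight argument. The walk is stopped just after its \<open>r\<close>-th jump from
  \<open>j\<close> to \<open>j + 1\<close>. Look at the jumps made from one fixed site and call a jump \<^emph>\<open>homeward\<close> if it
  points towards the edge \<open>\<langle>j, j + 1\<rangle>\<close>, and \<^emph>\<open>outward\<close> otherwise. The
  difference \<open>outward - homeward\<close> is a Markov chain on the integers that steps up from \<open>z\<close> with
  probability \<open>p z = w (- z) / (w z + w (- z))\<close>, the same for either orientation, and the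
  chains of different sites are independent. At the stopping time the last jump made from any site was
  homeward. Hence, moving away from the edge \<open>\<langle>j, j + 1\<rangle>\<close> in either direction, the number \<open>Z\<close> of homeward
  jumps determines the law of the number of outward jumps, and adding one to the latter between the
  edge and the origin (where the walk has one net passage to make) gives the number of homeward
  jumps of the next site. So \<open>Z\<close> is a Markov chain indexed by the sites, and local
  times are \<open>2 Z\<close> up to an error of one.

  The increment of \<open>Z\<close> has mean close to \<open>- 1 / 2\<close> when \<open>Z\<close> is large. This rests on two facts
  about one site. Having at least \<open>u\<close> outward jumps before the \<open>d\<close>-th homeward one means having
  fewer than \<open>d\<close> homeward jumps before the \<open>u\<close>-th outward one, and exchanging the directions
  only changes the sign of the difference (\<open>outward_count_duality\<close>); so the two tails of the
  difference chain \<open>eta\<close> control each other, and an exponential moment on one side suffices for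
  tightness. Moreover the law of \<open>eta\<close> changes slowly in time, because two copies of the chain
  with tight marginals coalesce (\<open>joint_unequal_tendsto_0\<close>). Duality and slow variation together
  say that the limit law is symmetric about \<open>- 1 / 2\<close> (\<open>eta_mean_tendsto\<close>).

  Consequently \<open>2 Z\<close> decreases with slope one away from the origin and increases with slope
  \<open>2 (1 - 1 / 2) = 1\<close> between the edge and the origin: this is the function
  \<open>(|x| - |y| + 2 h)\<^sub>+\<close>. The fluctuations are those of a martingale with bounded conditional
  variance, so they are of order \<open>sqrt A\<close> by Kolmogorov's inequality, and the mean of the increment
  is wrong only while \<open>Z\<close> is small, which after the passage of the origin happens a bounded expected number of
  times before the chain dies at \<open>0\<close> (\<open>level_path_concentration\<close>).

  It remains to transport this to the walk, whose law is only known through its one-step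
  conditional probabilities. Prescribing the finite list of jumps made from every site
  (a stack), with the flow balanced as above and the last jump of each list homeward, determines
  exactly one finite path, and this path ends with the \<open>r\<close>-th jump from \<open>j\<close> to \<open>j + 1\<close>
  (\<open>directed_stacks_exits\<close>). The probability that the walk follows the path is the product of the
  probabilities of the stacks, and paths of different stacks are incompatible. Summing over all good
  families of stacks bounds the probability of a good profile from below by that of the site-to-site
  chains (\<open>stopped_profile_event\<close>); as the latter tends to one, this also shows that the inverse
  local time is finite with probability tending to one. The sign \<open>-\<close> follows by reflection.
\<close>

section \<open>The jumps from a single site\<close>

lemma prob_bind_pmf:
  "measure_pmf.prob (bind_pmf M f) S = (\<integral>x. measure_pmf.prob (f x) S \<partial>measure_pmf M)"
proof -
  have int: "integrable (measure_pmf M) (\<lambda>x. measure_pmf.prob (f x) S)"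
    by (rule measure_pmf.integrable_const_bound[where B = 1]) auto
  have "ennreal (measure_pmf.prob (bind_pmf M f) S)
      = (\<integral>\<^sup>+x. ennreal (measure_pmf.prob (f x) S) \<partial>measure_pmf M)"
    using emeasure_bind_pmf[of M f S] unfolding measure_pmf.emeasure_eq_measure .
  also have "\<dots> = ennreal (\<integral>x. measure_pmf.prob (f x) S \<partial>measure_pmf M)"
    by (rule nn_integral_eq_integral[OF int]) simp
  finally show ?thesis
    by (simp add: integral_nonneg_AE)
qed

text \<open>
  \<open>p z\<close> is the probability of an outward jump when the outward jumps already made from the
  site outnumber the homeward ones by \<open>z\<close>.
\<close>

locale site_chain =
  fixes p :: "int \<Rightarrow> real"
  assumes p_pos: "p z > 0"
    and p_reflect: "p (- z) = 1 - p z"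
    and p_antimono: "y \<le> z \<Longrightarrow> p z \<le> p y"
    and p_nonconst: "\<exists>z. p z < 1 / 2"
begin

lemma p_less_1: "p z < 1"
  using p_pos[of "- z"] p_reflect[of z] by simp

lemma p_le_half: "z \<ge> 0 \<Longrightarrow> p z \<le> 1 / 2"
  using p_reflect[of 0] p_antimono[of 0 z] by simp

lemma sum_run_weights:
  "(\<Sum>m<n. (\<Prod>i<m. p (z + int i)) * (1 - p (z + int m))) = 1 - (\<Prod>i<n. p (z + int i))"
  by (induction n) (auto simp: algebra_simps)

text \<open>
  From difference \<open>0\<close> on, each factor is at most \<open>1 / 2\<close>; so a homeward jump comes eventually.
\<close>

lemma prod_p_tendsto_0: "(\<lambda>n. \<Prod>i<n. p (z + int i)) \<longlonglongrightarrow> 0"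
proof -
  define k where "k = nat (- z)"
  have k: "z + int k \<ge> 0" by (simp add: k_def)
  have le: "(\<Prod>i<n + k. p (z + int i)) \<le> (1 / 2) ^ n" for n
  proof (induction n)
    case 0
    show ?case
      by (auto intro!: prod_le_1 simp: less_imp_le p_pos p_less_1)
  next
    case (Suc n)
    have "p (z + int (n + k)) \<le> 1 / 2"
      using k by (intro p_le_half) auto
    moreover have "(\<Prod>i<n + k. p (z + int i)) \<ge> 0"
      by (intro prod_nonneg) (auto simp: less_imp_le p_pos)
    ultimately have "(\<Prod>i<n + k. p (z + int i)) * p (z + int (n + k)) \<le> (1 / 2) ^ n * (1 / 2)"
      using Suc p_pos[of "z + int (n + k)"] by (intro mult_mono) auto
    then show ?case by simp
  qed
  have "(\<lambda>n. \<Prod>i<n + k. p (z + int i)) \<longlonglongrightarrow> 0"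
    by (rule tendsto_sandwich[OF _ _ tendsto_const LIMSEQ_power_zero[of "1/2 :: real"]])
      (use le in \<open>auto intro!: always_eventually prod_nonneg simp: less_imp_le p_pos\<close>)
  then show ?thesis
    by (rule LIMSEQ_offset)
qed

text \<open>
  The number of outward jumps before the next homeward one, from difference \<open>z\<close>.
\<close>

definition outward_run :: "int \<Rightarrow> nat pmf" where
  "outward_run z = embed_pmf (\<lambda>m. (\<Prod>i<m. p (z + int i)) * (1 - p (z + int m)))"

lemma pmf_outward_run: "pmf (outward_run z) m = (\<Prod>i<m. p (z + int i)) * (1 - p (z + int m))"
  unfolding outward_run_def
proof (rule pmf_embed_pmf)
  let ?f = "\<lambda>m. (\<Prod>i<m. p (z + int i)) * (1 - p (z + int m))"
  show nn: "0 \<le> ?f m" for m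
    by (intro mult_nonneg_nonneg prod_nonneg) (auto simp: less_imp_le p_pos p_less_1)
  have "?f sums (1 - 0)"
    unfolding sums_def sum_run_weights by (intro tendsto_diff tendsto_const prod_p_tendsto_0)
  then show "(\<integral>\<^sup>+ x. ennreal (?f x) \<partial>count_space UNIV) = 1"
    using suminf_ennreal_eq[OF nn] by (simp add: nn_integral_count_space_nat)
qed

lemma pmf_outward_run_0: "pmf (outward_run z) 0 = 1 - p z"
  by (simp add: pmf_outward_run)

lemma pmf_outward_run_Suc: "pmf (outward_run z) (Suc m) = p z * pmf (outward_run (z + 1)) m"
  by (simp add: pmf_outward_run prod.lessThan_Suc_shift add.assoc del: prod.lessThan_Suc)

lemma pmf_outward_run_pos: "pmf (outward_run z) m > 0"
  unfolding pmf_outward_run by (intro mult_pos_pos prod_pos) (auto simp: p_pos p_less_1)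

lemma outward_run_unfold:
  "outward_run z = bernoulli_pmf (p z) \<bind> (\<lambda>b. if b then map_pmf Suc (outward_run (z + 1)) else return_pmf 0)"
proof (rule pmf_eqI)
  fix m
  have 0: "pmf (map_pmf Suc (outward_run (z + 1))) 0 = 0"
    by (auto simp: pmf_eq_0_set_pmf)
  have Suc: "pmf (map_pmf Suc (outward_run (z + 1))) (Suc k) = pmf (outward_run (z + 1)) k" for k
    by (rule pmf_map_inj') simp
  show "pmf (outward_run z) m = pmf (bernoulli_pmf (p z) \<bind> (\<lambda>b. if b then map_pmf Suc (outward_run (z + 1)) else return_pmf 0)) m"
    using p_pos[of z] p_less_1[of z]
    by (cases m) (auto simp: pmf_bind 0 Suc pmf_outward_run_0 pmf_outward_run_Suc)
qed

text \<open>
  All jumps up to the \<open>d\<close>-th homeward one, recorded as the lengths of the \<open>d\<close> runs of outward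
  jumps that precede the homeward ones.
\<close>

primrec runs :: "nat \<Rightarrow> int \<Rightarrow> nat list pmf" where
  "runs 0 z = return_pmf []"
| "runs (Suc d) z = outward_run z \<bind> (\<lambda>m. map_pmf (Cons m) (runs d (z + int m - 1)))"

text \<open>
  The law of the number of outward jumps before the \<open>d\<close>-th homeward one.
\<close>

primrec outward_count :: "nat \<Rightarrow> int \<Rightarrow> nat pmf" where
  "outward_count 0 z = return_pmf 0"
| "outward_count (Suc d) z = outward_run z \<bind> (\<lambda>m. map_pmf ((+) m) (outward_count d (z + int m - 1)))"

lemma map_sum_list_runs: "map_pmf sum_list (runs d z) = outward_count d z"
proof (induction d arbitrary: z)
  case (Suc d)
  have "map_pmf sum_list (runs (Suc d) z)
      = outward_run z \<bind> (\<lambda>m. map_pmf ((+) m) (map_pmf sum_list (runs d (z + int m - 1))))"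
    by (simp add: map_bind_pmf pmf.map_comp o_def)
  then show ?case by (simp add: Suc.IH)
qed simp

lemma length_runs: "ms \<in> set_pmf (runs d z) \<Longrightarrow> length ms = d"
  by (induction d arbitrary: z ms) auto

text \<open>
  Conditioning on a single jump, instead of a whole run, is what makes both sides of the duality
  satisfy the same recursion.
\<close>

lemma outward_count_Suc_unfold:
  "outward_count (Suc d) z = bernoulli_pmf (p z) \<bind>
     (\<lambda>b. if b then map_pmf Suc (outward_count (Suc d) (z + 1)) else outward_count d (z - 1))"
proof -
  have "outward_count (Suc d) z = (bernoulli_pmf (p z) \<bind> (\<lambda>b. if b then map_pmf Suc (outward_run (z + 1)) else return_pmf 0))
     \<bind> (\<lambda>m. map_pmf ((+) m) (outward_count d (z + int m - 1)))"
    by (subst outward_run_unfold[symmetric]) simp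
  also have "\<dots> = bernoulli_pmf (p z) \<bind>
     (\<lambda>b. if b then map_pmf Suc (outward_count (Suc d) (z + 1)) else outward_count d (z - 1))"
    unfolding bind_assoc_pmf
    by (intro bind_pmf_cong refl)
      (auto simp: bind_map_pmf map_bind_pmf bind_return_pmf pmf.map_comp o_def add.assoc
        pmf.map_ident plus_nat.add_0[abs_def] plus_nat.add_Suc[abs_def] intro!: bind_pmf_cong)
  finally show ?thesis .
qed

lemma prob_bernoulli_bind:
  assumes "0 \<le> q" "q \<le> 1"
  shows "measure_pmf.prob (bernoulli_pmf q \<bind> (\<lambda>b. if b then f else g)) S
       = q * measure_pmf.prob f S + (1 - q) * measure_pmf.prob g S"
  using assms by (simp add: prob_bind_pmf)

text \<open>
  At least \<open>u\<close> outward jumps precede the \<open>d\<close>-th homeward one iff fewer than \<open>d\<close> homeward jumps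
  precede the \<open>u\<close>-th outward one; exchanging the two directions turns the difference \<open>z\<close> into
  \<open>- z\<close>. The case \<open>d = u = 0\<close> must be left out, as it would read \<open>1 = 0\<close>.
\<close>

lemma outward_count_duality:
  "d + u > 0 \<Longrightarrow> measure_pmf.prob (outward_count d z) {u..} = measure_pmf.prob (outward_count u (- z)) {..<d}"
proof (induction "d + u" arbitrary: d u z rule: less_induct)
  case less
  note p01 = p_pos[THEN less_imp_le] p_less_1[THEN less_imp_le]
  show ?case
  proof (cases d)
    case 0
    with less.prems show ?thesis
      by (auto simp: measure_return_pmf indicator_def)
  next
    case d: (Suc d')
    show ?thesis
    proof (cases u)
      case 0
      then show ?thesis using d by (simp add: measure_return_pmf indicator_def)
    next
      case u: (Suc u')
      have arg1: "- (z + 1) = - z - 1" and arg2: "- (z - 1) = - z + 1"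
        by simp_all
      have "measure_pmf.prob (outward_count d z) {u..}
          = p z * measure_pmf.prob (outward_count d (z + 1)) {u'..} + (1 - p z) * measure_pmf.prob (outward_count d' (z - 1)) {u..}"
        unfolding d by (subst outward_count_Suc_unfold, subst prob_bernoulli_bind)
          (auto simp: p01 measure_map_pmf vimage_def u atLeast_def)
      also have "measure_pmf.prob (outward_count d (z + 1)) {u'..} = measure_pmf.prob (outward_count u' (- (z + 1))) {..<d}"
        by (rule less.hyps) (auto simp: d u)
      also have "measure_pmf.prob (outward_count d' (z - 1)) {u..} = measure_pmf.prob (outward_count u (- (z - 1))) {..<d'}"
        by (rule less.hyps) (auto simp: d u)
      also have "p z * measure_pmf.prob (outward_count u' (- (z + 1))) {..<d}
            + (1 - p z) * measure_pmf.prob (outward_count u (- (z - 1))) {..<d'}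
          = p (- z) * measure_pmf.prob (map_pmf Suc (outward_count u (- z + 1))) {..<d}
            + (1 - p (- z)) * measure_pmf.prob (outward_count u' (- z - 1)) {..<d}"
        unfolding arg1 arg2 by (simp add: p_reflect measure_map_pmf vimage_def d lessThan_def)
      also have "\<dots> = measure_pmf.prob (outward_count u (- z)) {..<d}"
        unfolding u by (subst outward_count_Suc_unfold[of u' "- z"], subst prob_bernoulli_bind) (auto simp: p01)
      finally show ?thesis .
    qed
  qed
qed

lemma pmf_outward_count_0_pos: "pmf (outward_count d z) 0 > 0"
proof (induction d arbitrary: z)
  case (Suc d)
  have "0 \<in> set_pmf (outward_run z)" using pmf_outward_run_pos[of z 0] by (simp add: set_pmf_iff)
  moreover have "0 \<in> set_pmf (outward_count d (z - 1))" using Suc.IH[of "z - 1"] by (simp add: set_pmf_iff)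
  ultimately have "0 \<in> set_pmf (outward_count (Suc d) z)"
    by (auto intro!: bexI[of _ 0])
  then show ?case by (simp add: pmf_positive)
qed simp

text \<open>
  The difference chain \<open>eta\<close> is observed only after homeward jumps, so one step of it goes up by a
  run of outward jumps and then down by one.
\<close>

definition kern :: "int \<Rightarrow> int pmf" where
  "kern z = map_pmf (\<lambda>m. z + int m - 1) (outward_run z)"

primrec eta :: "nat \<Rightarrow> int pmf" where
  "eta 0 = return_pmf 0"
| "eta (Suc d) = eta d \<bind> kern"

text \<open>
  \<open>eta\<close> appends steps at the end, the count is defined by splitting off the first run; both
  are the \<open>d\<close>-fold iterate of the kernel, called \<open>it\<close> below.
\<close>

lemma eta_eq_outward_count: "eta d = map_pmf (\<lambda>y. int y - int d) (outward_count d 0)"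
proof -
  define it where "it = rec_nat return_pmf (\<lambda>_ f z. kern z \<bind> f)"
  have it0: "it 0 = return_pmf" and itS: "it (Suc d) z = kern z \<bind> it d" for d z
    by (simp_all add: it_def)
  have snoc: "it d z \<bind> kern = it (Suc d) z" for d z
  proof (induction d arbitrary: z)
    case 0
    then show ?case by (simp add: it0 itS bind_return_pmf bind_return_pmf')
  next
    case (Suc d)
    have "it (Suc d) z \<bind> kern = kern z \<bind> (\<lambda>x. it d x \<bind> kern)"
      by (simp add: itS bind_assoc_pmf)
    then show ?case by (simp only: Suc.IH itS[of _ z])
  qed
  have 1: "eta d = it d 0" for d
    by (induction d) (simp_all add: snoc it0)
  have 2: "it d z = map_pmf (\<lambda>y. z + int y - int d) (outward_count d z)" for z
  proof (induction d arbitrary: z)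
    case 0
    then show ?case by (simp add: it0)
  next
    case (Suc d)
    show ?case
      unfolding itS kern_def bind_map_pmf Suc.IH outward_count.simps map_bind_pmf pmf.map_comp
      by (intro bind_pmf_cong refl arg_cong2[where f = map_pmf]) (auto simp: fun_eq_iff)
  qed
  show ?thesis unfolding 1 2 by simp
qed

end

section \<open>Tightness and drift of the difference chain\<close>

context site_chain
begin

text \<open>
  Where outward jumps have probability at most \<open>\<alpha> < 1 / 2\<close> the exponential \<open>c powi z\<close> contracts.
  A run is compared with the geometric law of parameter \<open>\<alpha>\<close> through its first-jump recursion
  \<open>step\<close>; left of \<open>z0\<close> a run either
  ends before \<open>z0\<close> or reaches it, so there the bound is the constant \<open>c powi z0\<close>.
\<close>

lemma kern_exp_bound:
  obtains c \<kappa> b :: real where "1 < c" "0 \<le> \<kappa>" "\<kappa> < 1" "0 \<le> b"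
    "\<And>z. (\<integral>\<^sup>+x. ennreal (c powi x) \<partial>kern z) \<le> ennreal (\<kappa> * c powi z + b)"
proof -
  obtain z0 where z0: "p z0 < 1 / 2" using p_nonconst by blast
  define \<alpha> where "\<alpha> = p z0"
  have \<alpha>: "0 < \<alpha>" "\<alpha> < 1 / 2" using p_pos z0 by (auto simp: \<alpha>_def)
  \<comment> \<open>Any \<open>c\<close> between \<open>1\<close> and \<open>(1 - \<alpha>) / \<alpha>\<close> contracts; this one makes \<open>\<alpha> c = 1 / 2\<close>.\<close>
  define c where "c = 1 / (2 * \<alpha>)"
  define \<kappa> where "\<kappa> = 4 * \<alpha> * (1 - \<alpha>)"
  have c: "1 < c" using \<alpha> by (simp add: c_def)
  have \<kappa>0: "0 \<le> \<kappa>" using \<alpha> by (simp add: \<kappa>_def)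
  have "0 < (1 - 2 * \<alpha>)\<^sup>2" using \<alpha> by simp
  then have \<kappa>1: "\<kappa> < 1" by (simp add: \<kappa>_def power2_eq_square algebra_simps)
  have cm: "c powi (z - 1) = 2 * \<alpha> * c powi z" for z
    using c \<alpha> by (simp add: power_int_diff c_def)
  have cp: "c powi (z + 1) = c * c powi z" for z
    using c by (simp add: power_int_add)
  define h where "h z = (if z \<ge> z0 then \<kappa> * c powi z else c powi z0)" for z
  have h_le: "h z \<le> \<kappa> * c powi z + c powi z0" for z
    using c \<kappa>0 by (auto simp: h_def)
  have h_nn: "h z \<ge> 0" for z using c \<kappa>0 by (auto simp: h_def)
  have step: "(1 - p z) * c powi (z - 1) + p z * h (z + 1) \<le> h z" for z
  proof (cases "z \<ge> z0")
    case True
    have pz: "p z \<le> \<alpha>" using p_antimono[OF True] by (simp add: \<alpha>_def)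
    have lc: "\<kappa> * c = 2 * (1 - \<alpha>)" using \<alpha> by (simp add: \<kappa>_def c_def)
    have "(1 - p z) * c powi (z - 1) + p z * h (z + 1)
        = ((1 - p z) * (2 * \<alpha>) + p z * (\<kappa> * c)) * c powi z"
      using True by (simp add: h_def cm cp ring_distribs mult_ac)
    also have "(1 - p z) * (2 * \<alpha>) + p z * (\<kappa> * c) = 2 * \<alpha> + p z * (2 - 4 * \<alpha>)"
      unfolding lc by (simp add: algebra_simps)
    also have "\<dots> \<le> 2 * \<alpha> + \<alpha> * (2 - 4 * \<alpha>)"
      using pz \<alpha> by (intro add_left_mono mult_right_mono) auto
    also have "\<dots> = \<kappa>" by (simp add: \<kappa>_def algebra_simps)
    finally show ?thesis using True c by (simp add: h_def mult_right_mono)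
  next
    case False
    have "c powi (z - 1) \<le> c powi z0" using c False by (intro power_int_increasing) auto
    moreover have "h (z + 1) \<le> c powi z0"
    proof (cases "z + 1 \<ge> z0")
      case True
      with False have "z + 1 = z0" by simp
      then show ?thesis using \<kappa>1 c by (simp add: h_def mult_le_cancel_right1)
    qed (simp add: h_def)
    ultimately have "(1 - p z) * c powi (z - 1) + p z * h (z + 1)
        \<le> (1 - p z) * c powi z0 + p z * c powi z0"
      using p_pos[of z] p_less_1[of z] by (intro add_mono mult_left_mono) auto
    also have "\<dots> = c powi z0" by (simp add: algebra_simps)
    finally show ?thesis using False by (simp add: h_def)
  qed
  have S: "(\<Sum>m<n. pmf (outward_run z) m * c powi (z + int m - 1)) \<le> h z" for n z
  proof (induction n arbitrary: z)
    case (Suc n)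
    have "(\<Sum>m<Suc n. pmf (outward_run z) m * c powi (z + int m - 1))
        = (1 - p z) * c powi (z - 1) + p z * (\<Sum>m<n. pmf (outward_run (z + 1)) m * c powi (z + 1 + int m - 1))"
      unfolding sum.lessThan_Suc_shift
      by (simp add: pmf_outward_run_0 pmf_outward_run_Suc sum_distrib_left mult.assoc add.commute add.left_commute)
    also have "\<dots> \<le> (1 - p z) * c powi (z - 1) + p z * h (z + 1)"
      using Suc.IH[of "z + 1"] p_pos[of z] by (intro add_left_mono mult_left_mono) auto
    finally show ?case using step[of z] by simp
  qed (simp add: h_nn)
  have "(\<integral>\<^sup>+x. ennreal (c powi x) \<partial>kern z) \<le> ennreal (\<kappa> * c powi z + c powi z0)" for z
  proof -
    have "(\<integral>\<^sup>+x. ennreal (c powi x) \<partial>kern z)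
        = (\<Sum>m. ennreal (pmf (outward_run z) m * c powi (z + int m - 1)))"
      unfolding kern_def nn_integral_map_pmf
      using c by (subst nn_integral_measure_pmf) (simp add: nn_integral_count_space_nat ennreal_mult)
    also have "\<dots> \<le> ennreal (h z)"
    proof (rule suminf_le_const)
      show "summable (\<lambda>m. ennreal (pmf (outward_run z) m * c powi (z + int m - 1)))" by simp
      show "(\<Sum>m<n. ennreal (pmf (outward_run z) m * c powi (z + int m - 1))) \<le> ennreal (h z)" for n
        using S[where n = n and z = z] c by (subst sum_ennreal) (auto intro: ennreal_leI)
    qed
    also have "\<dots> \<le> ennreal (\<kappa> * c powi z + c powi z0)"
      by (rule ennreal_leI[OF h_le])
    finally show ?thesis .
  qed
  then show thesis using c \<kappa>0 \<kappa>1 by (intro that[of c \<kappa> "c powi z0"]) auto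
qed

lemma eta_exp_bound:
  obtains c B :: real where "1 < c" "0 \<le> B"
    "\<And>d. (\<integral>\<^sup>+x. ennreal (c powi x) \<partial>eta d) \<le> ennreal B"
proof -
  obtain c \<kappa> b :: real where c: "1 < c" "0 \<le> \<kappa>" "\<kappa> < 1" "0 \<le> b"
    and K: "\<And>z. (\<integral>\<^sup>+x. ennreal (c powi x) \<partial>kern z) \<le> ennreal (\<kappa> * c powi z + b)"
    using kern_exp_bound by blast
  \<comment> \<open>At least the value \<open>1\<close> at time \<open>0\<close>, and stable under \<open>B \<mapsto> \<kappa> B + b\<close>.\<close>
  define B where "B = 1 + b / (1 - \<kappa>)"
  have "(1 - \<kappa>) * B = (1 - \<kappa>) + b"
    using c by (simp add: B_def field_simps)
  then have "\<kappa> * B + b \<le> B"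
    using c by (simp add: algebra_simps)
  moreover have "1 \<le> B"
    using c by (simp add: B_def)
  ultimately have B: "1 \<le> B" "\<kappa> * B + b \<le> B"
    by auto
  have "(\<integral>\<^sup>+x. ennreal (c powi x) \<partial>eta d) \<le> ennreal B" for d
  proof (induction d)
    case 0
    then show ?case using B by simp
  next
    case (Suc d)
    have "(\<integral>\<^sup>+x. ennreal (c powi x) \<partial>eta (Suc d))
        \<le> (\<integral>\<^sup>+z. ennreal (\<kappa> * c powi z + b) \<partial>eta d)"
      by (auto intro!: nn_integral_mono K)
    also have "\<dots> = ennreal \<kappa> * (\<integral>\<^sup>+z. ennreal (c powi z) \<partial>eta d) + ennreal b"
      using c by (simp add: ennreal_mult nn_integral_add nn_integral_cmult)
    also have "\<dots> \<le> ennreal \<kappa> * ennreal B + ennreal b"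
      by (intro add_right_mono mult_left_mono Suc) simp
    also have "\<dots> = ennreal (\<kappa> * B + b)"
      using c B by (simp add: ennreal_mult)
    also have "\<dots> \<le> ennreal B" by (intro ennreal_leI B)
    finally show ?case .
  qed
  with B c show thesis by (intro that[of c B]) auto
qed

text \<open>
  The shape of the duality used from now on: the upper tail at time \<open>d\<close> is the lower tail, reflected
  about \<open>- 1 / 2\<close>, at another time.
\<close>

lemma eta_duality:
  "d + k > 0 \<Longrightarrow> measure_pmf.prob (eta d) {int k..} = measure_pmf.prob (eta (d + k)) {..- 1 - int k}"
proof -
  assume dk: "d + k > 0"
  have 1: "(\<lambda>y. int y - int d) -` {int k..} = {d + k..}" by auto
  have 2: "(\<lambda>y. int y - int (d + k)) -` {..- 1 - int k} = {..<d}" by auto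
  show ?thesis
    unfolding eta_eq_outward_count measure_map_pmf 1 2
    using outward_count_duality[of d "d + k" 0] dk by simp
qed

lemma eta_ge: "x \<in> set_pmf (eta d) \<Longrightarrow> x \<ge> - int d"
  by (auto simp: eta_eq_outward_count)

text \<open>
  Markov's inequality gives the upper tail, and the duality carries it over to the lower one.
\<close>

lemma eta_tails:
  obtains r B :: real where "0 < r" "r < 1" "0 \<le> B"
    "\<And>d k. measure_pmf.prob (eta d) {int k..} \<le> B * r ^ k"
    "\<And>d k. measure_pmf.prob (eta d) {..- 1 - int k} \<le> B * r ^ k"
proof -
  obtain c B :: real where c: "1 < c" "0 \<le> B"
    and E: "\<And>d. (\<integral>\<^sup>+x. ennreal (c powi x) \<partial>eta d) \<le> ennreal B"
    using eta_exp_bound by blast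
  define r where "r = 1 / c"
  have upper: "measure_pmf.prob (eta d) {int k..} \<le> B * r ^ k" for d k
  proof -
    have "ennreal (c ^ k * measure_pmf.prob (eta d) {int k..})
        = (\<integral>\<^sup>+x. ennreal (c ^ k) * indicator {int k..} x \<partial>eta d)"
      using c by (simp add: nn_integral_cmult_indicator measure_pmf.emeasure_eq_measure ennreal_mult)
    also have "\<dots> \<le> (\<integral>\<^sup>+x. ennreal (c powi x) \<partial>eta d)"
    proof (rule nn_integral_mono)
      fix x :: int
      have "c ^ k \<le> c powi x" if "int k \<le> x"
        using power_int_increasing[OF that, of c] c by simp
      then show "ennreal (c ^ k) * indicator {int k..} x \<le> ennreal (c powi x)"
        by (auto simp: indicator_def intro: ennreal_leI)
    qed
    also have "\<dots> \<le> ennreal B" by (rule E)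
    finally have "c ^ k * measure_pmf.prob (eta d) {int k..} \<le> B"
      using c by (simp add: ennreal_le_iff)
    then show ?thesis using c by (simp add: r_def field_simps)
  qed
  have lower: "measure_pmf.prob (eta d) {..- 1 - int k} \<le> B * r ^ k" for d k
  proof (cases "d = 0 \<or> d < k")
    case True
    then have "set_pmf (eta d) \<inter> {..- 1 - int k} = {}" using eta_ge[of _ d] by fastforce
    then have "measure_pmf.prob (eta d) {..- 1 - int k} = 0"
      by (simp add: measure_pmf_zero_iff)
    then show ?thesis using c by (simp add: r_def)
  next
    case False
    then have "measure_pmf.prob (eta (d - k)) {int k..} = measure_pmf.prob (eta d) {..- 1 - int k}"
      using eta_duality[of "d - k" k] by simp
    then show ?thesis using upper[of "d - k" k] by simp
  qed
  show thesis
    by (rule that[of r B]) (use c upper lower in \<open>auto simp: r_def\<close>)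
qed

text \<open>
  A coupling of \<open>eta d\<close> and \<open>eta (Suc d)\<close>: the two chains move independently until they meet and
  stay together afterwards.
\<close>

primrec joint :: "nat \<Rightarrow> (int \<times> int) pmf" where
  "joint 0 = map_pmf (Pair 0) (kern 0)"
| "joint (Suc d) = joint d \<bind> (\<lambda>(x, y). if x = y then map_pmf (\<lambda>z. (z, z)) (kern x)
     else pair_pmf (kern x) (kern y))"

lemma map_fst_joint: "map_pmf fst (joint d) = eta d"
proof (induction d)
  case 0
  then show ?case by (simp add: pmf.map_comp o_def)
next
  case (Suc d)
  have "map_pmf fst (joint (Suc d)) = joint d \<bind> (\<lambda>xy. kern (fst xy))"
    unfolding joint.simps map_bind_pmf
    by (intro bind_pmf_cong refl) (auto simp: pmf.map_comp o_def map_fst_pair_pmf split: prod.splits)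
  also have "\<dots> = eta (Suc d)" by (simp add: Suc[symmetric] bind_map_pmf)
  finally show ?case .
qed

lemma map_snd_joint: "map_pmf snd (joint d) = eta (Suc d)"
proof (induction d)
  case 0
  then show ?case by (simp add: pmf.map_comp o_def bind_return_pmf)
next
  case (Suc d)
  have "map_pmf snd (joint (Suc d)) = joint d \<bind> (\<lambda>xy. kern (snd xy))"
    unfolding joint.simps map_bind_pmf
    by (intro bind_pmf_cong refl) (auto simp: pmf.map_comp o_def map_snd_pair_pmf split: prod.splits)
  also have "\<dots> = eta (Suc (Suc d))"
    unfolding eta.simps(2)[of "Suc d"] Suc[symmetric] by (simp add: bind_map_pmf)
  finally show ?case .
qed


text \<open>
  From anywhere in \<open>[-R, R]\<close> both chains can reach \<open>R\<close> in one step, since runs of every length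
  have positive probability; \<open>\<alpha>\<close> is the least probability that they both do so.
\<close>

lemma joint_unequal_step:
  fixes R :: nat
  obtains \<alpha> where "0 < \<alpha>" "\<alpha> \<le> 1"
    "\<And>d. measure_pmf.prob (joint (Suc d)) {(x, y). x \<noteq> y}
       \<le> measure_pmf.prob (joint d) {(x, y). x \<noteq> y}
         - \<alpha> * measure_pmf.prob (joint d) {(x, y). x \<noteq> y \<and> \<bar>x\<bar> \<le> int R \<and> \<bar>y\<bar> \<le> int R}"
proof -
  define D where "D = {- int R..int R} \<times> {- int R..int R}"
  have D: "finite D" "D \<noteq> {}" by (auto simp: D_def)
  define f where "f = (\<lambda>(x, y). pmf (kern x) (int R) * pmf (kern y) (int R))"
  define \<alpha> where "\<alpha> = Min (f ` D)"
  have kpos: "pmf (kern x) (int R) > 0" if "x \<le> int R" for x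
  proof -
    have "nat (int R + 1 - x) \<in> set_pmf (outward_run x)"
      using pmf_outward_run_pos by (simp add: set_pmf_iff less_imp_neq[symmetric])
    then have "int R \<in> set_pmf (kern x)"
      using that by (auto simp: kern_def intro!: image_eqI[of _ _ "nat (int R + 1 - x)"])
    then show ?thesis by (simp add: pmf_positive)
  qed
  have fpos: "f xy > 0" if "xy \<in> D" for xy
    using that by (auto simp: f_def D_def intro!: mult_pos_pos kpos)
  have \<alpha>_pos: "0 < \<alpha>" using D fpos by (simp add: \<alpha>_def)
  have \<alpha>_le: "\<alpha> \<le> f xy" if "xy \<in> D" for xy using D that by (simp add: \<alpha>_def)
  have "\<alpha> \<le> f (0, 0)" by (rule \<alpha>_le) (simp add: D_def)
  also have "\<dots> \<le> 1" unfolding f_def by (auto intro!: mult_le_one simp: pmf_le_1)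
  finally have \<alpha>1: "\<alpha> \<le> 1" .
  have "measure_pmf.prob (joint (Suc d)) {(x, y). x \<noteq> y}
       \<le> measure_pmf.prob (joint d) {(x, y). x \<noteq> y}
         - \<alpha> * measure_pmf.prob (joint d) {(x, y). x \<noteq> y \<and> \<bar>x\<bar> \<le> int R \<and> \<bar>y\<bar> \<le> int R}" for d
  proof -
    let ?N = "{(x, y). x \<noteq> (y :: int)}"
    let ?C = "{(x, y). x \<noteq> y \<and> \<bar>x\<bar> \<le> int R \<and> \<bar>y\<bar> \<le> int R}"
    let ?g = "\<lambda>xy. (case xy of (x, y) \<Rightarrow> if x = y then map_pmf (\<lambda>z. (z, z)) (kern x)
        else pair_pmf (kern x) (kern y)) :: (int \<times> int) pmf"
    have bnd: "measure_pmf.prob (?g xy) ?N \<le> indicat_real ?N xy - \<alpha> * indicat_real ?C xy" for xy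
    proof (cases xy)
      case (Pair x y)
      show ?thesis
      proof (cases "x = y")
        case True
        then show ?thesis by (simp add: Pair measure_map_pmf vimage_def)
      next
        case False
        show ?thesis
        proof (cases "(x, y) \<in> D")
          case True
          have "measure_pmf.prob (pair_pmf (kern x) (kern y)) ?N
              \<le> measure_pmf.prob (pair_pmf (kern x) (kern y)) (- {(int R, int R)})"
            by (intro measure_pmf.finite_measure_mono) auto
          also have "\<dots> = 1 - pmf (pair_pmf (kern x) (kern y)) (int R, int R)"
            by (simp add: measure_pmf.prob_compl[of _ "pair_pmf (kern x) (kern y)", simplified] Compl_eq_Diff_UNIV measure_pmf_single)
          also have "\<dots> \<le> 1 - \<alpha>"
            using \<alpha>_le[OF True] by (simp add: pmf_pair f_def)
          finally show ?thesis using False True by (auto simp: Pair D_def indicator_def abs_le_iff)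
        next
          case nD: False
          then show ?thesis using False by (auto simp: Pair indicator_def D_def)
        qed
      qed
    qed
    have "measure_pmf.prob (joint (Suc d)) ?N = (\<integral>xy. measure_pmf.prob (?g xy) ?N \<partial>joint d)"
      by (simp add: prob_bind_pmf)
    also have "\<dots> \<le> (\<integral>xy. indicat_real ?N xy - \<alpha> * indicat_real ?C xy \<partial>joint d)"
      by (intro integral_mono bnd measure_pmf.integrable_const_bound[where B = 1] Bochner_Integration.integrable_diff
           integrable_mult_right) (auto)
    also have "\<dots> = measure_pmf.prob (joint d) ?N - \<alpha> * measure_pmf.prob (joint d) ?C"
      by (subst Bochner_Integration.integral_diff)
        (auto intro!: integrable_mult_right measure_pmf.integrable_const_bound[where B = 1])
    finally show ?thesis .
  qed
  with \<alpha>_pos \<alpha>1 show thesis by (rule that)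
qed

text \<open>
  Tightness keeps both chains in a bounded window up to probability \<open>e / 2\<close>, and inside the window
  they meet with probability at least \<open>\<alpha>\<close> at each step.
\<close>

lemma joint_unequal_tendsto_0:
  "(\<lambda>d. measure_pmf.prob (joint d) {(x, y). x \<noteq> y}) \<longlonglongrightarrow> 0"
proof -
  define t where "t d = measure_pmf.prob (joint d) {(x, y). x \<noteq> y}" for d
  obtain r B :: real where r: "0 < r" "r < 1" "0 \<le> B"
    and up: "\<And>d k. measure_pmf.prob (eta d) {int k..} \<le> B * r ^ k"
    and low: "\<And>d k. measure_pmf.prob (eta d) {..- 1 - int k} \<le> B * r ^ k"
    using eta_tails by blast
  have out: "measure_pmf.prob (eta d) {x. \<bar>x\<bar> > int R} \<le> 2 * B * r ^ R" for d R
  proof -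
    have "measure_pmf.prob (eta d) {x. \<bar>x\<bar> > int R}
        \<le> measure_pmf.prob (eta d) ({int R..} \<union> {..- 1 - int R})"
      by (intro measure_pmf.finite_measure_mono) auto
    also have "\<dots> \<le> measure_pmf.prob (eta d) {int R..} + measure_pmf.prob (eta d) {..- 1 - int R}"
      by (intro measure_Un_le) auto
    finally show ?thesis using up[of d R] low[of d R] by simp
  qed
  have "\<exists>n0. \<forall>n\<ge>n0. t n < e" if "e > 0" for e
  proof -
    have "(\<lambda>R. 4 * B * r ^ R) \<longlonglongrightarrow> 4 * B * 0"
      using r by (intro tendsto_mult_left LIMSEQ_power_zero) auto
    then have "\<forall>\<^sub>F R in sequentially. 4 * B * r ^ R < e / 2"
      using \<open>e > 0\<close> by (intro order_tendstoD) auto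
    then obtain R where R: "4 * B * r ^ R < e / 2"
      by (auto simp: eventually_sequentially)
    obtain \<alpha> where \<alpha>: "0 < \<alpha>" "\<alpha> \<le> 1"
      and step: "\<And>d. t (Suc d) \<le> t d - \<alpha> * measure_pmf.prob (joint d)
          {(x, y). x \<noteq> y \<and> \<bar>x\<bar> \<le> int R \<and> \<bar>y\<bar> \<le> int R}"
      unfolding t_def using joint_unequal_step[of R] by blast
    have t_le: "t d \<le> measure_pmf.prob (joint d) {(x, y). x \<noteq> y \<and> \<bar>x\<bar> \<le> int R \<and> \<bar>y\<bar> \<le> int R} + e / 2" for d
    proof -
      let ?C = "{(x, y). x \<noteq> y \<and> \<bar>x\<bar> \<le> int R \<and> \<bar>y\<bar> \<le> int R}"
      let ?U = "fst -` {x. \<bar>x\<bar> > int R} :: (int \<times> int) set" and ?V = "snd -` {x. \<bar>x\<bar> > int R} :: (int \<times> int) set"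
      have "t d \<le> measure_pmf.prob (joint d) (?C \<union> (?U \<union> ?V))"
        unfolding t_def by (intro measure_pmf.finite_measure_mono) auto
      also have "\<dots> \<le> measure_pmf.prob (joint d) ?C + measure_pmf.prob (joint d) (?U \<union> ?V)"
        by (intro measure_Un_le) auto
      also have "measure_pmf.prob (joint d) (?U \<union> ?V)
          \<le> measure_pmf.prob (joint d) ?U + measure_pmf.prob (joint d) ?V"
        by (intro measure_Un_le) auto
      also have "measure_pmf.prob (joint d) ?U \<le> 2 * B * r ^ R"
        using out[of d R] unfolding map_fst_joint[symmetric] measure_map_pmf .
      also have "measure_pmf.prob (joint d) ?V \<le> 2 * B * r ^ R"
        using out[of "Suc d" R] unfolding map_snd_joint[symmetric] measure_map_pmf .
      finally show ?thesis using R by simp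
    qed
    have decay: "t d - e / 2 \<le> (1 - \<alpha>) ^ d" for d
    proof (induction d)
      case 0
      have "t 0 \<le> 1" by (simp only: t_def measure_pmf.prob_le_1)
      then show ?case using \<open>e > 0\<close> by simp
    next
      case (Suc d)
      have "t (Suc d) \<le> t d - \<alpha> * (t d - e / 2)"
        using step[of d] mult_left_mono[OF t_le[of d], of \<alpha>] \<alpha> by (simp add: algebra_simps)
      then have "t (Suc d) - e / 2 \<le> (1 - \<alpha>) * (t d - e / 2)"
        by (simp add: field_simps)
      also have "\<dots> \<le> (1 - \<alpha>) * (1 - \<alpha>) ^ d"
        using Suc \<alpha> by (intro mult_left_mono) auto
      finally show ?case by simp
    qed
    have "(\<lambda>d. (1 - \<alpha>) ^ d) \<longlonglongrightarrow> 0"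
      using \<alpha> by (intro LIMSEQ_power_zero) auto
    then have "\<forall>\<^sub>F d in sequentially. (1 - \<alpha>) ^ d < e / 2"
      using \<open>e > 0\<close> by (intro order_tendstoD) auto
    then obtain n0 where "\<And>d. d \<ge> n0 \<Longrightarrow> (1 - \<alpha>) ^ d < e / 2"
      by (auto simp: eventually_sequentially)
    then have "t d < e" if "d \<ge> n0" for d
      using decay[of d] that by force
    then show ?thesis by blast
  qed
  then have "t \<longlonglongrightarrow> 0"
    unfolding LIMSEQ_iff by (auto simp: t_def)
  then show ?thesis by (simp add: t_def[abs_def])
qed

lemma eta_slowly_varying:
  "\<bar>measure_pmf.prob (eta (Suc d)) S - measure_pmf.prob (eta d) S\<bar>
    \<le> measure_pmf.prob (joint d) {(x, y). x \<noteq> y}"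
proof -
  let ?N = "{(x, y). x \<noteq> (y :: int)}"
  have "measure_pmf.prob (joint d) (fst -` S) \<le> measure_pmf.prob (joint d) (snd -` S \<union> ?N)"
    by (intro measure_pmf.finite_measure_mono) auto
  also have "\<dots> \<le> measure_pmf.prob (joint d) (snd -` S) + measure_pmf.prob (joint d) ?N"
    by (intro measure_Un_le) auto
  finally have 1: "measure_pmf.prob (eta d) S \<le> measure_pmf.prob (eta (Suc d)) S + measure_pmf.prob (joint d) ?N"
    by (simp only: map_fst_joint[symmetric, of d] map_snd_joint[symmetric] measure_map_pmf)
  have "measure_pmf.prob (joint d) (snd -` S) \<le> measure_pmf.prob (joint d) (fst -` S \<union> ?N)"
    by (intro measure_pmf.finite_measure_mono) auto
  also have "\<dots> \<le> measure_pmf.prob (joint d) (fst -` S) + measure_pmf.prob (joint d) ?N"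
    by (intro measure_Un_le) auto
  finally have 2: "measure_pmf.prob (eta (Suc d)) S \<le> measure_pmf.prob (eta d) S + measure_pmf.prob (joint d) ?N"
    by (simp only: map_fst_joint[symmetric, of d] map_snd_joint[symmetric] measure_map_pmf)
  show ?thesis using 1 2 by linarith
qed


text \<open>
  Write the mean as the sum of the upper tails minus the sum of the lower tails \<open>F d k\<close>. Duality
  turns the former into lower tails at later times, shifted by one; if the law did not depend on
  time, everything would telescope to \<open>- F d 0 = - 1 / 2\<close>. The differences \<open>\<delta> k d\<close> left
  over vanish by slow variation, and their sum by dominated convergence.
\<close>

lemma eta_mean_tendsto:
  "(\<lambda>d. measure_pmf.expectation (eta d) real_of_int) \<longlonglongrightarrow> - 1 / 2"
  "integrable (measure_pmf (eta d)) real_of_int"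
proof -
  obtain r B :: real where r: "0 < r" "r < 1" "0 \<le> B"
    and up: "\<And>d k. measure_pmf.prob (eta d) {int k..} \<le> B * r ^ k"
    and low: "\<And>d k. measure_pmf.prob (eta d) {..- 1 - int k} \<le> B * r ^ k"
    using eta_tails by blast
  define P where "P d k = measure_pmf.prob (eta d) {int k + 1..}" for d k :: nat
  define F where "F d k = measure_pmf.prob (eta d) {..- 1 - int k}" for d k :: nat
  have sr: "summable (\<lambda>k. B * r ^ k)" using r by (intro summable_mult summable_geometric) auto
  have P_le: "P d k \<le> B * r ^ k" for d k
    unfolding P_def by (rule order_trans[OF measure_pmf.finite_measure_mono up[of d k]]) auto
  have F_le: "F d k \<le> B * r ^ k" for d k
    unfolding F_def by (rule low)
  have sP: "summable (P d)" for d
    by (rule summable_comparison_test'[OF sr, of 0]) (use P_le in \<open>auto simp: P_def\<close>)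
  have sF: "summable (F d)" for d
    by (rule summable_comparison_test'[OF sr, of 0]) (use F_le in \<open>auto simp: F_def\<close>)
  have posI: "(\<integral>\<^sup>+x. ennreal (real (nat x)) \<partial>eta d) = ennreal (suminf (P d))" for d
  proof -
    have "(\<integral>\<^sup>+x. ennreal (real (nat x)) \<partial>eta d) = (\<integral>\<^sup>+x. of_nat (nat x) \<partial>eta d)"
      by (simp add: ennreal_of_nat_eq_real_of_nat)
    also have "\<dots> = (\<Sum>t. emeasure (eta d) {x\<in>space (eta d). t < nat x})"
      by (rule nn_integral_nat_function) simp
    also have "\<dots> = (\<Sum>t. ennreal (P d t))"
      by (auto intro!: suminf_cong arg_cong[where f = "measure_pmf.prob (eta d)"]
          simp: P_def measure_pmf.emeasure_eq_measure)
    also have "\<dots> = ennreal (suminf (P d))"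
      by (intro suminf_ennreal2 sP) (simp add: P_def)
    finally show ?thesis .
  qed
  have negI: "(\<integral>\<^sup>+x. ennreal (real (nat (- x))) \<partial>eta d) = ennreal (suminf (F d))" for d
  proof -
    have "(\<integral>\<^sup>+x. ennreal (real (nat (- x))) \<partial>eta d) = (\<integral>\<^sup>+x. of_nat (nat (- x)) \<partial>eta d)"
      by (simp add: ennreal_of_nat_eq_real_of_nat)
    also have "\<dots> = (\<Sum>t. emeasure (eta d) {x\<in>space (eta d). t < nat (- x)})"
      by (rule nn_integral_nat_function) simp
    also have "\<dots> = (\<Sum>t. ennreal (F d t))"
      by (auto intro!: suminf_cong arg_cong[where f = "measure_pmf.prob (eta d)"]
          simp: F_def measure_pmf.emeasure_eq_measure)
    also have "\<dots> = ennreal (suminf (F d))"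
      by (intro suminf_ennreal2 sF) (simp add: F_def)
    finally show ?thesis .
  qed
  have hP: "has_bochner_integral (eta d) (\<lambda>x. real (nat x)) (suminf (P d))" for d
    by (intro has_bochner_integral_nn_integral posI) (auto intro!: suminf_nonneg sP simp: P_def)
  have hF: "has_bochner_integral (eta d) (\<lambda>x. real (nat (- x))) (suminf (F d))" for d
    by (intro has_bochner_integral_nn_integral negI) (auto intro!: suminf_nonneg sF simp: F_def)
  have "(\<lambda>x. real (nat x) - real (nat (- x))) = real_of_int"
    by (auto simp: fun_eq_iff)
  then have h: "has_bochner_integral (eta d) real_of_int (suminf (P d) - suminf (F d))" for d
    using has_bochner_integral_diff[OF hP[of d] hF[of d]] by simp
  then show "integrable (measure_pmf (eta d)) real_of_int"
    by (blast intro: integrable.intros)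
  have P_eq: "P d k = F (d + Suc k) (Suc k)" for d k
    using eta_duality[of d "Suc k"] by (simp add: P_def F_def add.commute)
  have F0: "F d 0 = 1 / 2" if "d > 0" for d
  proof -
    have "F d 0 = measure_pmf.prob (eta d) {0..}"
      using eta_duality[of d 0] that by (simp add: F_def)
    also have "\<dots> = measure_pmf.prob (eta d) (- {..- 1})"
      by (intro arg_cong[where f = "measure_pmf.prob (eta d)"]) auto
    also have "\<dots> = 1 - F d 0"
      using measure_pmf.prob_compl[of "{..- 1 :: int}" "eta d"] by (simp add: F_def Compl_eq_Diff_UNIV)
    finally show ?thesis by simp
  qed
  \<comment> \<open>Duality replaces the upper tail \<open>P d k\<close> by \<open>F (d + Suc k) (Suc k)\<close>.\<close>
  define \<delta> where "\<delta> k d = F (d + Suc k) (Suc k) - F d (Suc k)" for k d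
  have mean: "measure_pmf.expectation (eta d) real_of_int = (\<Sum>k. \<delta> k d) - 1 / 2" if "d > 0" for d
  proof -
    have s\<delta>: "summable (\<lambda>k. \<delta> k d)"
      unfolding \<delta>_def P_eq[symmetric] by (intro summable_diff sP) (simp add: summable_Suc_iff sF)
    have "measure_pmf.expectation (eta d) real_of_int = suminf (P d) - suminf (F d)"
      by (rule has_bochner_integral_integral_eq[OF h])
    also have "suminf (F d) = (\<Sum>k. F d (Suc k)) + 1 / 2"
      using suminf_split_head[OF sF[of d]] F0[OF that] by simp
    also have "suminf (P d) - ((\<Sum>k. F d (Suc k)) + 1 / 2) = (\<Sum>k. P d k - F d (Suc k)) - 1 / 2"
      using suminf_diff[OF sP[of d], of "\<lambda>k. F d (Suc k)"] sF[of d] by (simp add: summable_Suc_iff)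
    finally show ?thesis by (simp add: \<delta>_def P_eq)
  qed
  have \<delta>_lim: "(\<lambda>d. \<delta> k d) \<longlonglongrightarrow> 0" for k
  proof -
    have shift: "(\<lambda>d. F (d + n) (Suc k) - F d (Suc k)) \<longlonglongrightarrow> 0" for n
    proof (induction n)
      case (Suc n)
      have "(\<lambda>d. F (Suc (d + n)) (Suc k) - F (d + n) (Suc k)) \<longlonglongrightarrow> 0"
      proof (rule Lim_null_comparison)
        show "\<forall>\<^sub>F d in sequentially. norm (F (Suc (d + n)) (Suc k) - F (d + n) (Suc k))
            \<le> measure_pmf.prob (joint (d + n)) {(x, y). x \<noteq> y}"
          unfolding F_def using eta_slowly_varying by (auto intro!: always_eventually)
        show "(\<lambda>d. measure_pmf.prob (joint (d + n)) {(x, y). x \<noteq> y}) \<longlonglongrightarrow> 0"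
          by (rule LIMSEQ_ignore_initial_segment[OF joint_unequal_tendsto_0])
      qed
      from tendsto_add[OF this Suc.IH] show ?case by simp
    qed simp
    show ?thesis unfolding \<delta>_def by (rule shift)
  qed
  have "(\<lambda>d. \<Sum>k. \<delta> k d) \<longlonglongrightarrow> (\<Sum>k. 0)"
  proof (rule tannerys_theorem[THEN conjunct2, THEN conjunct2])
    show "\<forall>\<^sub>F (k, n) in at_top \<times>\<^sub>F sequentially. norm (\<delta> k n) \<le> B * r ^ k"
    proof (intro always_eventually allI, clarify)
      fix k d :: nat
      have "\<bar>\<delta> k d\<bar> \<le> max (F (d + Suc k) (Suc k)) (F d (Suc k))"
        by (simp add: \<delta>_def F_def abs_le_iff)
          (smt (verit) measure_nonneg)
      also have "\<dots> \<le> B * r ^ Suc k" by (intro max.boundedI F_le)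
      also have "\<dots> \<le> B * r ^ k" using r by (intro mult_left_mono power_decreasing) auto
      finally show "norm (\<delta> k d) \<le> B * r ^ k" by simp
    qed
  qed (use sr \<delta>_lim in auto)
  then have "(\<lambda>d. (\<Sum>k. \<delta> k d) - 1 / 2) \<longlonglongrightarrow> 0 - 1 / 2"
    by (intro tendsto_diff tendsto_const) simp
  moreover have "\<forall>\<^sub>F d in sequentially. (\<Sum>k. \<delta> k d) - 1 / 2 = measure_pmf.expectation (eta d) real_of_int"
    using eventually_gt_at_top[of 0] by eventually_elim (simp add: mean)
  ultimately show "(\<lambda>d. measure_pmf.expectation (eta d) real_of_int) \<longlonglongrightarrow> - 1 / 2"
    using Lim_transform_eventually by fastforce
qed

lemma eta_second_moment:
  obtains C where "\<And>d. (\<integral>\<^sup>+x. ennreal ((real_of_int x)\<^sup>2) \<partial>eta d) \<le> ennreal C"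
proof -
  obtain r B :: real where r: "0 < r" "r < 1" "0 \<le> B"
    and up: "\<And>d k. measure_pmf.prob (eta d) {int k..} \<le> B * r ^ k"
    and low: "\<And>d k. measure_pmf.prob (eta d) {..- 1 - int k} \<le> B * r ^ k"
    using eta_tails by blast
  define b where "b k = (2 * real k + 1) * (2 * B * r ^ k)" for k
  have sb: "summable b"
  proof -
    have "summable (\<lambda>k. of_nat (Suc k) * r ^ k)"
      using geometric_deriv_sums[of r] r by (auto intro: sums_summable)
    moreover have "summable (\<lambda>k. r ^ k)"
      using r by (intro summable_geometric) auto
    ultimately have "summable (\<lambda>k. 4 * B * (of_nat (Suc k) * r ^ k) - 2 * B * r ^ k)"
      by (intro summable_diff summable_mult)
    then show ?thesis by (simp add: b_def[abs_def] algebra_simps)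
  qed
  \<comment> \<open>The square of \<open>n\<close> is the sum of the first \<open>n\<close> odd numbers.\<close>
  have sq: "ennreal ((real_of_int x)\<^sup>2) = (\<Sum>k. ennreal (2 * real k + 1) * indicator {x. \<bar>x\<bar> > int k} x)" for x
  proof -
    have "(\<Sum>k. ennreal (2 * real k + 1) * indicator {x. \<bar>x\<bar> > int k} x)
        = (\<Sum>k<nat \<bar>x\<bar>. ennreal (2 * real k + 1) * indicator {x. \<bar>x\<bar> > int k} x)"
      by (intro suminf_finite) (auto simp: indicator_def)
    also have "\<dots> = (\<Sum>k<nat \<bar>x\<bar>. ennreal (2 * real k + 1))"
      by (intro sum.cong) (auto simp: indicator_def)
    also have "\<dots> = ennreal (\<Sum>k<nat \<bar>x\<bar>. 2 * real k + 1)"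
      by (rule sum_ennreal) auto
    also have "(\<Sum>k<n. 2 * real k + 1) = (real n)\<^sup>2" for n
      by (induction n) (auto simp: power2_eq_square algebra_simps)
    also have "(real (nat \<bar>x\<bar>))\<^sup>2 = (real_of_int x)\<^sup>2" by simp
    finally show ?thesis by simp
  qed
  have "(\<integral>\<^sup>+x. ennreal ((real_of_int x)\<^sup>2) \<partial>eta d) \<le> ennreal (suminf b)" for d
  proof -
    have "(\<integral>\<^sup>+x. ennreal ((real_of_int x)\<^sup>2) \<partial>eta d)
        = (\<Sum>k. ennreal (2 * real k + 1) * emeasure (eta d) {x. \<bar>x\<bar> > int k})"
      unfolding sq by (subst nn_integral_suminf) (auto simp: nn_integral_cmult_indicator)
    also have "\<dots> \<le> (\<Sum>k. ennreal (b k))"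
    proof (rule suminf_le)
      fix k
      have "measure_pmf.prob (eta d) {x. \<bar>x\<bar> > int k}
          \<le> measure_pmf.prob (eta d) ({int k..} \<union> {..- 1 - int k})"
        by (intro measure_pmf.finite_measure_mono) auto
      also have "\<dots> \<le> measure_pmf.prob (eta d) {int k..} + measure_pmf.prob (eta d) {..- 1 - int k}"
        by (intro measure_Un_le) auto
      finally have "measure_pmf.prob (eta d) {x. \<bar>x\<bar> > int k} \<le> 2 * B * r ^ k"
        using up[of d k] low[of d k] by simp
      then have "ennreal ((2 * real k + 1) * measure_pmf.prob (eta d) {x. \<bar>x\<bar> > int k}) \<le> ennreal (b k)"
        unfolding b_def by (intro ennreal_leI mult_left_mono) auto
      then show "ennreal (2 * real k + 1) * emeasure (eta d) {x. \<bar>x\<bar> > int k} \<le> ennreal (b k)"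
        by (simp add: measure_pmf.emeasure_eq_measure ennreal_mult)
    qed auto
    also have "\<dots> = ennreal (suminf b)"
      using r by (intro suminf_ennreal2 sb) (simp add: b_def)
    finally show ?thesis .
  qed
  then show thesis by (rule that)
qed

end

section \<open>The chain of jump counts from site to site\<close>

lemma expectation_affine_combination:
  fixes f g :: "'b \<Rightarrow> real" and M :: "'b pmf"
  assumes "integrable (measure_pmf M) f" "integrable (measure_pmf M) g"
  shows "measure_pmf.expectation M (\<lambda>x. f x + (c * g x + k))
       = measure_pmf.expectation M f + (c * measure_pmf.expectation M g + k)"
  using assms by simp

text \<open>
  All that is used about a single site: \<open>\<kappa> d\<close> is the law of the number of outward jumps given
  \<open>d\<close> homeward ones.
\<close>

locale level_chain =
  fixes \<kappa> :: "nat \<Rightarrow> nat pmf"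
  assumes absorbing: "\<kappa> 0 = return_pmf 0"
    and extinction_pos: "pmf (\<kappa> d) 0 > 0"
    and second_moment: "\<exists>C. \<forall>d. (\<integral>\<^sup>+y. ennreal ((real y - real d)\<^sup>2) \<partial>\<kappa> d) \<le> ennreal C"
    and drift_tendsto: "(\<lambda>d. measure_pmf.expectation (\<kappa> d) real - real d) \<longlonglongrightarrow> - 1 / 2"
begin

definition drift :: "nat \<Rightarrow> real" where
  "drift d = measure_pmf.expectation (\<kappa> d) real - real d"

lemma drift_bounded: obtains C where "C \<ge> 0" "\<And>d. \<bar>drift d\<bar> \<le> C"
proof -
  have "Bseq drift"
    using drift_tendsto unfolding drift_def[abs_def] by (intro convergent_imp_Bseq) (auto simp: convergent_def)
  then show thesis using that by (auto simp: Bseq_def intro: less_imp_le)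
qed

lemma variance_bound:
  obtains C where "C \<ge> 0"
    "\<And>a d. integrable (measure_pmf (\<kappa> d)) (\<lambda>y. (a + (real y - real d - drift d))\<^sup>2)"
    "\<And>a d. measure_pmf.expectation (\<kappa> d) (\<lambda>y. (a + (real y - real d - drift d))\<^sup>2) \<le> a\<^sup>2 + C"
proof -
  obtain C where C: "\<And>d. (\<integral>\<^sup>+y. ennreal ((real y - real d)\<^sup>2) \<partial>\<kappa> d) \<le> ennreal C"
    using second_moment by blast
  have i2: "integrable (measure_pmf (\<kappa> d)) (\<lambda>y. (real y - real d)\<^sup>2)" for d
    by (rule integrableI_nonneg) (auto intro: le_less_trans[OF C])
  have i1: "integrable (measure_pmf (\<kappa> d)) (\<lambda>y. real y - real d)" for d
    by (rule measure_pmf.square_integrable_imp_integrable[OF _ i2]) auto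
  have ir: "integrable (measure_pmf (\<kappa> d)) real" for d
  proof -
    have "integrable (measure_pmf (\<kappa> d)) (\<lambda>y. (real y - real d) + real d)"
      by (intro Bochner_Integration.integrable_add i1) simp
    then show ?thesis by simp
  qed
  have e1: "measure_pmf.expectation (\<kappa> d) (\<lambda>y. real y - real d) = drift d" for d
    by (simp add: drift_def Bochner_Integration.integral_diff ir)
  have e2: "measure_pmf.expectation (\<kappa> d) (\<lambda>y. (real y - real d)\<^sup>2) \<le> max C 0" for d
  proof -
    have "ennreal (measure_pmf.expectation (\<kappa> d) (\<lambda>y. (real y - real d)\<^sup>2)) \<le> ennreal C"
      using C[of d] by (subst nn_integral_eq_integral[symmetric, OF i2]) auto
    then show ?thesis by (cases "C \<ge> 0") (auto simp: ennreal_neg)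
  qed
  have sq: "(\<lambda>y. (a + (real y - real d - drift d))\<^sup>2)
     = (\<lambda>y. (real y - real d)\<^sup>2 + (2 * (a - drift d) * (real y - real d) + (a - drift d)\<^sup>2))" for a d
    by (auto simp: fun_eq_iff power2_eq_square algebra_simps)
  have int: "integrable (measure_pmf (\<kappa> d)) (\<lambda>y. (a + (real y - real d - drift d))\<^sup>2)" for a d
    unfolding sq by (intro Bochner_Integration.integrable_add i2 integrable_mult_right i1) auto
  have "measure_pmf.expectation (\<kappa> d) (\<lambda>y. (a + (real y - real d - drift d))\<^sup>2) \<le> a\<^sup>2 + max C 0" for a d
  proof -
    have "measure_pmf.expectation (\<kappa> d) (\<lambda>y. (a + (real y - real d - drift d))\<^sup>2)
        = measure_pmf.expectation (\<kappa> d) (\<lambda>y. (real y - real d)\<^sup>2) + (2 * (a - drift d) * drift d + (a - drift d)\<^sup>2)"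
      unfolding sq expectation_affine_combination[OF i2 i1] e1 ..
    also have "2 * (a - drift d) * drift d + (a - drift d)\<^sup>2 = a\<^sup>2 - (drift d)\<^sup>2"
      by (simp add: power2_eq_square algebra_simps)
    finally show ?thesis using e2[of d] by (smt (verit) zero_le_power2)
  qed
  then show thesis using int by (intro that[of "max C 0"]) auto
qed

text \<open>
  The values of the chain at the next \<open>n\<close> sites, of which the first \<open>L\<close> receive one extra jump.
\<close>

primrec level_path :: "nat \<Rightarrow> nat \<Rightarrow> nat \<Rightarrow> nat list pmf" where
  "level_path 0 L d = return_pmf []"
| "level_path (Suc n) L d =
     map_pmf (\<lambda>y. y + of_bool (L > 0)) (\<kappa> d) \<bind> (\<lambda>z. map_pmf (Cons z) (level_path n (L - 1) z))"

lemma set_level_path: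
  "zs \<in> set_pmf (level_path n L d) \<Longrightarrow>
     length zs = n \<and> (\<forall>i<n. L \<le> i \<and> (d # zs) ! i = 0 \<longrightarrow> (d # zs) ! Suc i = 0)"
proof (induction n arbitrary: L d zs)
  case (Suc n)
  then obtain y zs' where y: "y \<in> set_pmf (\<kappa> d)" and zs': "zs' \<in> set_pmf (level_path n (L - 1) (y + of_bool (L > 0)))"
    and zs: "zs = (y + of_bool (L > 0)) # zs'" by auto
  have "(d # zs) ! Suc i = 0" if "i < Suc n" "L \<le> i" "(d # zs) ! i = 0" for i
  proof (cases i)
    case 0
    with that y show ?thesis by (auto simp: zs absorbing)
  next
    case (Suc i')
    with that Suc.IH[OF zs'] show ?thesis by (auto simp: zs)
  qed
  with Suc.IH[OF zs'] show ?case by (simp add: zs)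
qed simp

text \<open>
  The martingale part of the chain, read off from its path.
\<close>

definition deviation :: "nat \<Rightarrow> nat \<Rightarrow> nat list \<Rightarrow> nat \<Rightarrow> real" where
  "deviation L d zs i = real ((d # zs) ! i) - real d - real (min i L) - (\<Sum>t<i. drift ((d # zs) ! t))"

lemma deviation_0: "deviation L d zs 0 = 0"
  by (simp add: deviation_def)

lemma deviation_Suc:
  "deviation L d (z # zs) (Suc i) = (real z - of_bool (L > 0) - real d - drift d) + deviation (L - 1) z zs i"
  unfolding deviation_def by (cases L) (auto simp: sum.lessThan_Suc_shift simp del: sum.lessThan_Suc)

text \<open>
  Kolmogorov's inequality. Adding the starting value \<open>a\<close> of the martingale allows an
  induction on the number of steps: the bound \<open>a\<^sup>2 + n C\<close> is at least \<open>l\<^sup>2\<close> once the level is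
  passed, and otherwise averages correctly over the first step.
\<close>

lemma maximal_inequality:
  assumes C: "C \<ge> 0"
    and int: "\<And>a d. integrable (measure_pmf (\<kappa> d)) (\<lambda>y. (a + (real y - real d - drift d))\<^sup>2)"
    and var: "\<And>a d. measure_pmf.expectation (\<kappa> d) (\<lambda>y. (a + (real y - real d - drift d))\<^sup>2) \<le> a\<^sup>2 + C"
    and l: "l > 0"
  shows "measure_pmf.prob (level_path n L d) {zs. \<exists>i\<le>n. \<bar>a + deviation L d zs i\<bar> > l} \<le> (a\<^sup>2 + real n * C) / l\<^sup>2"
proof (induction n arbitrary: a L d)
  case 0
  show ?case
  proof (cases "\<bar>a\<bar> > l")
    case True
    then have "1 \<le> a\<^sup>2 / l\<^sup>2" using l by (simp add: field_simps abs_le_square_iff[symmetric])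
    then show ?thesis using True by (simp add: deviation_0)
  qed (simp add: deviation_0)
next
  case (Suc n)
  show ?case
  proof (cases "\<bar>a\<bar> > l")
    case True
    then have "1 \<le> a\<^sup>2 / l\<^sup>2" using l by (simp add: field_simps abs_le_square_iff[symmetric])
    also have "\<dots> \<le> (a\<^sup>2 + real (Suc n) * C) / l\<^sup>2" using C by (intro divide_right_mono) auto
    finally show ?thesis using measure_pmf.prob_le_1 order_trans by blast
  next
    case False
    let ?inc = "\<lambda>y. real y - real d - drift d"
    have ev: "Cons z -` {zs. \<exists>i\<le>Suc n. \<bar>a + deviation L d zs i\<bar> > l}
        = {zs. \<exists>i\<le>n. \<bar>(a + (real z - of_bool (L > 0) - real d - drift d)) + deviation (L - 1) z zs i\<bar> > l}" for z
    proof -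
      have "(\<exists>i\<le>Suc n. \<bar>a + deviation L d (z # zs) i\<bar> > l)
          \<longleftrightarrow> (\<exists>i\<le>n. \<bar>a + deviation L d (z # zs) (Suc i)\<bar> > l)" for zs
        using False by (metis Suc_le_mono add.right_neutral deviation_0 not0_implies_Suc)
      then show ?thesis unfolding deviation_Suc by (auto simp: add.assoc)
    qed
    have "measure_pmf.prob (level_path (Suc n) L d) {zs. \<exists>i\<le>Suc n. \<bar>a + deviation L d zs i\<bar> > l}
        = (\<integral>y. measure_pmf.prob (level_path n (L - 1) (y + of_bool (L > 0)))
            {zs. \<exists>i\<le>n. \<bar>(a + ?inc y) + deviation (L - 1) (y + of_bool (L > 0)) zs i\<bar> > l} \<partial>\<kappa> d)"
      unfolding level_path.simps prob_bind_pmf integral_map_pmf measure_map_pmf ev by simp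
    also have "\<dots> \<le> (\<integral>y. ((a + ?inc y)\<^sup>2 + real n * C) / l\<^sup>2 \<partial>\<kappa> d)"
    proof (intro integral_mono Suc.IH)
      show "integrable (measure_pmf (\<kappa> d)) (\<lambda>y. ((a + ?inc y)\<^sup>2 + real n * C) / l\<^sup>2)"
        using int[where a = a and d = d] by (intro integrable_divide Bochner_Integration.integrable_add) auto
    qed (auto intro!: measure_pmf.integrable_const_bound[where B = 1])
    also have "\<dots> = (measure_pmf.expectation (\<kappa> d) (\<lambda>y. (a + ?inc y)\<^sup>2) + real n * C) / l\<^sup>2"
      using int[where a = a and d = d] by (simp only: integral_divide_zero) (simp add: Bochner_Integration.integral_add)
    also have "\<dots> \<le> (a\<^sup>2 + C + real n * C) / l\<^sup>2"
      by (intro divide_right_mono add_right_mono var) auto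
    finally show ?thesis by (simp add: algebra_simps)
  qed
qed

text \<open>
  The number of times, after the immigration has stopped, at which the chain is alive but below
  \<open>K\<close>, where its drift is not yet close to \<open>- 1 / 2\<close>.
\<close>

definition low_visits :: "nat \<Rightarrow> nat \<Rightarrow> nat \<Rightarrow> nat list \<Rightarrow> nat" where
  "low_visits K L d zs = (\<Sum>i<length zs. of_bool (L \<le> i \<and> 0 < (d # zs) ! i \<and> (d # zs) ! i < K))"

lemma low_visits_Cons:
  "low_visits K L d (z # zs) = of_bool (L = 0 \<and> 0 < d \<and> d < K) + low_visits K (L - 1) z zs"
proof -
  show ?thesis
    by (cases L) (simp_all add: low_visits_def sum.lessThan_Suc_shift del: sum.lessThan_Suc)
qed

text \<open>
  Each such visit kills the chain with probability at least \<open>q\<close>, so their number is dominated by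
  a geometric variable.
\<close>

lemma expected_low_visits:
  assumes q: "0 < q" "q \<le> 1" "\<And>d. 0 < d \<Longrightarrow> d < K \<Longrightarrow> q \<le> pmf (\<kappa> d) 0"
  shows "(\<integral>\<^sup>+zs. of_nat (low_visits K L d zs) \<partial>level_path n L d) \<le> (if L = 0 \<and> d = 0 then 0 else ennreal (1 / q))"
proof (induction n arbitrary: L d)
  case 0
  then show ?case by (simp add: low_visits_def)
next
  case (Suc n)
  let ?h = "\<lambda>z. of_nat (of_bool (L = 0 \<and> 0 < d \<and> d < K)) + (\<integral>\<^sup>+zs. of_nat (low_visits K (L - 1) z zs) \<partial>level_path n (L - 1) z) :: ennreal"
  have eq: "(\<integral>\<^sup>+zs. of_nat (low_visits K L d zs) \<partial>level_path (Suc n) L d)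
      = (\<integral>\<^sup>+y. ?h (y + of_bool (L > 0)) \<partial>\<kappa> d)"
    unfolding level_path.simps nn_integral_bind_pmf nn_integral_map_pmf low_visits_Cons of_nat_add
    by (subst nn_integral_add) simp_all
  have IH: "(\<integral>\<^sup>+zs. of_nat (low_visits K L' z zs) \<partial>level_path n L' z) \<le> ennreal (1 / q)" for L' z
    by (rule order_trans[OF Suc.IH[of L' z]]) simp
  have IH0: "(\<integral>\<^sup>+zs. of_nat (low_visits K 0 0 zs) \<partial>level_path n 0 0) = (0 :: ennreal)"
    using Suc.IH[of 0 0] by simp
  show ?case
  proof (cases "L = 0 \<and> d = 0")
    case True
    then have "(\<integral>\<^sup>+y. ?h (y + of_bool (L > 0)) \<partial>\<kappa> d) = 0" by (simp add: absorbing IH0)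
    then show ?thesis unfolding eq by simp
  next
    case nz: False
    show ?thesis
    proof (cases "L = 0 \<and> 0 < d \<and> d < K")
      case True
      have "(\<integral>\<^sup>+y. ?h (y + of_bool (L > 0)) \<partial>\<kappa> d)
          \<le> (\<integral>\<^sup>+y. 1 + ennreal (1 / q) * indicator (- {0}) y \<partial>\<kappa> d)"
      proof (rule nn_integral_mono)
        fix y
        have L: "L = 0" "L - 1 = 0" and e: "of_bool (L = 0 \<and> 0 < d \<and> d < K) = (1 :: nat)" using True by auto
        show "?h (y + of_bool (L > 0)) \<le> 1 + ennreal (1 / q) * indicator (- {0}) y"
        proof (cases "y = 0")
          case True
          then show ?thesis unfolding e using IH0 L by simp
        next
          case False
          then show ?thesis unfolding e using IH[of 0 y] L by simp
        qed
      qed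
      also have "\<dots> = 1 + ennreal (1 / q) * ennreal (1 - pmf (\<kappa> d) 0)"
      proof -
        have "measure_pmf.prob (\<kappa> d) (- {0}) = 1 - pmf (\<kappa> d) 0"
          using measure_pmf.prob_compl[of "{0}" "\<kappa> d"] by (simp add: Compl_eq_Diff_UNIV measure_pmf_single)
        then show ?thesis
          by (subst nn_integral_add) (simp_all add: nn_integral_cmult_indicator measure_pmf.emeasure_eq_measure)
      qed
      also have "\<dots> = ennreal 1 + ennreal (1 / q * (1 - pmf (\<kappa> d) 0))"
        using q(1) by (subst ennreal_mult) (auto simp: pmf_le_1)
      also have "\<dots> = ennreal (1 + 1 / q * (1 - pmf (\<kappa> d) 0))"
        using q(1) by (intro ennreal_plus[symmetric]) (auto simp: pmf_le_1)
      also have "\<dots> \<le> ennreal (1 / q)"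
      proof (rule ennreal_leI)
        have "1 \<le> pmf (\<kappa> d) 0 / q" using q(1) q(3)[of d] True by simp
        then show "1 + 1 / q * (1 - pmf (\<kappa> d) 0) \<le> 1 / q" by (simp add: diff_divide_distrib)
      qed
      finally show ?thesis unfolding eq by (simp only: nz if_False)
    next
      case False
      have "(\<integral>\<^sup>+y. ?h (y + of_bool (L > 0)) \<partial>\<kappa> d) \<le> (\<integral>\<^sup>+y. ennreal (1 / q) \<partial>\<kappa> d)"
      proof (rule nn_integral_mono)
        fix y
        have e: "of_bool (L = 0 \<and> 0 < d \<and> d < K) = (0 :: nat)" using False by simp
        show "?h (y + of_bool (L > 0)) \<le> ennreal (1 / q)"
          unfolding e of_nat_0 add_0 by (rule IH)
      qed
      also have "\<dots> = ennreal (1 / q)" by simp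
      finally show ?thesis unfolding eq by (simp only: nz if_False)
    qed
  qed
qed

lemma low_visits_tail:
  assumes q: "0 < q" "q \<le> 1" "\<And>d. 0 < d \<Longrightarrow> d < K \<Longrightarrow> q \<le> pmf (\<kappa> d) 0" and V: "V > 0"
  shows "measure_pmf.prob (level_path n L d) {zs. real (low_visits K L d zs) > V} \<le> 1 / (q * V)"
proof -
  let ?S = "{zs. real (low_visits K L d zs) > V}"
  have "ennreal (V * measure_pmf.prob (level_path n L d) ?S) = (\<integral>\<^sup>+zs. ennreal V * indicator ?S zs \<partial>level_path n L d)"
    using V by (simp add: nn_integral_cmult_indicator measure_pmf.emeasure_eq_measure ennreal_mult)
  also have "\<dots> \<le> (\<integral>\<^sup>+zs. of_nat (low_visits K L d zs) \<partial>level_path n L d)"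
    by (intro nn_integral_mono) (auto simp: indicator_def ennreal_of_nat_eq_real_of_nat intro: ennreal_leI)
  also have "\<dots> \<le> ennreal (1 / q)"
    by (rule order_trans[OF expected_low_visits[OF q]]) simp_all
  finally have "V * measure_pmf.prob (level_path n L d) ?S \<le> 1 / q"
    using q by (simp add: ennreal_le_iff)
  then show ?thesis using V q by (simp add: field_simps)
qed

end

context level_chain
begin

text \<open>
  The deterministic part of the law of large numbers. During the immigration the chain never gets
  below \<open>K\<close>, by induction, because its drift there is positive. Later, until it dies, its drift
  differs from \<open>- 1 / 2\<close> by \<open>\<delta>\<close> except at the low visits. Once dead it stays so, and it cannot die
  before the target has come down to \<open>2 E\<close>.
\<close>

lemma profile_from_deviation:
  fixes Z :: "nat \<Rightarrow> nat" and N L K :: nat and l V \<delta> C :: real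
  assumes dev: "\<And>i. i \<le> N \<Longrightarrow> \<bar>real (Z i) - real (Z 0) - real (min i L) - (\<Sum>t<i. drift (Z t))\<bar> \<le> l"
    and absorb: "\<And>i. i < N \<Longrightarrow> L \<le> i \<Longrightarrow> Z i = 0 \<Longrightarrow> Z (Suc i) = 0"
    and low: "(\<Sum>i<N. of_bool (L \<le> i \<and> 0 < Z i \<and> Z i < K)) \<le> V"
    and high: "\<And>z. K \<le> z \<Longrightarrow> \<bar>drift z + 1 / 2\<bar> \<le> \<delta>"
    and C: "\<And>z. \<bar>drift z\<bar> \<le> C" and \<delta>: "0 \<le> \<delta>" "\<delta> \<le> 1 / 4" and start: "real K + l \<le> real (Z 0)"
    and E: "E = \<delta> * real N + (C + 1) * V + l"
  shows "\<forall>i\<le>N. \<bar>2 * real (Z i) - max 0 (2 * real (Z 0) + real L - \<bar>real i - real L\<bar>)\<bar> \<le> 2 * E"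
    and "real N > 2 * real (Z 0) + 2 * real L + 2 * E \<Longrightarrow> Z N = 0"
proof -
  have imm: "K \<le> Z i" if "i \<le> N" "i \<le> L" for i
    using that
  proof (induction i rule: less_induct)
    case (less i)
    have "(\<Sum>t<i. drift (Z t)) \<ge> (\<Sum>t<i. - 3 / 4)"
    proof (rule sum_mono)
      fix t assume "t \<in> {..<i}"
      then have "K \<le> Z t" using less by auto
      from high[OF this] \<delta> show "- 3 / 4 \<le> drift (Z t)" by linarith
    qed
    moreover have "\<bar>real (Z i) - real (Z 0) - real (min i L) - (\<Sum>t<i. drift (Z t))\<bar> \<le> l"
      by (rule dev) (use less in auto)
    moreover have "min i L = i" using less by auto
    ultimately have "real (Z i) \<ge> real K" using start by (simp add: abs_le_iff)
    then show ?case by simp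
  qed
  have C0: "C \<ge> 0" using C[of 0] by (rule order_trans[rotated]) simp
  have near: "\<bar>real (Z i) - (real (Z 0) + real (min i L) - real i / 2)\<bar> \<le> E"
    if i: "i \<le> N" and pos: "\<And>t. L \<le> t \<Longrightarrow> t < i \<Longrightarrow> Z t > 0" for i
  proof -
    let ?b = "\<lambda>t. of_bool (L \<le> t \<and> 0 < Z t \<and> Z t < K) :: real"
    have "(\<Sum>t<i. drift (Z t)) + real i / 2 = (\<Sum>t<i. drift (Z t) + 1 / 2)"
      by (simp add: sum.distrib)
    also have "\<bar>\<dots>\<bar> \<le> (\<Sum>t<i. \<bar>drift (Z t) + 1 / 2\<bar>)" by (rule sum_abs)
    also have "\<dots> \<le> (\<Sum>t<i. \<delta> + (C + 1) * ?b t)"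
    proof (rule sum_mono)
      fix t assume t: "t \<in> {..<i}"
      show "\<bar>drift (Z t) + 1 / 2\<bar> \<le> \<delta> + (C + 1) * ?b t"
      proof (cases "K \<le> Z t")
        case True
        then show ?thesis using high[of "Z t"] by simp
      next
        case False
        then have "L \<le> t" using imm[of t] t i by force
        moreover have "0 < Z t" using pos[of t] t calculation by simp
        ultimately have "?b t = 1" using False by simp
        moreover have "\<bar>drift (Z t) + 1 / 2\<bar> \<le> C + 1" using C[of "Z t"] by linarith
        ultimately show ?thesis using \<delta> by (simp only: mult_1_right)
      qed
    qed
    also have "\<dots> \<le> (\<Sum>t<N. \<delta> + (C + 1) * ?b t)"
      using i \<delta> C0 by (intro sum_mono2) auto
    also have "\<dots> = \<delta> * real N + (C + 1) * (\<Sum>t<N. ?b t)"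
      by (simp add: sum.distrib sum_distrib_left)
    also have "\<dots> \<le> \<delta> * real N + (C + 1) * V"
      using low C0 by (intro add_left_mono mult_left_mono) auto
    finally show ?thesis using dev[OF i] unfolding E by linarith
  qed
  have stay: "Z i = 0" if "L \<le> t" "t \<le> i" "i \<le> N" "Z t = 0" for i t
    using that(2,3)
  proof (induction i rule: dec_induct)
    case (step n)
    then show ?case using absorb[of n] that(1) by simp
  qed (use that in simp)
  have E0: "E \<ge> 0" using near[of 0] by linarith
  show all: "\<forall>i\<le>N. \<bar>2 * real (Z i) - max 0 (2 * real (Z 0) + real L - \<bar>real i - real L\<bar>)\<bar> \<le> 2 * E"
  proof (intro allI impI)
    fix i assume i: "i \<le> N"
    have tgt: "2 * real (Z 0) + real L - \<bar>real i - real L\<bar> = 2 * (real (Z 0) + real (min i L) - real i / 2)" for i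
      by (cases "i \<le> L") (auto simp: min_def)
    show "\<bar>2 * real (Z i) - max 0 (2 * real (Z 0) + real L - \<bar>real i - real L\<bar>)\<bar> \<le> 2 * E"
    proof (cases "\<exists>t. L \<le> t \<and> t < i \<and> Z t = 0")
      case False
      then have "\<bar>real (Z i) - (real (Z 0) + real (min i L) - real i / 2)\<bar> \<le> E"
        by (intro near i) auto
      then show ?thesis unfolding tgt by (simp add: max_def abs_le_iff)
    next
      case True
      \<comment> \<open>At the time of death the approximation is still valid, and the target only decreases from there on.\<close>
      define t where "t = (LEAST t. L \<le> t \<and> t < i \<and> Z t = 0)"
      have t: "L \<le> t" "t < i" "Z t = 0"
        using LeastI_ex[OF True] by (auto simp: t_def)
      have min: "Z s > 0" if "L \<le> s" "s < t" for s
        using not_less_Least[of s "\<lambda>t. L \<le> t \<and> t < i \<and> Z t = 0"] that t(2) by (auto simp: t_def)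
      have "\<bar>real (Z t) - (real (Z 0) + real (min t L) - real t / 2)\<bar> \<le> E"
        by (rule near) (use t i min in auto)
      moreover have "Z i = 0" using stay[of t i] t i by simp
      ultimately show ?thesis using t E0 by (simp add: max_def abs_le_iff)
    qed
  qed
  assume N: "real N > 2 * real (Z 0) + 2 * real L + 2 * E"
  then have NL: "L \<le> N" using E0 by linarith
  show "Z N = 0"
  proof (rule ccontr)
    assume "Z N \<noteq> 0"
    then have "Z t > 0" if "L \<le> t" "t < N" for t using stay[of t N] that by auto
    then have "\<bar>real (Z N) - (real (Z 0) + real (min N L) - real N / 2)\<bar> \<le> E" by (intro near) auto
    then show False using N NL by (simp add: min_def abs_le_iff split: if_splits)
  qed
qed

text \<open>
  The target is \<open>2 d + min i L - (i - L)\<^sub>+\<close>, cut off at \<open>0\<close>; the horizon \<open>N\<close> is meant to lie just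
  beyond the point where it vanishes.
\<close>

definition follows_profile :: "real \<Rightarrow> nat \<Rightarrow> nat \<Rightarrow> nat \<Rightarrow> nat list \<Rightarrow> bool" where
  "follows_profile e N L d zs \<longleftrightarrow> (d # zs) ! N = 0 \<and>
     (\<forall>i\<le>N. \<bar>2 * real ((d # zs) ! i) - max 0 (2 * real d + real L - \<bar>real i - real L\<bar>)\<bar> \<le> e)"

lemma level_path_concentration:
  fixes h B \<epsilon> \<theta> :: real
  assumes pos: "0 < h" "0 < B" "0 < \<epsilon>" "0 < \<theta>"
  shows "\<exists>A0>0. \<forall>A\<ge>A0. \<forall>d L. h * A \<le> real d \<and> real d \<le> B * A \<and> real L \<le> B * A \<longrightarrow>
    measure_pmf.prob (level_path (2 * d + 2 * L + nat \<lfloor>\<epsilon> * A\<rfloor>) L d)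
      {zs. follows_profile (\<epsilon> * A) (2 * d + 2 * L + nat \<lfloor>\<epsilon> * A\<rfloor>) L d zs} \<ge> 1 - \<theta>"
proof -
  obtain C1 where C1: "C1 \<ge> 0" "\<And>d. \<bar>drift d\<bar> \<le> C1" using drift_bounded by blast
  obtain C2 where C2: "C2 \<ge> 0"
    and int: "\<And>a d. integrable (measure_pmf (\<kappa> d)) (\<lambda>y. (a + (real y - real d - drift d))\<^sup>2)"
    and var: "\<And>a d. measure_pmf.expectation (\<kappa> d) (\<lambda>y. (a + (real y - real d - drift d))\<^sup>2) \<le> a\<^sup>2 + C2"
    using variance_bound by metis
  \<comment> \<open>\<open>Q A\<close> bounds the horizon; each of the three parts of the error gets at most \<open>\<epsilon> A / 16\<close>.\<close>
  define Q where "Q = 4 * B + \<epsilon>"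
  have Q: "Q > 0" using pos by (simp add: Q_def)
  define \<delta> where "\<delta> = min (1 / 4) (\<epsilon> / (16 * Q))"
  have \<delta>: "0 < \<delta>" "\<delta> \<le> 1 / 4" "\<delta> * Q \<le> \<epsilon> / 16"
  proof -
    have "\<delta> * Q \<le> \<epsilon> / (16 * Q) * Q" using Q by (intro mult_right_mono) (auto simp: \<delta>_def)
    also have "\<dots> = \<epsilon> / 16" using Q by simp
    finally show "\<delta> * Q \<le> \<epsilon> / 16" .
  qed (use pos Q in \<open>auto simp: \<delta>_def\<close>)
  have "\<forall>\<^sub>F d in sequentially. dist (drift d) (- 1 / 2) < \<delta>"
    using drift_tendsto \<delta>(1) unfolding drift_def[symmetric] by (rule tendstoD)
  then obtain K0 where K0: "\<And>d. d \<ge> K0 \<Longrightarrow> \<bar>drift d + 1 / 2\<bar> < \<delta>"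
    by (auto simp: eventually_sequentially dist_real_def)
  define K where "K = Suc K0"
  have high: "\<bar>drift d + 1 / 2\<bar> \<le> \<delta>" if "K \<le> d" for d using K0[of d] that by (simp add: K_def)
  define q where "q = Min ((\<lambda>d. pmf (\<kappa> d) 0) ` {..K})"
  have q_le: "q \<le> pmf (\<kappa> d) 0" if "d \<le> K" for d using that by (auto simp: q_def)
  have q: "0 < q" by (auto simp: q_def extinction_pos)
  have q1: "q \<le> 1" using q_le[of 0] pmf_le_1[of "\<kappa> 0" 0] by linarith
  define b where "b = min (\<epsilon> / 16) (h / 2)"
  define v where "v = \<epsilon> / (16 * (C1 + 1))"
  have b: "0 < b" "b \<le> \<epsilon> / 16" "b \<le> h / 2" using pos by (auto simp: b_def)
  have cancel: "c * (\<epsilon> / (16 * c)) = \<epsilon> / 16" if "c > 0" for c :: real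
    using that by simp
  have v: "0 < v" "(C1 + 1) * v = \<epsilon> / 16"
    unfolding v_def by (use pos C1(1) in simp, rule cancel, use C1(1) in simp)
  define A0 where "A0 = max 1 (max (2 / \<epsilon>) (max (2 * real K / h) ((Q * C2 / b\<^sup>2 + 1 / (q * v)) / \<theta>)))"
  show ?thesis
  proof (intro exI[of _ A0] conjI allI impI)
    show "0 < A0" by (simp add: A0_def)
    fix A :: real and d L :: nat
    assume A: "A0 \<le> A" and dL: "h * A \<le> real d \<and> real d \<le> B * A \<and> real L \<le> B * A"
    have A1: "1 \<le> A" "2 / \<epsilon> \<le> A" "2 * real K / h \<le> A" "(Q * C2 / b\<^sup>2 + 1 / (q * v)) / \<theta> \<le> A"
      using A by (auto simp: A0_def)
    have eA: "\<epsilon> * A \<ge> 2" using A1(2) pos by (simp add: field_simps)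
    have hA: "h * A / 2 \<ge> real K" using A1(3) pos by (simp add: field_simps)
    define N where "N = 2 * d + 2 * L + nat \<lfloor>\<epsilon> * A\<rfloor>"
    define l where "l = b * A"
    define V where "V = v * A"
    have lV: "0 < l" "0 < V" using A1 b v by (auto simp: l_def V_def)
    have fl: "real (nat \<lfloor>\<epsilon> * A\<rfloor>) \<le> \<epsilon> * A" "real (nat \<lfloor>\<epsilon> * A\<rfloor>) \<ge> \<epsilon> * A / 2"
      using eA by linarith+
    have NQ: "real N \<le> Q * A"
    proof -
      have "real N = 2 * real d + 2 * real L + real (nat \<lfloor>\<epsilon> * A\<rfloor>)" by (simp add: N_def)
      moreover have "Q * A = 4 * (B * A) + \<epsilon> * A" by (simp add: Q_def algebra_simps)
      ultimately show ?thesis using dL fl by linarith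
    qed
    let ?M = "level_path N L d"
    let ?X = "{zs. \<exists>i\<le>N. \<bar>0 + deviation L d zs i\<bar> > l}" and ?Y = "{zs. real (low_visits K L d zs) > V}"
    have X: "measure_pmf.prob ?M ?X \<le> (0\<^sup>2 + real N * C2) / l\<^sup>2"
      by (rule maximal_inequality[OF C2 int var lV(1)])
    have Y: "measure_pmf.prob ?M ?Y \<le> 1 / (q * V)"
      by (rule low_visits_tail[OF q q1 _ lV(2)]) (use q_le in auto)
    have "real N * C2 / l\<^sup>2 \<le> (Q * A) * C2 / l\<^sup>2"
      using NQ C2 by (intro divide_right_mono mult_right_mono) auto
    also have "\<dots> = (Q * C2 / b\<^sup>2) / A" using A1 by (simp add: l_def power2_eq_square)
    finally have "real N * C2 / l\<^sup>2 + 1 / (q * V) \<le> (Q * C2 / b\<^sup>2 + 1 / (q * v)) / A"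
      by (simp add: V_def add_divide_distrib)
    also have "\<dots> \<le> \<theta>" using A1(1,4) pos by (simp add: field_simps)
    finally have small: "measure_pmf.prob ?M (?X \<union> ?Y) \<le> \<theta>"
      using X Y measure_Un_le[of ?X ?M ?Y] by simp
    define E where "E = \<delta> * real N + (C1 + 1) * V + l"
    have E: "2 * E \<le> 3 / 8 * (\<epsilon> * A)"
    proof -
      have "\<delta> * real N \<le> \<delta> * (Q * A)" using NQ \<delta> by (intro mult_left_mono) auto
      also have "\<dots> \<le> \<epsilon> / 16 * A" using \<delta>(3) A1 by (simp only: mult.assoc[symmetric]) (intro mult_right_mono, auto)
      finally have "\<delta> * real N \<le> \<epsilon> / 16 * A" .
      moreover have "(C1 + 1) * V = \<epsilon> / 16 * A" using v by (simp add: V_def flip: mult.assoc)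
      moreover have "l \<le> \<epsilon> / 16 * A" unfolding l_def using b A1 by (intro mult_right_mono) auto
      ultimately show ?thesis by (simp add: E_def)
    qed
    have good: "follows_profile (\<epsilon> * A) N L d zs" if zs: "zs \<in> set_pmf ?M" "zs \<notin> ?X \<union> ?Y" for zs
    proof -
      let ?Z = "\<lambda>i. (d # zs) ! i"
      have len: "length zs = N" using set_level_path[OF zs(1)] by simp
      have l: "real K + l \<le> real d"
      proof -
        have "l \<le> h / 2 * A" unfolding l_def using b A1 by (intro mult_right_mono) auto
        then show ?thesis using hA dL by simp
      qed
      note * = profile_from_deviation[where Z = ?Z and N = N and L = L and l = l and V = V and K = K
          and \<delta> = \<delta> and C = C1 and E = E]
      have 1: "\<forall>i\<le>N. \<bar>2 * real (?Z i) - max 0 (2 * real (?Z 0) + real L - \<bar>real i - real L\<bar>)\<bar> \<le> 2 * E"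
        by (rule *) (use zs set_level_path[OF zs(1)] len l high C1 \<delta> in
          \<open>auto simp: deviation_def low_visits_def E_def K_def not_less\<close>)
      have 2: "?Z N = 0"
      proof (rule *(2))
        show "real N > 2 * real (?Z 0) + 2 * real L + 2 * E"
          using E fl eA by (simp add: N_def)
      qed (use zs set_level_path[OF zs(1)] len l high C1 \<delta> in
          \<open>auto simp: deviation_def low_visits_def E_def K_def not_less\<close>)
      have "2 * E \<le> \<epsilon> * A" using E eA by linarith
      then show ?thesis unfolding follows_profile_def using 1 2 by fastforce
    qed
    have "1 - measure_pmf.prob ?M (?X \<union> ?Y) = measure_pmf.prob ?M (- (?X \<union> ?Y))"
      using measure_pmf.prob_compl[of "?X \<union> ?Y" ?M] by (simp add: Compl_eq_Diff_UNIV)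
    also have "\<dots> \<le> measure_pmf.prob ?M {zs. follows_profile (\<epsilon> * A) N L d zs}"
      by (intro measure_pmf.finite_measure_mono_AE) (auto simp: AE_measure_pmf_iff good)
    finally show "1 - \<theta> \<le> measure_pmf.prob (level_path (2 * d + 2 * L + nat \<lfloor>\<epsilon> * A\<rfloor>) L d)
        {zs. follows_profile (\<epsilon> * A) (2 * d + 2 * L + nat \<lfloor>\<epsilon> * A\<rfloor>) L d zs}"
      using small unfolding N_def by linarith
  qed
qed

end

section \<open>Paths driven by stacks of jumps\<close>

text \<open>
  The jumps made from site \<open>k\<close>, in their order, by the path with steps \<open>ss\<close> that starts at \<open>a\<close>.
\<close>

primrec exits :: "int list \<Rightarrow> int \<Rightarrow> int \<Rightarrow> int list" where
  "exits [] a k = []"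
| "exits (s # ss) a k = (if a = k then [s] else []) @ exits ss (a + s) k"

lemma exits_append: "exits (ss @ ts) a k = exits ss a k @ exits ts (a + sum_list ss) k"
  by (induction ss arbitrary: a) (auto simp: add.assoc)

lemma exits_empty_imp_Nil: "(\<And>k. exits ss a k = []) \<Longrightarrow> ss = []"
proof (cases ss)
  case (Cons s ts)
  assume "\<And>k. exits ss a k = []"
  from this[of a] Cons show ?thesis by simp
qed

text \<open>
  The net number of passages from \<open>k\<close> to \<open>k + 1\<close> of any path from \<open>a\<close> to \<open>j + 1\<close>.
\<close>

definition unit_flow :: "int \<Rightarrow> int \<Rightarrow> int \<Rightarrow> int" where
  "unit_flow a j k = of_bool (a \<le> k \<and> k \<le> j) - of_bool (j < k \<and> k < a)"

lemma unit_flow_shift_up: "unit_flow (a + 1) j k = unit_flow a j k - of_bool (k = a)"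
proof -
  consider "k < a" | "k = a" | "k > a" by linarith
  then show ?thesis by cases (auto simp: unit_flow_def)
qed

text \<open>
  A stack at \<open>k\<close> lists the jumps still to be made from \<open>k\<close>. A path from \<open>a\<close> that uses up all
  stacks and ends with a jump from \<open>j\<close> to \<open>j + 1\<close> forces the flow condition, and forces the last
  jump from each site to point towards that edge; the converse is \<open>directed_stacks_exits\<close>.
\<close>

locale directed_stacks =
  fixes \<sigma> :: "int \<Rightarrow> int list" and a j :: int
  assumes steps: "set (\<sigma> k) \<subseteq> {1, -1}"
    and flow: "int (count_list (\<sigma> k) 1) - int (count_list (\<sigma> (k + 1)) (-1)) = unit_flow a j k"
    and last_right: "j < k \<Longrightarrow> \<sigma> k \<noteq> [] \<Longrightarrow> last (\<sigma> k) = -1"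
    and last_left: "k \<le> j \<Longrightarrow> \<sigma> k \<noteq> [] \<Longrightarrow> last (\<sigma> k) = 1"
begin

lemma Nil_right: "j < k \<Longrightarrow> count_list (\<sigma> k) (-1) = 0 \<Longrightarrow> \<sigma> k = []"
  using last_right[of k] last_in_set[of "\<sigma> k"] by (auto simp: count_list_0_iff)

lemma Nil_left: "k \<le> j \<Longrightarrow> count_list (\<sigma> k) 1 = 0 \<Longrightarrow> \<sigma> k = []"
  using last_left[of k] last_in_set[of "\<sigma> k"] by (auto simp: count_list_0_iff)

text \<open>
  If no jump is left at the current site, the flow condition shows that the site is \<open>j + 1\<close> and that
  the flow vanishes everywhere. Then an empty stack leaves its outer neighbour without homeward
  jumps, hence, by the last-jump condition, empty.
\<close>

lemma exhausted:
  assumes "\<sigma> a = []"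
  shows "\<sigma> k = []"
proof -
  have "a = j + 1"
    using flow[of a] flow[of "a - 1"] assms by (auto simp: unit_flow_def of_bool_def split: if_splits)
  then have fl: "count_list (\<sigma> k) 1 = count_list (\<sigma> (k + 1)) (-1)" for k
    using flow[of k] by (auto simp: unit_flow_def of_bool_def split: if_splits)
  have up: "\<sigma> k = []" if "a \<le> k" for k
    using that
  proof (induction k rule: int_ge_induct)
    case (step k)
    then show ?case using Nil_right[of "k + 1"] fl[of k] \<open>a = j + 1\<close> by simp
  qed (fact assms)
  have down: "\<sigma> k = []" if "k \<le> a" for k
    using that
  proof (induction k rule: int_le_induct)
    case (step k)
    then show ?case using Nil_left[of "k - 1"] fl[of "k - 1"] \<open>a = j + 1\<close> by simp
  qed (fact assms)
  show ?thesis using up down by (cases "a \<le> k") auto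
qed

lemma pop:
  assumes "\<sigma> a = s # l"
  shows "directed_stacks (\<sigma>(a := l)) (a + s) j"
proof
  have s: "s = 1 \<or> s = -1" using steps[of a] assms by auto
  fix k
  show "set ((\<sigma>(a := l)) k) \<subseteq> {1, -1}" using steps[of k] steps[of a] assms by auto
  have u: "int (count_list ((\<sigma>(a := l)) k) 1) = int (count_list (\<sigma> k) 1) - of_bool (k = a \<and> s = 1)"
    using assms by auto
  have d: "int (count_list ((\<sigma>(a := l)) (k + 1)) (-1)) = int (count_list (\<sigma> (k + 1)) (-1)) - of_bool (k + 1 = a \<and> s = -1)"
    using assms by auto
  show "int (count_list ((\<sigma>(a := l)) k) 1) - int (count_list ((\<sigma>(a := l)) (k + 1)) (-1)) = unit_flow (a + s) j k"
    using s
  proof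
    assume "s = 1"
    then show ?thesis unfolding u d by (simp add: unit_flow_shift_up flow[of k, symmetric])
  next
    assume "s = -1"
    then have "unit_flow (a + s) j k = unit_flow a j k + of_bool (k + 1 = a)"
      using unit_flow_shift_up[of "a - 1" j k] by (simp add: eq_diff_eq)
    with \<open>s = -1\<close> show ?thesis unfolding u d by (simp add: flow[of k, symmetric])
  qed
  show "last ((\<sigma>(a := l)) k) = -1" if "j < k" "(\<sigma>(a := l)) k \<noteq> []"
    using that last_right[of k] assms by (auto split: if_splits)
  show "last ((\<sigma>(a := l)) k) = 1" if "k \<le> j" "(\<sigma>(a := l)) k \<noteq> []"
    using that last_left[of k] assms by (auto split: if_splits)
qed

end

text \<open>
  Execute the top jump at the current site, which preserves all conditions, until that site has
  none left; by the previous lemma nothing is left anywhere. The same lemma shows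
  that the path stops at once when the last jump from \<open>j\<close> to \<open>j + 1\<close> has been made.
\<close>

lemma directed_stacks_exits:
  assumes "directed_stacks \<sigma> a j" "finite S" "\<And>k. k \<notin> S \<Longrightarrow> \<sigma> k = []"
  shows "\<exists>ss. set ss \<subseteq> {1, -1} \<and> (\<forall>k. exits ss a k = \<sigma> k) \<and>
    (count_list (\<sigma> j) 1 > 0 \<longrightarrow> (\<exists>ts. ss = ts @ [1] \<and> a + sum_list ts = j))"
  using assms(1,3)
proof (induction "\<Sum>k\<in>S. length (\<sigma> k)" arbitrary: \<sigma> a)
  case 0
  have "\<sigma> k = []" for k
  proof (cases "k \<in> S")
    case True
    then show ?thesis using "0.hyps" sum_eq_0_iff[OF \<open>finite S\<close>, of "\<lambda>k. length (\<sigma> k)"] by simp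
  next
    case False
    then show ?thesis by (rule "0.prems"(2))
  qed
  then show ?case by (intro exI[of _ "[]"]) auto
next
  case (Suc n)
  interpret directed_stacks \<sigma> a j by (rule Suc.prems)
  have "\<sigma> a \<noteq> []"
  proof
    assume "\<sigma> a = []"
    then have "\<sigma> k = []" for k by (rule exhausted)
    then have "(\<Sum>k\<in>S. length (\<sigma> k)) = 0" by simp
    then show False using Suc.hyps(2) by simp
  qed
  then obtain s l where sl: "\<sigma> a = s # l" by (cases "\<sigma> a") auto
  then have "a \<in> S" using Suc.prems(2)[of a] by auto
  let ?\<sigma> = "\<sigma>(a := l)"
  interpret popped: directed_stacks ?\<sigma> "a + s" j by (rule pop[OF sl])
  have n: "n = (\<Sum>k\<in>S. length (?\<sigma> k))"
    using Suc.hyps(2) sl unfolding sum.remove[OF \<open>finite S\<close> \<open>a \<in> S\<close>] by simp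
  have outside: "?\<sigma> k = []" if "k \<notin> S" for k
    using Suc.prems(2)[OF that] that \<open>a \<in> S\<close> by (cases "k = a") simp_all
  have "\<exists>ss. set ss \<subseteq> {1, -1} \<and> (\<forall>k. exits ss (a + s) k = ?\<sigma> k) \<and>
      (count_list (?\<sigma> j) 1 > 0 \<longrightarrow> (\<exists>ts. ss = ts @ [1] \<and> a + s + sum_list ts = j))"
    by (rule Suc.hyps(1)[OF n popped.directed_stacks_axioms outside])
  then obtain ss where IH: "set ss \<subseteq> {1, -1} \<and> (\<forall>k. exits ss (a + s) k = ?\<sigma> k) \<and>
      (count_list (?\<sigma> j) 1 > 0 \<longrightarrow> (\<exists>ts. ss = ts @ [1] \<and> a + s + sum_list ts = j))"
    by (rule exE)
  have ss: "set ss \<subseteq> {1, -1}" "exits ss (a + s) k = ?\<sigma> k" for k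
    using IH[THEN conjunct1] IH[THEN conjunct2, THEN conjunct1, rule_format] .
  note end_ss = IH[THEN conjunct2, THEN conjunct2, rule_format]
  have s: "s = 1 \<or> s = -1" using steps[of a] sl by auto
  have "\<exists>ts. s # ss = ts @ [1] \<and> a + sum_list ts = j" if cnt: "count_list (\<sigma> j) 1 > 0"
  proof (cases "count_list (?\<sigma> j) 1 > 0")
    case True
    from end_ss[OF this] obtain ts where "ss = ts @ [1]" "a + s + sum_list ts = j" by blast
    then show ?thesis by (intro exI[of _ "s # ts"]) auto
  next
    case False
    with cnt have "a = j" by (cases "a = j") simp_all
    moreover have "s = 1" using False cnt sl calculation by (cases "s = 1") simp_all
    ultimately have as: "a = j" "s = 1" .
    \<comment> \<open>The last upward jump from \<open>j\<close> has just been made: no passage back to \<open>j\<close> remains.\<close>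
    have "count_list (?\<sigma> (j + 1)) (-1) = 0"
      using popped.flow[of j] False as by (simp add: unit_flow_def)
    then have "?\<sigma> (a + s) = []" using popped.Nil_right[of "j + 1"] as by simp
    then have "?\<sigma> k = []" for k by (rule popped.exhausted)
    then have "ss = []" using exits_empty_imp_Nil[of ss "a + s"] ss(2) by simp
    then show ?thesis using as by (intro exI[of _ "[]"]) auto
  qed
  moreover have "exits (s # ss) a k = \<sigma> k" for k using ss(2)[of k] sl by auto
  ultimately show ?case using s ss(1) by (intro exI[of _ "s # ss"]) auto
qed

context site_chain
begin

text \<open>
  The probability of a list of jumps from one site, starting at difference \<open>z\<close>.
\<close>

primrec stack_weight :: "int list \<Rightarrow> int \<Rightarrow> real" where
  "stack_weight [] z = 1"
| "stack_weight (s # l) z = p (s * z) * stack_weight l (z + s)"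

text \<open>
  The probability of a path from \<open>a\<close>, where \<open>D\<close> holds the present differences of all sites.
\<close>

primrec path_weight :: "int list \<Rightarrow> (int \<Rightarrow> int) \<Rightarrow> int \<Rightarrow> real" where
  "path_weight [] D a = 1"
| "path_weight (s # ss) D a = p (s * D a) * path_weight ss (D(a := D a + s)) (a + s)"

lemma path_weight_eq_prod_stack_weight:
  assumes "finite S" "\<And>k. k \<notin> S \<Longrightarrow> exits ss a k = []"
  shows "path_weight ss D a = (\<Prod>k\<in>S. stack_weight (exits ss a k) (D k))"
  using assms(2)
proof (induction ss arbitrary: D a)
  case (Cons s ss)
  have "a \<in> S" using Cons.prems[of a] by auto
  let ?D = "D(a := D a + s)"
  have "stack_weight (exits (s # ss) a k) (D k)
      = (if k = a then p (s * D a) else 1) * stack_weight (exits ss (a + s) k) (?D k)" for k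
    by auto
  then have "(\<Prod>k\<in>S. stack_weight (exits (s # ss) a k) (D k))
      = p (s * D a) * (\<Prod>k\<in>S. stack_weight (exits ss (a + s) k) (?D k))"
    using \<open>a \<in> S\<close> \<open>finite S\<close> by (simp only: prod.distrib prod.delta) simp
  also have "(\<Prod>k\<in>S. stack_weight (exits ss (a + s) k) (?D k)) = path_weight ss ?D (a + s)"
    by (rule Cons.IH[symmetric]) (use Cons.prems in auto)
  finally show ?case by simp
qed simp

lemma path_weight_snoc:
  "path_weight (ss @ [s]) D a =
     path_weight ss D a * p (s * (D (a + sum_list ss) + sum_list (exits ss a (a + sum_list ss))))"
  by (induction ss arbitrary: D a) (auto simp: add.assoc)

text \<open>
  Run lengths back to jumps, with outward jumps as \<open>1\<close>: the orientation of the sites right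
  of the stopped edge.
\<close>

definition encode :: "nat list \<Rightarrow> int list" where
  "encode ms = concat (map (\<lambda>m. replicate m 1 @ [-1]) ms)"

lemma encode_simps [simp]:
  "encode [] = []" "encode (m # ms) = replicate m 1 @ [-1] @ encode ms"
  by (simp_all add: encode_def)

lemma count_list_replicate: "count_list (replicate n x) y = (if x = y then n else 0)"
  by (induction n) auto

lemma count_encode: "count_list (encode ms) 1 = sum_list ms" "count_list (encode ms) (-1) = length ms"
  by (induction ms) (auto simp: count_list_replicate)

lemma set_encode: "set (encode ms) \<subseteq> {1, -1}"
  by (induction ms) auto

lemma encode_eq_Nil_iff: "encode ms = [] \<longleftrightarrow> ms = []"
  by (cases ms) auto

lemma last_encode: "ms \<noteq> [] \<Longrightarrow> last (encode ms) = -1"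
  by (induction ms) (auto simp: encode_eq_Nil_iff)

lemma takeWhile_replicate_append: "takeWhile P (replicate m x @ y # l) = replicate m x" if "P x" "\<not> P y"
  using that by (induction m) auto

lemma encode_inject: "encode ms = encode ms' \<Longrightarrow> ms = ms'"
proof (induction ms arbitrary: ms')
  case Nil
  then show ?case using encode_eq_Nil_iff[of ms'] by simp
next
  case (Cons m ms)
  then obtain m' ns where ms': "ms' = m' # ns" by (cases ms') auto
  have "takeWhile ((=) 1) (encode (m # ms)) = takeWhile ((=) 1) (encode ms')"
    using Cons.prems by (rule arg_cong)
  then have "m = m'"
    unfolding ms' encode_simps append_Cons append_Nil
    by (subst (asm) (1 2) takeWhile_replicate_append) (auto simp: replicate_eq_replicate)
  with Cons show ?case by (simp add: ms')
qed

lemma stack_weight_replicate: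
  "stack_weight (replicate m 1 @ l) z = (\<Prod>i<m. p (z + int i)) * stack_weight l (z + int m)"
  by (induction m arbitrary: z) (auto simp: prod.lessThan_Suc_shift add.assoc simp del: prod.lessThan_Suc)

lemma stack_weight_uminus: "stack_weight (map uminus l) z = stack_weight l (- z)"
  by (induction l arbitrary: z) auto

lemma pmf_bind_Cons:
  "pmf (M \<bind> (\<lambda>x. map_pmf (Cons x) (f x))) (y # ys) = pmf M y * pmf (f y) ys"
proof -
  have "pmf (map_pmf (Cons x) (f x)) (y # ys) = pmf (f y) ys * indicator {y} x" for x
  proof (cases "x = y")
    case True
    then show ?thesis by (simp add: pmf_map_inj')
  next
    case False
    then show ?thesis by (auto simp: pmf_eq_0_set_pmf)
  qed
  then show ?thesis by (simp add: pmf_bind measure_pmf_single)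
qed

lemma pmf_runs: "length ms = d \<Longrightarrow> pmf (runs d z) ms = stack_weight (encode ms) z"
proof (induction ms arbitrary: d z)
  case (Cons m ms)
  then show ?case
    using p_reflect[of "z + int m"]
    by (cases d) (auto simp: pmf_bind_Cons stack_weight_replicate pmf_outward_run)
qed simp

text \<open>
  The site-to-site chain together with the complete record of jumps at each site.
\<close>

primrec explore :: "nat \<Rightarrow> nat \<Rightarrow> nat \<Rightarrow> nat list list pmf" where
  "explore 0 L d = return_pmf []"
| "explore (Suc n) L d =
     runs d 0 \<bind> (\<lambda>ms. map_pmf (Cons ms) (explore n (L - 1) (sum_list ms + of_bool (L > 0))))"

primrec levels :: "nat \<Rightarrow> nat list list \<Rightarrow> nat list" where
  "levels L [] = []"
| "levels L (ms # mss) = (sum_list ms + of_bool (L > 0)) # levels (L - 1) mss"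

lemma nth_levels: "i < length mss \<Longrightarrow> levels L mss ! i = sum_list (mss ! i) + of_bool (i < L)"
  by (induction mss arbitrary: i L) (auto simp: nth_Cons split: nat.splits)

lemma set_explore:
  "mss \<in> set_pmf (explore n L d) \<Longrightarrow> length mss = n \<and> (\<forall>i<n. length (mss ! i) = (d # levels L mss) ! i)"
proof (induction n arbitrary: L d mss)
  case (Suc n)
  then obtain ms mss' where ms: "ms \<in> set_pmf (runs d 0)"
    and mss': "mss' \<in> set_pmf (explore n (L - 1) (sum_list ms + of_bool (L > 0)))" and [simp]: "mss = ms # mss'"
    by auto
  have "length (mss ! i) = (d # levels L mss) ! i" if "i < Suc n" for i
    using that length_runs[OF ms] Suc.IH[OF mss'] by (cases i) auto
  then show ?case using Suc.IH[OF mss'] by auto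
qed simp

lemma pmf_explore:
  "mss \<in> set_pmf (explore n L d) \<Longrightarrow> pmf (explore n L d) mss = (\<Prod>ms\<leftarrow>mss. stack_weight (encode ms) 0)"
proof (induction n arbitrary: L d mss)
  case (Suc n)
  then obtain ms mss' where ms: "ms \<in> set_pmf (runs d 0)"
    and mss': "mss' \<in> set_pmf (explore n (L - 1) (sum_list ms + of_bool (L > 0)))" and [simp]: "mss = ms # mss'"
    by auto
  show ?case using Suc.IH[OF mss'] pmf_runs[OF length_runs[OF ms]] by (simp add: pmf_bind_Cons)
qed simp

end

lemma prod_list_map_conv_nth: "(\<Prod>x\<leftarrow>xs. f x) = (\<Prod>i<length xs. f (xs ! i))" for f :: "'a \<Rightarrow> real"
  by (simp add: prod.list_conv_set_nth atLeast0LessThan)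

context site_chain
begin

text \<open>
  \<open>R\<close> holds the records of the sites \<open>j + 1, j + 2, \<dots>\<close> and \<open>L\<close> those of \<open>j, j - 1, \<dots>\<close>; on the
  left side outward means down.
\<close>

definition stack :: "int \<Rightarrow> nat list list \<Rightarrow> nat list list \<Rightarrow> int \<Rightarrow> int list" where
  "stack j R L k =
     (if j < k then (if nat (k - j - 1) < length R then encode (R ! nat (k - j - 1)) else [])
      else (if nat (j - k) < length L then map uminus (encode (L ! nat (j - k))) else []))"

lemma stack_right: "stack j R L (j + 1 + int i) = (if i < length R then encode (R ! i) else [])"
  by (simp add: stack_def)

lemma stack_left: "stack j R L (j - int i) = (if i < length L then map uminus (encode (L ! i)) else [])"
  by (simp add: stack_def)

lemma site_cases:
  fixes j k :: int
  obtains i where "k = j + 1 + int i" | i where "k = j - int i"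
proof (cases "j < k")
  case True
  then have "k = j + 1 + int (nat (k - j - 1))" by simp
  then show thesis by (rule that(1))
next
  case False
  then have "k = j - int (nat (j - k))" by simp
  then show thesis by (rule that(2))
qed

lemma count_map_uminus: "count_list (map uminus l) (s :: int) = count_list l (- s)"
  by (induction l) auto

lemma prod_stack_weight:
  assumes S: "S = {j - int (length L) + 1..j + int (length R)}"
  shows "(\<Prod>k\<in>S. stack_weight (stack j R L k) 0)
    = (\<Prod>ms\<leftarrow>R. stack_weight (encode ms) 0) * (\<Prod>ms\<leftarrow>L. stack_weight (encode ms) 0)"
proof -
  have "S = {j + 1..j + int (length R)} \<union> {j - int (length L) + 1..j}"
    by (auto simp: S)
  then have "(\<Prod>k\<in>S. stack_weight (stack j R L k) 0)
      = (\<Prod>k\<in>{j + 1..j + int (length R)}. stack_weight (stack j R L k) 0)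
        * (\<Prod>k\<in>{j - int (length L) + 1..j}. stack_weight (stack j R L k) 0)"
    by (simp only:) (rule prod.union_disjoint, auto)
  also have "(\<Prod>k\<in>{j + 1..j + int (length R)}. stack_weight (stack j R L k) 0)
      = (\<Prod>i<length R. stack_weight (encode (R ! i)) 0)"
    by (rule prod.reindex_bij_witness[of _ "\<lambda>i. j + 1 + int i" "\<lambda>k. nat (k - j - 1)"])
      (auto simp: stack_def)
  also have "(\<Prod>k\<in>{j - int (length L) + 1..j}. stack_weight (stack j R L k) 0)
      = (\<Prod>i<length L. stack_weight (encode (L ! i)) 0)"
    by (rule prod.reindex_bij_witness[of _ "\<lambda>i. j - int i" "\<lambda>k. nat (j - k)"])
      (auto simp: stack_def stack_weight_uminus)
  finally show ?thesis by (simp add: prod_list_map_conv_nth)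
qed

lemma stack_inject:
  assumes "stack j R L = stack j R' L'" "length R = length R'" "length L = length L'"
  shows "R = R' \<and> L = L'"
proof
  show "R = R'"
  proof (rule nth_equalityI)
    fix i assume "i < length R"
    then show "R ! i = R' ! i"
      using stack_right[of j R L i] stack_right[of j R' L' i] assms encode_inject by simp
  qed (fact assms)
  show "L = L'"
  proof (rule nth_equalityI)
    fix i assume "i < length L"
    then have "map uminus (encode (L ! i)) = map uminus (encode (L' ! i))"
      using stack_left[of j R L i] stack_left[of j R' L' i] assms by simp
    then show "L ! i = L' ! i"
      using encode_inject by (metis (no_types, lifting) inj_map_eq_map inj_uminus)
  qed (fact assms)
qed

end

lemma abs_diff_max_0: "\<bar>max 0 a - max 0 b\<bar> \<le> \<bar>a - b\<bar>" for a b :: real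
  by (simp add: max_def)

lemma abs_diff_chain:
  "\<bar>x - 2 * z\<bar> \<le> 1 \<Longrightarrow> \<bar>2 * z - t\<bar> \<le> e \<Longrightarrow> \<bar>t - T\<bar> \<le> 2 \<Longrightarrow> \<bar>x - T\<bar> \<le> e + 3" for x :: real
  by linarith

text \<open>
  The \<open>r\<close> jumps from \<open>j\<close> to \<open>j + 1\<close> are the homeward jumps of \<open>j\<close>. The site \<open>j + 1\<close> makes
  equally many homeward jumps, but one less if the walk starts at or left of \<open>j\<close>, since it ends at
  \<open>j + 1\<close>. The immigration is over at the origin: \<open>L1\<close> and \<open>L2\<close> count the sites between the
  edge and the origin, the origin excluded, on either side.
\<close>

locale dead_exploration = site_chain p for p :: "int \<Rightarrow> real" +
  fixes j :: int and r N1 N2 :: nat and R L :: "nat list list"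
  fixes d1 L1 L2 :: nat and Z1 Z2 :: "nat \<Rightarrow> nat"
  defines "d1 \<equiv> r - of_bool (0 \<le> j)" and "L1 \<equiv> nat (- 1 - j)" and "L2 \<equiv> nat j"
    and "Z1 \<equiv> \<lambda>i. (d1 # levels L1 R) ! i" and "Z2 \<equiv> \<lambda>i. (r # levels L2 L) ! i"
  assumes r: "r > 0" and N: "N1 > 0" "N2 > 0"
    and R: "R \<in> set_pmf (explore N1 L1 d1)" and L: "L \<in> set_pmf (explore N2 L2 r)"
    and dead: "Z1 N1 = 0" "Z2 N2 = 0"
begin

lemma len: "length R = N1" "length L = N2"
  using set_explore[OF R] set_explore[OF L] by auto

lemma len_nth: "i < N1 \<Longrightarrow> length (R ! i) = Z1 i" "i < N2 \<Longrightarrow> length (L ! i) = Z2 i"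
  using set_explore[OF R] set_explore[OF L] by (auto simp: Z1_def Z2_def)

lemma Z_Suc:
  "i < N1 \<Longrightarrow> Z1 (Suc i) = sum_list (R ! i) + of_bool (i < L1)"
  "i < N2 \<Longrightarrow> Z2 (Suc i) = sum_list (L ! i) + of_bool (i < L2)"
  by (simp_all add: Z1_def Z2_def len nth_levels)

lemma immigration_ends: "L1 < N1" "L2 < N2"
  using Z_Suc(1)[of "N1 - 1"] Z_Suc(2)[of "N2 - 1"] N dead by (auto simp: not_less of_bool_def split: if_splits)

abbreviation "\<sigma> \<equiv> stack j R L"

lemma downs_right: "count_list (\<sigma> (j + 1 + int i)) (-1) = (if i \<le> N1 then Z1 i else 0)"
  using len_nth(1)[of i] dead(1) by (auto simp: stack_right len count_encode)

lemma ups_right: "count_list (\<sigma> (j + 1 + int i)) 1 = (if i < N1 then Z1 (Suc i) - of_bool (i < L1) else 0)"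
  using Z_Suc(1)[of i] by (auto simp: stack_right len count_encode)

lemma ups_left: "count_list (\<sigma> (j - int i)) 1 = (if i \<le> N2 then Z2 i else 0)"
  using len_nth(2)[of i] dead(2) by (auto simp: stack_left len count_encode count_map_uminus)

lemma downs_left: "count_list (\<sigma> (j - int i)) (-1) = (if i < N2 then Z2 (Suc i) - of_bool (i < L2) else 0)"
  using Z_Suc(2)[of i] by (auto simp: stack_left len count_encode count_map_uminus)

lemma flow_right:
  "int (count_list (\<sigma> (j + 1 + int i)) 1) - int (count_list (\<sigma> (j + 2 + int i)) (-1)) = - of_bool (i < L1)"
proof -
  have e: "j + 2 + int i = j + 1 + int (Suc i)" by simp
  show ?thesis unfolding e ups_right downs_right using Z_Suc(1)[of i] dead(1) immigration_ends(1)
    by (cases "i < N1") auto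
qed

lemma flow_middle: "int (count_list (\<sigma> j) 1) - int (count_list (\<sigma> (j + 1)) (-1)) = of_bool (0 \<le> j)"
  using ups_left[of 0] downs_right[of 0] r by (simp add: Z1_def Z2_def d1_def of_nat_diff)

lemma flow_left:
  "int (count_list (\<sigma> (j - 1 - int i)) 1) - int (count_list (\<sigma> (j - int i)) (-1)) = of_bool (i < L2)"
proof -
  have e: "j - 1 - int i = j - int (Suc i)" by simp
  show ?thesis unfolding e ups_left downs_left using Z_Suc(2)[of i] dead(2) immigration_ends(2)
    by (cases "i < N2") auto
qed

lemma flow: "int (count_list (\<sigma> k) 1) - int (count_list (\<sigma> (k + 1)) (-1)) = unit_flow 0 j k"
proof (rule site_cases[of k j])
  fix i assume k: "k = j + 1 + int i"
  have "unit_flow 0 j k = - of_bool (i < L1)"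
    by (auto simp: k unit_flow_def L1_def of_bool_def)
  then show ?thesis using flow_right[of i] by (simp add: k add_ac)
next
  fix i assume k: "k = j - int i"
  show ?thesis
  proof (cases i)
    case 0
    then show ?thesis using flow_middle by (simp add: k unit_flow_def)
  next
    case (Suc i')
    have "unit_flow 0 j k = of_bool (i' < L2)"
      by (auto simp: k Suc unit_flow_def L2_def of_bool_def)
    then show ?thesis using flow_left[of i'] by (simp add: k Suc algebra_simps)
  qed
qed

sublocale directed_stacks \<sigma> 0 j
proof
  show "set (\<sigma> k) \<subseteq> {1, -1}" for k
    using set_encode[of "R ! nat (k - j - 1)"] set_encode[of "L ! nat (j - k)"] by (auto simp: stack_def)
  show "int (count_list (\<sigma> k) 1) - int (count_list (\<sigma> (k + 1)) (-1)) = unit_flow 0 j k" for k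
    by (rule flow)
  show "last (\<sigma> k) = -1" if "j < k" "\<sigma> k \<noteq> []" for k
    using that by (auto simp: stack_def encode_eq_Nil_iff last_encode split: if_splits)
  show "last (\<sigma> k) = 1" if "k \<le> j" "\<sigma> k \<noteq> []" for k
    using that by (auto simp: stack_def encode_eq_Nil_iff last_encode last_map split: if_splits)
qed

lemma path_exists:
  "\<exists>ss. set ss \<subseteq> {1, -1} \<and> (\<forall>k. exits ss 0 k = \<sigma> k) \<and> (\<exists>ts. ss = ts @ [1] \<and> sum_list ts = j) \<and>
     path_weight ss (\<lambda>_. 0) 0 = pmf (explore N1 L1 d1) R * pmf (explore N2 L2 r) L"
proof -
  define S where "S = {j - int (length L) + 1..j + int (length R)}"
  have out: "\<sigma> k = []" if "k \<notin> S" for k using that by (auto simp: stack_def S_def)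
  have "finite S" by (simp add: S_def)
  from directed_stacks_exits[OF directed_stacks_axioms this out]
  obtain ss where ss0: "set ss \<subseteq> {1, -1} \<and> (\<forall>k. exits ss 0 k = \<sigma> k) \<and>
      (count_list (\<sigma> j) 1 > 0 \<longrightarrow> (\<exists>ts. ss = ts @ [1] \<and> 0 + sum_list ts = j))"
    by (rule exE)
  have ss: "exits ss 0 k = \<sigma> k" for k
    by (rule ss0[THEN conjunct2, THEN conjunct1, rule_format])
  have "count_list (\<sigma> j) 1 > 0" using ups_left[of 0] r by (simp add: Z2_def)
  then have "\<exists>ts. ss = ts @ [1] \<and> 0 + sum_list ts = j"
    by (rule ss0[THEN conjunct2, THEN conjunct2, rule_format])
  then have ends: "\<exists>ts. ss = ts @ [1] \<and> sum_list ts = j" by (simp only: add_0)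
  have "path_weight ss (\<lambda>_. 0) 0 = (\<Prod>k\<in>S. stack_weight (exits ss 0 k) 0)"
    by (rule path_weight_eq_prod_stack_weight[OF \<open>finite S\<close>]) (simp only: ss, rule out)
  also have "\<dots> = pmf (explore N1 L1 d1) R * pmf (explore N2 L2 r) L"
    unfolding ss prod_stack_weight[OF S_def] pmf_explore[OF R] pmf_explore[OF L] ..
  finally have "set ss \<subseteq> {1, -1} \<and> (\<forall>k. exits ss 0 k = \<sigma> k) \<and> (\<exists>ts. ss = ts @ [1] \<and> sum_list ts = j) \<and>
      path_weight ss (\<lambda>_. 0) 0 = pmf (explore N1 L1 d1) R * pmf (explore N2 L2 r) L"
    using ss0[THEN conjunct1] ss ends by (intro conjI allI)
  then show ?thesis by (rule exI)
qed

definition "\<Lambda> k = count_list (\<sigma> k) 1 + count_list (\<sigma> (k + 1)) (-1)"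

lemma unit_flow_bounds: "\<bar>unit_flow a b k\<bar> \<le> 1"
  by (auto simp: unit_flow_def of_bool_def)

text \<open>
  The local time of an edge is \<open>2 Z\<close> up to the unit flow, and the
  targets of the two sides differ from the common one by at most \<open>2\<close>, which comes from the
  offsets in \<open>d1\<close> and \<open>L1\<close>.
\<close>

lemma profile:
  assumes e: "0 \<le> e"
    and 1: "\<And>i. i \<le> N1 \<Longrightarrow> \<bar>2 * real (Z1 i) - max 0 (2 * real d1 + real L1 - \<bar>real i - real L1\<bar>)\<bar> \<le> e"
    and 2: "\<And>i. i \<le> N2 \<Longrightarrow> \<bar>2 * real (Z2 i) - max 0 (2 * real r + real L2 - \<bar>real i - real L2\<bar>)\<bar> \<le> e"
    and N1: "N1 = 2 * d1 + 2 * L1 + n" and N2: "N2 = 2 * r + 2 * L2 + n"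
  shows "\<bar>real (\<Lambda> k) - max 0 (\<bar>real_of_int j\<bar> - \<bar>real_of_int k\<bar> + 2 * real r)\<bar> \<le> e + 3"
    and "\<bar>k\<bar> \<ge> \<bar>j\<bar> + 2 * int r + int n \<Longrightarrow> \<Lambda> k = 0"
proof -
  have d1: "real d1 = real r - of_bool (0 \<le> j)" using r by (simp add: d1_def of_nat_diff)
  let ?T = "\<lambda>k. max 0 (\<bar>real_of_int j\<bar> - \<bar>real_of_int k\<bar> + 2 * real r)"
  have right_zero: "\<Lambda> (j + int i) = 0" if "i \<ge> N1" for i
  proof -
    have "count_list (\<sigma> (j + int i + 1)) (-1) = 0"
      using downs_right[of i] that dead(1) by (auto simp: add_ac)
    moreover have "unit_flow 0 j (j + int i) = 0"
      using that immigration_ends(1) N by (auto simp: unit_flow_def L1_def of_bool_def)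
    ultimately show ?thesis using flow[of "j + int i"] by (simp add: \<Lambda>_def)
  qed
  have left_zero: "\<Lambda> (j - int i) = 0" if "i \<ge> N2" for i
  proof -
    have "count_list (\<sigma> (j - int i)) 1 = 0"
      using ups_left[of i] that dead(2) by auto
    moreover have "unit_flow 0 j (j - int i) = 0"
      using that immigration_ends(2) N by (auto simp: unit_flow_def L2_def of_bool_def)
    ultimately show ?thesis using flow[of "j - int i"] by (simp add: \<Lambda>_def)
  qed
  have right: "\<bar>real (\<Lambda> (j + int i)) - ?T (j + int i)\<bar> \<le> e + 3" for i
  proof -
    let ?t = "max 0 (2 * real d1 + real L1 - \<bar>real i - real L1\<bar>)"
    have t: "\<bar>?t - ?T (j + int i)\<bar> \<le> 2"
    proof (rule order_trans[OF abs_diff_max_0])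
      show "\<bar>2 * real d1 + real L1 - \<bar>real i - real L1\<bar>
          - (\<bar>real_of_int j\<bar> - \<bar>real_of_int (j + int i)\<bar> + 2 * real r)\<bar> \<le> 2"
      proof (cases "0 \<le> j")
        case True
        then show ?thesis by (simp add: d1 L1_def)
      next
        case False
        then have "real L1 = - 1 - real_of_int j" by (simp add: L1_def)
        then show ?thesis using False by (simp add: d1)
      qed
    qed
    show ?thesis
    proof (cases "i \<le> N1")
      case True
      have "count_list (\<sigma> (j + int i + 1)) (-1) = Z1 i"
        using downs_right[of i] True by (simp add: add_ac)
      then have "\<bar>int (\<Lambda> (j + int i)) - 2 * int (Z1 i)\<bar> \<le> 1"
        using flow[of "j + int i"] unit_flow_bounds[of 0 j "j + int i"] by (simp add: \<Lambda>_def)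
      then have "\<bar>real (\<Lambda> (j + int i)) - 2 * real (Z1 i)\<bar> \<le> 1" by linarith
      then show ?thesis by (rule abs_diff_chain[OF _ 1[OF True] t])
    next
      case False
      have "?t = 0" using False N1 by (simp add: max_def)
      have "\<Lambda> (j + int i) = 0" using False by (intro right_zero) simp
      then show ?thesis using t e unfolding \<open>?t = 0\<close> by simp
    qed
  qed
  have left: "\<bar>real (\<Lambda> (j - int i)) - ?T (j - int i)\<bar> \<le> e + 3" for i
  proof -
    let ?t = "max 0 (2 * real r + real L2 - \<bar>real i - real L2\<bar>)"
    have t: "?t = ?T (j - int i)"
    proof (cases "0 \<le> j")
      case True
      then have "real L2 = real_of_int j" by (simp add: L2_def)
      moreover have "\<bar>real i - real_of_int j\<bar> = \<bar>real_of_int (j - int i)\<bar>" by simp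
      ultimately show ?thesis using True by (simp add: algebra_simps)
    next
      case False
      then have "L2 = 0" by (simp add: L2_def)
      moreover have "\<bar>real_of_int j\<bar> - \<bar>real_of_int (j - int i)\<bar> = - real i" using False by simp
      ultimately show ?thesis by simp
    qed
    show ?thesis
    proof (cases "i \<le> N2")
      case True
      have "count_list (\<sigma> (j - int i)) 1 = Z2 i"
        using ups_left[of i] True by simp
      then have "\<bar>int (\<Lambda> (j - int i)) - 2 * int (Z2 i)\<bar> \<le> 1"
        using flow[of "j - int i"] unit_flow_bounds[of 0 j "j - int i"] by (simp add: \<Lambda>_def)
      then have "\<bar>real (\<Lambda> (j - int i)) - 2 * real (Z2 i)\<bar> \<le> 1" by linarith
      then show ?thesis by (rule abs_diff_chain[OF _ 2[OF True]]) (subst t, simp)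
    next
      case False
      have "?t = 0" using False N2 by (simp add: max_def)
      have "\<Lambda> (j - int i) = 0" using False by (intro left_zero) simp
      then show ?thesis using e unfolding t[symmetric] \<open>?t = 0\<close> by simp
    qed
  qed
  show "\<bar>real (\<Lambda> k) - ?T k\<bar> \<le> e + 3"
  proof (rule site_cases[of k j])
    fix i assume "k = j + 1 + int i"
    then show ?thesis using right[of "Suc i"] by (simp add: add_ac)
  qed (use left in simp)
  assume k: "\<bar>k\<bar> \<ge> \<bar>j\<bar> + 2 * int r + int n"
  have d1': "int d1 = int r - of_bool (0 \<le> j)" using r by (simp add: d1_def of_nat_diff)
  show "\<Lambda> k = 0"
  proof (cases "k \<ge> 0")
    case True
    have "k \<ge> j + int N1"
      using k True N1 d1' by (cases "0 \<le> j") (auto simp: L1_def)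
    then have a: "nat (k - j) \<ge> N1" and b: "k = j + int (nat (k - j))" by auto
    show ?thesis by (subst b) (rule right_zero[OF a])
  next
    case False
    have "k \<le> j - int N2"
      using k False N2 by (cases "0 \<le> j") (auto simp: L2_def)
    then have a: "nat (j - k) \<ge> N2" and b: "k = j - int (nat (j - k))" by auto
    show ?thesis by (subst b) (rule left_zero[OF a])
  qed
qed

end

section \<open>The law of the walk\<close>

definition follows :: "(nat \<Rightarrow> int) \<Rightarrow> int list \<Rightarrow> bool" where
  "follows \<xi> ss \<longleftrightarrow> (\<forall>i\<le>length ss. \<xi> i = sum_list (take i ss))"

lemma follows_snoc:
  "follows \<xi> (ss @ [s]) \<longleftrightarrow> follows \<xi> ss \<and> \<xi> (Suc (length ss)) = \<xi> (length ss) + s"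
  by (auto simp: follows_def le_Suc_eq)

lemma follows_end: "follows \<xi> ss \<Longrightarrow> \<xi> (length ss) = sum_list ss"
  by (simp add: follows_def)

lemma oriented_local_time_Suc:
  "oriented_local_time \<xi> s (Suc n) k = oriented_local_time \<xi> s n k + of_bool (\<xi> n = k \<and> \<xi> (Suc n) = k + s)"
proof -
  let ?A = "{i. i < n \<and> \<xi> i = k \<and> \<xi> (Suc i) = k + s}"
  have "{i. i < Suc n \<and> \<xi> i = k \<and> \<xi> (Suc i) = k + s} = ?A \<union> (if \<xi> n = k \<and> \<xi> (Suc n) = k + s then {n} else {})"
    by (auto simp: less_Suc_eq)
  moreover have "finite ?A" by simp
  ultimately show ?thesis by (simp add: oriented_local_time_def)
qed

lemma oriented_local_time_mono: "m \<le> n \<Longrightarrow> oriented_local_time \<xi> s m k \<le> oriented_local_time \<xi> s n k"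
  unfolding oriented_local_time_def by (intro card_mono) auto

lemma oriented_local_time_follows:
  "follows \<xi> ss \<Longrightarrow> oriented_local_time \<xi> s (length ss) k = count_list (exits ss 0 k) s"
proof (induction ss rule: rev_induct)
  case Nil
  then show ?case by (simp add: oriented_local_time_def)
next
  case (snoc t ss)
  then have "follows \<xi> ss" "\<xi> (Suc (length ss)) = \<xi> (length ss) + t" by (simp_all add: follows_snoc)
  with snoc.IH follows_end[of \<xi> ss] show ?case
    by (auto simp: oriented_local_time_Suc exits_append)
qed

text \<open>
  The last step of the path is the \<open>r\<close>-th jump from \<open>j\<close> upwards, so the path is completed exactly
  at the inverse local time.
\<close>

lemma stopped_local_time_follows:
  assumes "follows \<xi> (ts @ [1])" "sum_list ts = j"
    and r: "r = count_list (exits (ts @ [1]) 0 j) 1"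
  shows "stopped_local_time \<xi> 1 j r k
     = enat (count_list (exits (ts @ [1]) 0 k) 1 + count_list (exits (ts @ [1]) 0 (k + 1)) (-1))"
    and "inverse_local_time \<xi> 1 j r = enat (Suc (length ts))"
proof -
  have olt: "oriented_local_time \<xi> s (Suc (length ts)) k = count_list (exits (ts @ [1]) 0 k) s" for s k
    using oriented_local_time_follows[OF assms(1)] by simp
  have "follows \<xi> ts" using assms(1) by (simp add: follows_snoc)
  then have "oriented_local_time \<xi> 1 (length ts) j < r"
    using oriented_local_time_follows[of \<xi> ts 1 j] assms(2) by (simp add: r exits_append)
  then have less: "oriented_local_time \<xi> 1 n j < r" if "n \<le> length ts" for n
    using oriented_local_time_mono[OF that, of \<xi> 1 j] by simp
  show inv: "inverse_local_time \<xi> 1 j r = enat (Suc (length ts))"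
    unfolding inverse_local_time_def
  proof (rule antisym)
    show "(INF n \<in> {n. r \<le> oriented_local_time \<xi> 1 n j}. enat n) \<le> enat (Suc (length ts))"
      by (rule INF_lower) (simp add: olt r)
    show "enat (Suc (length ts)) \<le> (INF n \<in> {n. r \<le> oriented_local_time \<xi> 1 n j}. enat n)"
    proof (rule INF_greatest)
      fix n assume "n \<in> {n. r \<le> oriented_local_time \<xi> 1 n j}"
      with less[of n] have "\<not> n \<le> length ts" by auto
      then show "enat (Suc (length ts)) \<le> enat n" by simp
    qed
  qed
  show "stopped_local_time \<xi> 1 j r k
     = enat (count_list (exits (ts @ [1]) 0 k) 1 + count_list (exits (ts @ [1]) 0 (k + 1)) (-1))"
    by (simp add: stopped_local_time_def inv edge_local_time_def olt)
qed

text \<open>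
  Closeness to the tent function with height \<open>a\<close> and slope \<open>1\<close>. Vanishing at distance \<open>a + b\<close> is
  demanded separately, as the extreme visited edges are not controlled by uniform closeness.
\<close>

definition profile_close :: "(nat \<Rightarrow> int) \<Rightarrow> int \<Rightarrow> int \<Rightarrow> nat \<Rightarrow> real \<Rightarrow> real \<Rightarrow> bool" where
  "profile_close \<xi> s j r a b \<longleftrightarrow> (\<exists>\<Lambda>. \<forall>k. stopped_local_time \<xi> s j r k = enat (\<Lambda> k) \<and>
     \<bar>real (\<Lambda> k) - max 0 (a - \<bar>real_of_int k\<bar>)\<bar> \<le> b \<and> (a + b \<le> \<bar>real_of_int k\<bar> \<longrightarrow> \<Lambda> k = 0))"

lemma follows_unique:
  assumes "follows \<xi> ss" "follows \<xi> ss'" "length ss = length ss'"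
  shows "ss = ss'"
  using assms
proof (induction ss arbitrary: ss' rule: rev_induct)
  case (snoc s ss)
  then obtain ts t where ss': "ss' = ts @ [t]" by (cases ss' rule: rev_cases) auto
  with snoc show ?case by (auto simp: follows_snoc)
qed simp

sublocale site_chain \<subseteq> level_chain "\<lambda>d. outward_count d 0"
proof
  show "outward_count 0 0 = return_pmf 0" by simp
  show "pmf (outward_count d 0) 0 > 0" for d by (rule pmf_outward_count_0_pos)
  obtain C where C: "\<And>d. (\<integral>\<^sup>+x. ennreal ((real_of_int x)\<^sup>2) \<partial>eta d) \<le> ennreal C"
    using eta_second_moment by blast
  show "\<exists>C. \<forall>d. (\<integral>\<^sup>+y. ennreal ((real y - real d)\<^sup>2) \<partial>outward_count d 0) \<le> ennreal C"
    using C by (intro exI[of _ C]) (simp add: eta_eq_outward_count)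
  have i: "integrable (measure_pmf (outward_count d 0)) real" for d
  proof -
    have "integrable (measure_pmf (outward_count d 0)) (\<lambda>y. real_of_int (int y - int d))"
      using eta_mean_tendsto(2)[of d] by (simp add: eta_eq_outward_count integrable_map_pmf_eq)
    then have "integrable (measure_pmf (outward_count d 0)) (\<lambda>y. real_of_int (int y - int d) + real d)"
      by (intro Bochner_Integration.integrable_add) auto
    then show ?thesis by simp
  qed
  have "measure_pmf.expectation (eta d) real_of_int = measure_pmf.expectation (outward_count d 0) real - real d" for d
    using i[of d] by (simp add: eta_eq_outward_count)
  then show "(\<lambda>d. measure_pmf.expectation (outward_count d 0) real - real d) \<longlonglongrightarrow> - 1 / 2"
    using eta_mean_tendsto(1) by simp
qed

context site_chain
begin

lemma bind_runs_sum_list: "runs d z \<bind> (\<lambda>ms. f (sum_list ms)) = outward_count d z \<bind> f"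
  by (simp add: bind_map_pmf flip: map_sum_list_runs)

lemma map_levels_explore: "map_pmf (levels L) (explore n L d) = level_path n L d"
proof (induction n arbitrary: L d)
  case (Suc n)
  have "map_pmf (levels L) (explore (Suc n) L d)
      = runs d 0 \<bind> (\<lambda>ms. map_pmf (Cons (sum_list ms + of_bool (L > 0)))
          (map_pmf (levels (L - 1)) (explore n (L - 1) (sum_list ms + of_bool (L > 0)))))"
    by (simp add: map_bind_pmf pmf.map_comp o_def)
  also have "\<dots> = outward_count d 0 \<bind> (\<lambda>y. map_pmf (Cons (y + of_bool (L > 0))) (level_path n (L - 1) (y + of_bool (L > 0))))"
    unfolding Suc.IH by (rule bind_runs_sum_list)
  also have "\<dots> = level_path (Suc n) L d"
    by (simp add: bind_map_pmf)
  finally show ?case .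
qed simp

end

context self_repelling_walk
begin

definition outward_prob :: "int \<Rightarrow> real" where
  "outward_prob z = w (- z) / (w z + w (- z))"

sublocale site_chain outward_prob
proof
  have mono: "w y \<le> w z" if "y \<le> z" for y z
    using that by (induction z rule: int_ge_induct) (auto intro: order_trans[OF _ w_mono])
  have pos: "w z + w (- z) > 0" for z using w_pos[of z] w_pos[of "- z"] by simp
  show "outward_prob z > 0" for z using w_pos pos by (simp add: outward_prob_def)
  show "outward_prob (- z) = 1 - outward_prob z" for z
    using pos[of z] by (simp add: outward_prob_def field_simps)
  show "outward_prob z \<le> outward_prob y" if "y \<le> z" for y z
  proof -
    have "w (- z) * w y \<le> w (- y) * w z"
      using mono[of y z] mono[of "- z" "- y"] that w_pos by (intro mult_mono) (auto simp: less_imp_le)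
    then show ?thesis using pos[of z] pos[of y] by (simp add: outward_prob_def field_simps)
  qed
  show "\<exists>z. outward_prob z < 1 / 2"
  proof -
    obtain l :: ereal where l: "((\<lambda>z. ereal (w z - w (- z))) \<longlongrightarrow> l) at_top" "l > 0"
      using w_nonconst by blast
    have "\<forall>\<^sub>F z in at_top. ereal (w z - w (- z)) > 0" by (rule order_tendstoD(1)[OF l])
    then obtain z where "w z - w (- z) > 0" by (auto simp: eventually_at_top_linorder)
    then show ?thesis using pos[of z] by (intro exI[of _ z]) (simp add: outward_prob_def field_simps)
  qed
qed

lemma step_prob: "s \<in> {1, -1} \<Longrightarrow> w (- s * D) / (w D + w (- D)) = outward_prob (s * D)"
  by (auto simp: outward_prob_def add.commute)

lemma subalgebra_history: "subalgebra M (history M X n)"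
proof -
  have gen: "{X i -` B \<inter> space M |i B. i \<le> n} \<subseteq> sets M"
    using X_measurable by (auto simp: measurable_sets)
  then have Pow: "{X i -` B \<inter> space M |i B. i \<le> n} \<subseteq> Pow (space M)"
    by auto
  show ?thesis
    unfolding subalgebra_def history_def space_measure_of[OF Pow] sets_measure_of[OF Pow]
    using sets.sigma_sets_subset[OF gen] by simp
qed

lemma follows_in_history: "length ss \<le> n \<Longrightarrow> {\<omega> \<in> space M. follows (\<lambda>i. X i \<omega>) ss} \<in> sets (history M X n)"
proof -
  assume n: "length ss \<le> n"
  have "{\<omega> \<in> space M. follows (\<lambda>i. X i \<omega>) ss} = (\<Inter>i\<in>{..length ss}. X i -` {sum_list (take i ss)} \<inter> space M)"
    by (auto simp: follows_def)
  moreover have "X i -` B \<inter> space M \<in> sets (history M X n)" if "i \<le> n" for i B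
    using that unfolding history_def by (intro in_measure_of) auto
  then have "(\<Inter>i\<in>{..length ss}. X i -` {sum_list (take i ss)} \<inter> space M) \<in> sets (history M X n)"
    using n by (intro sets.finite_INT) auto
  ultimately show ?thesis by (simp only:)
qed

lemma follows_measurable: "{\<omega> \<in> space M. follows (\<lambda>i. X i \<omega>) ss} \<in> sets M"
  using follows_in_history[of ss "length ss"] subalgebra_history[of "length ss"]
  by (auto simp: subalgebra_def)

lemma local_drift_follows:
  assumes "follows \<xi> ss" "set ss \<subseteq> {1, -1}"
  shows "local_drift \<xi> (length ss) = sum_list (exits ss 0 (sum_list ss))"
proof -
  have count: "int (count_list l 1) - int (count_list l (-1)) = sum_list l" if "set l \<subseteq> {1, -1}" for l :: "int list"
    using that by (induction l) auto
  have "set (exits ss a k) \<subseteq> set ss" for a k by (induction ss arbitrary: a) auto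
  then show ?thesis
    unfolding local_drift_def oriented_local_time_follows[OF assms(1)] follows_end[OF assms(1)]
    using assms(2) by (intro count) blast
qed

text \<open>
  The event that the walk follows \<open>ss\<close> belongs to the history, and the conditional probability of
  the next step is constant on it.
\<close>

lemma prob_follows:
  "set ss \<subseteq> {1, -1} \<Longrightarrow> prob {\<omega> \<in> space M. follows (\<lambda>i. X i \<omega>) ss} = path_weight ss (\<lambda>_. 0) 0"
proof (induction ss rule: rev_induct)
  case Nil
  have "AE \<omega> in M. \<omega> \<in> {\<omega> \<in> space M. follows (\<lambda>i. X i \<omega>) []}"
    using X_start by (rule AE_mp) (auto simp: follows_def intro!: AE_I2)
  then show ?case using prob_eq_1[OF follows_measurable[of "[]"]] by simp
next
  case (snoc s ss)
  define n where "n = length ss"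
  define A where "A = {\<omega> \<in> space M. follows (\<lambda>i. X i \<omega>) ss}"
  define B where "B = {\<omega> \<in> space M. X (Suc n) \<omega> = X n \<omega> + s}"
  define c where "c = outward_prob (s * sum_list (exits ss 0 (sum_list ss)))"
  have s: "s \<in> {1, -1}" and ss: "set ss \<subseteq> {1, -1}" using snoc.prems by auto
  have A: "A \<in> sets (history M X n)" "A \<in> sets M"
    unfolding A_def n_def by (rule follows_in_history, simp, rule follows_measurable)
  have B: "B \<in> sets M"
  proof -
    have "B = (\<Union>k. (X n -` {k} \<inter> space M) \<inter> (X (Suc n) -` {k + s} \<inter> space M))" by (auto simp: B_def)
    moreover have "X m -` C \<inter> space M \<in> sets M" for m C using X_measurable[of m] by (simp add: measurable_sets)
    ultimately show ?thesis by auto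
  qed
  interpret sub: finite_measure_subalgebra M "history M X n"
    by unfold_locales (rule subalgebra_history)
  have "prob (A \<inter> B) = (\<integral>\<omega>\<in>A. indicat_real B \<omega> \<partial>M)"
    using A B by (simp add: set_lebesgue_integral_def flip: indicator_inter_arith)
  also have "\<dots> = (\<integral>\<omega>\<in>A. real_cond_exp M (history M X n) (indicat_real B) \<omega> \<partial>M)"
    using A B by (intro sub.real_cond_exp_intA integrable_real_indicator) (auto simp: emeasure_eq_measure)
  also have "\<dots> = (\<integral>\<omega>. indicat_real A \<omega> * c \<partial>M)"
    unfolding set_lebesgue_integral_def
  proof (rule integral_cong_AE)
    show "AE \<omega> in M. indicat_real A \<omega> *\<^sub>R real_cond_exp M (history M X n) (indicat_real B) \<omega> = indicat_real A \<omega> * c"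
      using X_step[OF s, of n]
    proof (rule AE_mp, intro AE_I2 impI)
      fix \<omega> assume cond: "real_cond_exp M (history M X n) (indicat_real {\<omega> \<in> space M. X (Suc n) \<omega> = X n \<omega> + s}) \<omega>
          = (let D = local_drift (\<lambda>i. X i \<omega>) n in w (- s * D) / (w D + w (- D)))"
      show "indicat_real A \<omega> *\<^sub>R real_cond_exp M (history M X n) (indicat_real B) \<omega> = indicat_real A \<omega> * c"
      proof (cases "\<omega> \<in> A")
        case True
        then have "local_drift (\<lambda>i. X i \<omega>) n = sum_list (exits ss 0 (sum_list ss))"
          unfolding n_def A_def using ss by (auto intro: local_drift_follows)
        then have "real_cond_exp M (history M X n) (indicat_real B) \<omega> = c"
          using cond unfolding B_def Let_def c_def by (simp only: step_prob[OF s])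
        then show ?thesis by simp
      qed simp
    qed
  qed (use A B in auto)
  also have "\<dots> = prob A * c" using A by simp
  also have "prob A = path_weight ss (\<lambda>_. 0) 0" unfolding A_def by (rule snoc.IH[OF ss])
  also have "A \<inter> B = {\<omega> \<in> space M. follows (\<lambda>i. X i \<omega>) (ss @ [s])}"
    by (auto simp: A_def B_def n_def follows_snoc)
  finally show ?case by (simp add: path_weight_snoc c_def)
qed


text \<open>
  The event is the disjoint union, over all pairs of good explorations, of the events that the walk
  follows the path of the pair. Disjointness holds since the inverse local time fixes the
  length of the path, and the path returns the stacks.
\<close>

lemma stopped_profile_event:
  fixes j :: int and r n :: nat and e :: real
  defines "d1 \<equiv> r - of_bool (0 \<le> j)" and "L1 \<equiv> nat (- 1 - j)" and "L2 \<equiv> nat j"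
  defines "N1 \<equiv> 2 * d1 + 2 * L1 + n" and "N2 \<equiv> 2 * r + 2 * L2 + n"
  assumes r: "r > 0" and n: "n > 0" "real n \<le> e"
  obtains E where "E \<in> sets M"
    "prob E = measure_pmf.prob (level_path N1 L1 d1) {zs. follows_profile e N1 L1 d1 zs}
            * measure_pmf.prob (level_path N2 L2 r) {zs. follows_profile e N2 L2 r zs}"
    "\<And>\<omega>. \<omega> \<in> E \<Longrightarrow> profile_close (\<lambda>i. X i \<omega>) 1 j r (\<bar>real_of_int j\<bar> + 2 * real r) (e + 3)"
proof -
  define G1 where "G1 = set_pmf (explore N1 L1 d1) \<inter> levels L1 -` {zs. follows_profile e N1 L1 d1 zs}"
  define G2 where "G2 = set_pmf (explore N2 L2 r) \<inter> levels L2 -` {zs. follows_profile e N2 L2 r zs}"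
  let ?G = "G1 \<times> G2"
  have e: "0 \<le> e" using n by simp
  have N: "N1 > 0" "N2 > 0" using n by (auto simp: N1_def N2_def)
  have dead: "dead_exploration outward_prob j r N1 N2 R L" if "(R, L) \<in> ?G" for R L
    unfolding dead_exploration_def dead_exploration_axioms_def
    using that r N site_chain_axioms
    by (auto simp: G1_def G2_def follows_profile_def d1_def L1_def L2_def)
  define good where "good RL ss \<longleftrightarrow> set ss \<subseteq> {1, -1} \<and> (\<forall>k. exits ss 0 k = stack j (fst RL) (snd RL) k) \<and>
      (\<exists>ts. ss = ts @ [1] \<and> sum_list ts = j) \<and>
      path_weight ss (\<lambda>_. 0) 0 = pmf (explore N1 L1 d1) (fst RL) * pmf (explore N2 L2 r) (snd RL)" for RL ss
  define path where "path RL = (SOME ss. good RL ss)" for RL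
  have path: "good RL (path RL)" if RL: "RL \<in> ?G" for RL
  proof -
    interpret dead_exploration outward_prob j r N1 N2 "fst RL" "snd RL" d1 L1 L2
        "\<lambda>i. (d1 # levels L1 (fst RL)) ! i" "\<lambda>i. (r # levels L2 (snd RL)) ! i"
      using dead[of "fst RL" "snd RL"] RL by (simp_all add: d1_def L1_def L2_def)
    show ?thesis
      unfolding path_def using path_exists by (intro someI_ex[of "good RL"]) (simp only: good_def)
  qed
  define Ev where "Ev RL = {\<omega> \<in> space M. follows (\<lambda>i. X i \<omega>) (path RL)}" for RL
  have stopped: "stopped_local_time (\<lambda>i. X i \<omega>) 1 j r k
        = enat (count_list (stack j (fst RL) (snd RL) k) 1 + count_list (stack j (fst RL) (snd RL) (k + 1)) (-1))"
      "inverse_local_time (\<lambda>i. X i \<omega>) 1 j r = enat (length (path RL))"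
    if RL: "RL \<in> ?G" and \<omega>: "\<omega> \<in> Ev RL" for RL \<omega> k
  proof -
    interpret dead_exploration outward_prob j r N1 N2 "fst RL" "snd RL" d1 L1 L2
        "\<lambda>i. (d1 # levels L1 (fst RL)) ! i" "\<lambda>i. (r # levels L2 (snd RL)) ! i"
      using dead[of "fst RL" "snd RL"] RL by (simp_all add: d1_def L1_def L2_def)
    obtain ts where ts: "path RL = ts @ [1]" "sum_list ts = j"
      using path[OF RL] unfolding good_def by blast
    have ex: "exits (ts @ [1]) 0 k = stack j (fst RL) (snd RL) k" for k
      using path[OF RL] unfolding good_def ts(1) by blast
    have f: "follows (\<lambda>i. X i \<omega>) (ts @ [1])" using \<omega> by (simp add: Ev_def ts(1))
    have "r = count_list (exits (ts @ [1]) 0 j) 1"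
      unfolding ex using ups_left[of 0] by simp
    note * = stopped_local_time_follows[OF f ts(2) this]
    show "stopped_local_time (\<lambda>i. X i \<omega>) 1 j r k
        = enat (count_list (stack j (fst RL) (snd RL) k) 1 + count_list (stack j (fst RL) (snd RL) (k + 1)) (-1))"
      using *(1) unfolding ex .
    show "inverse_local_time (\<lambda>i. X i \<omega>) 1 j r = enat (length (path RL))"
      using *(2) by (simp add: ts(1))
  qed
  have disj: "disjoint_family_on Ev ?G"
    unfolding disjoint_family_on_def
  proof (intro ballI impI, rule ccontr)
    fix RL RL' assume RL: "RL \<in> ?G" "RL' \<in> ?G" "RL \<noteq> RL'" and "Ev RL \<inter> Ev RL' \<noteq> {}"
    then obtain \<omega> where \<omega>: "\<omega> \<in> Ev RL" "\<omega> \<in> Ev RL'" by blast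
    have "length (path RL) = length (path RL')"
      using stopped(2)[OF RL(1) \<omega>(1)] stopped(2)[OF RL(2) \<omega>(2)] by simp
    then have "path RL = path RL'"
      using \<omega> by (intro follows_unique[of "\<lambda>i. X i \<omega>"]) (simp_all add: Ev_def)
    then have "stack j (fst RL) (snd RL) k = stack j (fst RL') (snd RL') k" for k
      using path[OF RL(1)] path[OF RL(2)] unfolding good_def by metis
    then have "stack j (fst RL) (snd RL) = stack j (fst RL') (snd RL')" by (rule ext)
    moreover have "length (fst RL) = length (fst RL')" "length (snd RL) = length (snd RL')"
      using RL(1,2) set_explore by (auto simp: G1_def G2_def)
    ultimately have "fst RL = fst RL' \<and> snd RL = snd RL'" by (rule stack_inject)
    with RL(3) show False by (simp add: prod_eq_iff)
  qed
  have cnt: "countable ?G" by (auto simp: G1_def G2_def)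
  have sets: "Ev RL \<in> sets M" for RL unfolding Ev_def by (rule follows_measurable)
  have pr: "emeasure M (Ev RL) = ennreal (pmf (pair_pmf (explore N1 L1 d1) (explore N2 L2 r)) RL)" if "RL \<in> ?G" for RL
  proof -
    have "prob (Ev RL) = path_weight (path RL) (\<lambda>_. 0) 0"
      unfolding Ev_def by (rule prob_follows) (use path[OF that] in \<open>simp add: good_def\<close>)
    also have "\<dots> = pmf (explore N1 L1 d1) (fst RL) * pmf (explore N2 L2 r) (snd RL)"
      using path[OF that] by (simp add: good_def)
    finally show ?thesis by (cases RL) (simp add: emeasure_eq_measure pmf_pair)
  qed
  define E where "E = (\<Union>RL\<in>?G. Ev RL)"
  have "emeasure M E = (\<integral>\<^sup>+RL. emeasure M (Ev RL) \<partial>count_space ?G)"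
    unfolding E_def by (rule emeasure_UN_countable[OF sets cnt disj])
  also have "\<dots> = (\<integral>\<^sup>+RL. ennreal (pmf (pair_pmf (explore N1 L1 d1) (explore N2 L2 r)) RL) \<partial>count_space ?G)"
    by (rule nn_integral_cong) (simp add: pr)
  also have "\<dots> = emeasure (pair_pmf (explore N1 L1 d1) (explore N2 L2 r)) ?G"
    by (rule nn_integral_pmf)
  finally have "prob E = measure_pmf.prob (pair_pmf (explore N1 L1 d1) (explore N2 L2 r)) ?G"
    by (simp add: measure_def)
  also have "\<dots> = measure_pmf.prob (explore N1 L1 d1) G1 * measure_pmf.prob (explore N2 L2 r) G2"
    by (rule measure_pmf_prob_product) (auto simp: G1_def G2_def)
  also have "measure_pmf.prob (explore N1 L1 d1) G1 = measure_pmf.prob (level_path N1 L1 d1) {zs. follows_profile e N1 L1 d1 zs}"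
    unfolding G1_def map_levels_explore[symmetric] measure_map_pmf
    by (subst Int_commute) (rule measure_Int_set_pmf)
  also have "measure_pmf.prob (explore N2 L2 r) G2 = measure_pmf.prob (level_path N2 L2 r) {zs. follows_profile e N2 L2 r zs}"
    unfolding G2_def map_levels_explore[symmetric] measure_map_pmf
    by (subst Int_commute) (rule measure_Int_set_pmf)
  finally have prob: "prob E = measure_pmf.prob (level_path N1 L1 d1) {zs. follows_profile e N1 L1 d1 zs}
            * measure_pmf.prob (level_path N2 L2 r) {zs. follows_profile e N2 L2 r zs}" .
  have E: "E \<in> sets M" unfolding E_def by (intro sets.countable_UN'' cnt sets)
  show thesis
  proof (rule that[OF E prob])
    fix \<omega> assume "\<omega> \<in> E"
    then obtain RL where RL: "RL \<in> ?G" "\<omega> \<in> Ev RL" unfolding E_def by blast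
    interpret dead_exploration outward_prob j r N1 N2 "fst RL" "snd RL" d1 L1 L2
        "\<lambda>i. (d1 # levels L1 (fst RL)) ! i" "\<lambda>i. (r # levels L2 (snd RL)) ! i"
      using dead[of "fst RL" "snd RL"] RL by (simp_all add: d1_def L1_def L2_def)
    have fp: "follows_profile e N1 L1 d1 (levels L1 (fst RL))" "follows_profile e N2 L2 r (levels L2 (snd RL))"
      using RL(1) by (auto simp: G1_def G2_def)
    have fp1: "\<bar>2 * real ((d1 # levels L1 (fst RL)) ! i) - max 0 (2 * real d1 + real L1 - \<bar>real i - real L1\<bar>)\<bar> \<le> e"
      if "i \<le> N1" for i
      by (rule fp(1)[unfolded follows_profile_def, THEN conjunct2, rule_format, OF that])
    have fp2: "\<bar>2 * real ((r # levels L2 (snd RL)) ! i) - max 0 (2 * real r + real L2 - \<bar>real i - real L2\<bar>)\<bar> \<le> e"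
      if "i \<le> N2" for i
      by (rule fp(2)[unfolded follows_profile_def, THEN conjunct2, rule_format, OF that])
    note prof = profile[where e = e and n = n, OF e fp1 fp2 N1_def[THEN meta_eq_to_obj_eq] N2_def[THEN meta_eq_to_obj_eq]]
    show "profile_close (\<lambda>i. X i \<omega>) 1 j r (\<bar>real_of_int j\<bar> + 2 * real r) (e + 3)"
      unfolding profile_close_def
    proof (intro exI[of _ \<Lambda>] conjI allI impI)
      fix k
      show "stopped_local_time (\<lambda>i. X i \<omega>) 1 j r k = enat (\<Lambda> k)"
        unfolding stopped(1)[OF RL] \<Lambda>_def ..
      have eq: "\<bar>real_of_int j\<bar> - \<bar>real_of_int k\<bar> + 2 * real r = \<bar>real_of_int j\<bar> + 2 * real r - \<bar>real_of_int k\<bar>"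
        by simp
      show "\<bar>real (\<Lambda> k) - max 0 (\<bar>real_of_int j\<bar> + 2 * real r - \<bar>real_of_int k\<bar>)\<bar> \<le> e + 3"
        using prof(1)[of k] unfolding eq .
      assume "\<bar>real_of_int j\<bar> + 2 * real r + (e + 3) \<le> \<bar>real_of_int k\<bar>"
      then have "\<bar>real_of_int j\<bar> + 2 * real r + real n \<le> \<bar>real_of_int k\<bar>" using n(2) by linarith
      then have "\<bar>k\<bar> \<ge> \<bar>j\<bar> + 2 * int r + int n" by linarith
      then show "\<Lambda> k = 0" by (intro prof(2))
    qed
  qed
qed

end

section \<open>Reflection and scaling\<close>

lemma abs_diff_triangle:
  "\<bar>a - b\<bar> \<le> e1 \<Longrightarrow> \<bar>b - c\<bar> \<le> e2 \<Longrightarrow> e1 + e2 \<le> e \<Longrightarrow> \<bar>a - c\<bar> \<le> e" for a :: real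
  by linarith

lemma reflect_oriented_local_time:
  "oriented_local_time (\<lambda>i. - \<xi> i) s n k = oriented_local_time \<xi> (- s) n (- k)"
proof -
  have "(- \<xi> i = k \<and> - \<xi> (Suc i) = k + s) \<longleftrightarrow> (\<xi> i = - k \<and> \<xi> (Suc i) = - k + - s)" for i by auto
  then show ?thesis by (simp only: oriented_local_time_def)
qed

text \<open>
  The edge \<open>\<langle>k, k + 1\<rangle>\<close> is reflected to \<open>\<langle>- k - 1, - k\<rangle>\<close>.
\<close>

lemma reflect_stopped_local_time:
  "stopped_local_time \<xi> (-1) j r k = stopped_local_time (\<lambda>i. - \<xi> i) 1 (- j) r (- k - 1)"
proof -
  have "edge_local_time (\<lambda>i. - \<xi> i) n (- k - 1) = edge_local_time \<xi> n k" for n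
    by (simp add: edge_local_time_def reflect_oriented_local_time add.commute)
  moreover have "inverse_local_time (\<lambda>i. - \<xi> i) 1 (- j) r = inverse_local_time \<xi> (-1) j r"
    by (simp add: inverse_local_time_def reflect_oriented_local_time)
  ultimately show ?thesis by (simp only: stopped_local_time_def)
qed

lemma profile_close_shift:
  assumes "profile_close \<xi> s j r a b" "\<bar>a - a'\<bar> \<le> t" "b + t \<le> b'"
  shows "profile_close \<xi> s j r a' b'"
proof -
  obtain \<Lambda> where L: "\<And>k. stopped_local_time \<xi> s j r k = enat (\<Lambda> k)"
    "\<And>k. \<bar>real (\<Lambda> k) - max 0 (a - \<bar>real_of_int k\<bar>)\<bar> \<le> b"
    "\<And>k. a + b \<le> \<bar>real_of_int k\<bar> \<Longrightarrow> \<Lambda> k = 0"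
    using assms(1) unfolding profile_close_def by blast
  show ?thesis
    unfolding profile_close_def
  proof (intro exI[of _ \<Lambda>] conjI allI impI L)
    fix k
    show "\<bar>real (\<Lambda> k) - max 0 (a' - \<bar>real_of_int k\<bar>)\<bar> \<le> b'"
    proof (rule abs_diff_triangle[OF L(2) _ assms(3)])
      show "\<bar>max 0 (a - \<bar>real_of_int k\<bar>) - max 0 (a' - \<bar>real_of_int k\<bar>)\<bar> \<le> t"
        by (rule order_trans[OF abs_diff_max_0]) (use assms(2) in simp)
    qed
    show "a + b \<le> \<bar>real_of_int k\<bar>" if "a' + b' \<le> \<bar>real_of_int k\<bar>"
      using that assms(2,3) by linarith
  qed
qed

lemma reflect_profile_close:
  assumes "profile_close (\<lambda>i. - \<xi> i) 1 (- j) r a b"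
  shows "profile_close \<xi> (-1) j r a (b + 1)"
proof -
  obtain \<Lambda> where L: "\<And>k. stopped_local_time (\<lambda>i. - \<xi> i) 1 (- j) r k = enat (\<Lambda> k)"
    "\<And>k. \<bar>real (\<Lambda> k) - max 0 (a - \<bar>real_of_int k\<bar>)\<bar> \<le> b"
    "\<And>k. a + b \<le> \<bar>real_of_int k\<bar> \<Longrightarrow> \<Lambda> k = 0"
    using assms unfolding profile_close_def by blast
  show ?thesis
    unfolding profile_close_def
  proof (intro exI[of _ "\<lambda>k. \<Lambda> (- k - 1)"] conjI allI impI L)
    fix k
    have k: "\<bar>\<bar>real_of_int (- k - 1)\<bar> - \<bar>real_of_int k\<bar>\<bar> \<le> 1" by simp
    show "stopped_local_time \<xi> (-1) j r k = enat (\<Lambda> (- k - 1))"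
      unfolding reflect_stopped_local_time by (rule L(1))
    show "\<bar>real (\<Lambda> (- k - 1)) - max 0 (a - \<bar>real_of_int k\<bar>)\<bar> \<le> b + 1"
    proof (rule abs_diff_triangle[OF L(2) _ order_refl])
      show "\<bar>max 0 (a - \<bar>real_of_int (- k - 1)\<bar>) - max 0 (a - \<bar>real_of_int k\<bar>)\<bar> \<le> 1"
        by (rule order_trans[OF abs_diff_max_0]) (use k in linarith)
    qed
    show "a + b \<le> \<bar>real_of_int (- k - 1)\<bar>" if "a + (b + 1) \<le> \<bar>real_of_int k\<bar>"
      using that k by linarith
  qed
qed

lemma reflect_local_drift: "local_drift (\<lambda>i. - \<xi> i) n = - local_drift \<xi> n"
  by (simp add: local_drift_def reflect_oriented_local_time)

context self_repelling_walk
begin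

lemma reflect: "self_repelling_walk M w (\<lambda>n \<omega>. - X n \<omega>)"
proof
  show "w z > 0" "w z \<le> w (z + 1)" for z by (rule w_pos w_mono)+
  show "\<exists>L::ereal. ((\<lambda>z. ereal (w z - w (- z))) \<longlongrightarrow> L) at_top \<and> L > 0" by (rule w_nonconst)
  show "(\<lambda>\<omega>. - X n \<omega>) \<in> measurable M (count_space UNIV)" for n
    using X_measurable by (rule measurable_compose) simp
  show "AE \<omega> in M. - X 0 \<omega> = 0" using X_start by simp
  show "AE \<omega> in M. \<bar>- X (Suc n) \<omega> - - X n \<omega>\<bar> = 1" for n
    using X_nearest_neighbour[of n] by (rule AE_mp) (auto intro!: AE_I2)
  fix s :: int and n assume s: "s \<in> {1, -1}"
  have "{(\<lambda>\<omega>. - X i \<omega>) -` B \<inter> space M |i B. i \<le> n} = {X i -` B \<inter> space M |i B. i \<le> n}"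
  proof (intro equalityI subsetI)
    fix A assume "A \<in> {(\<lambda>\<omega>. - X i \<omega>) -` B \<inter> space M |i B. i \<le> n}"
    then obtain i B where "i \<le> n" "A = (\<lambda>\<omega>. - X i \<omega>) -` B \<inter> space M" by blast
    then have "i \<le> n" "A = X i -` (uminus -` B) \<inter> space M" by auto
    then show "A \<in> {X i -` B \<inter> space M |i B. i \<le> n}" by blast
  next
    fix A assume "A \<in> {X i -` B \<inter> space M |i B. i \<le> n}"
    then obtain i B where "i \<le> n" "A = X i -` B \<inter> space M" by blast
    then have "i \<le> n" "A = (\<lambda>\<omega>. - X i \<omega>) -` (uminus -` B) \<inter> space M" by auto
    then show "A \<in> {(\<lambda>\<omega>. - X i \<omega>) -` B \<inter> space M |i B. i \<le> n}" by blast
  qed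
  then have hist: "history M (\<lambda>n \<omega>. - X n \<omega>) n = history M X n"
    unfolding history_def by (rule arg_cong)
  have ev: "{\<omega> \<in> space M. - X (Suc n) \<omega> = - X n \<omega> + s} = {\<omega> \<in> space M. X (Suc n) \<omega> = X n \<omega> + - s}"
    by auto
  have "- s \<in> {1, -1}" using s by auto
  from X_step[OF this, of n]
  show "AE \<omega> in M. real_cond_exp M (history M (\<lambda>n \<omega>. - X n \<omega>) n)
        (indicat_real {\<omega> \<in> space M. - X (Suc n) \<omega> = - X n \<omega> + s}) \<omega> =
      (let D = local_drift (\<lambda>i. - X i \<omega>) n in w (- s * D) / (w D + w (- D)))"
    unfolding hist ev reflect_local_drift Let_def by (simp add: add.commute)
qed

text \<open>
  Stated for all \<open>j\<close> within distance one of \<open>A x\<close>, because reflection turns \<open>\<lfloor>A x\<rfloor>\<close> into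
  \<open>- \<lfloor>A x\<rfloor>\<close>, which need not be \<open>\<lfloor>- A x\<rfloor>\<close>.
\<close>

lemma stopped_profile_right:
  fixes x h \<epsilon> \<theta> :: real
  assumes pos: "h > 0" "\<epsilon> > 0" "\<theta> > 0"
  shows "\<exists>A0>0. \<forall>A\<ge>A0. \<forall>j. \<bar>real_of_int j - A * x\<bar> \<le> 1 \<longrightarrow> (\<exists>E\<in>sets M. prob E \<ge> 1 - \<theta> \<and>
    (\<forall>\<omega>\<in>E. profile_close (\<lambda>i. X i \<omega>) 1 j (nat \<lfloor>A * h\<rfloor>) (A * (\<bar>x\<bar> + 2 * h)) (\<epsilon> * A)))"
proof -
  define B where "B = \<bar>x\<bar> + h + 1"
  define \<epsilon>' where "\<epsilon>' = \<epsilon> / 4"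
  have "0 < h / 2" "0 < B" "0 < \<epsilon>'" "0 < \<theta> / 2" using pos by (auto simp: B_def \<epsilon>'_def)
  from level_path_concentration[OF this] obtain A1 where A1: "A1 > 0"
    and conc: "\<And>A d L. A1 \<le> A \<Longrightarrow> h / 2 * A \<le> real d \<and> real d \<le> B * A \<and> real L \<le> B * A \<Longrightarrow>
      measure_pmf.prob (level_path (2 * d + 2 * L + nat \<lfloor>\<epsilon>' * A\<rfloor>) L d)
        {zs. follows_profile (\<epsilon>' * A) (2 * d + 2 * L + nat \<lfloor>\<epsilon>' * A\<rfloor>) L d zs} \<ge> 1 - \<theta> / 2"
    by blast
  define A0 where "A0 = max A1 (max 1 (max (4 / h) (8 / \<epsilon>)))"
  show ?thesis
  proof (intro exI[of _ A0] conjI allI impI)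
    show "A0 > 0" using A1 by (simp add: A0_def)
    fix A :: real and j :: int
    assume A: "A0 \<le> A" and j: "\<bar>real_of_int j - A * x\<bar> \<le> 1"
    have A': "A1 \<le> A" "1 \<le> A" "4 / h \<le> A" "8 / \<epsilon> \<le> A" using A by (auto simp: A0_def)
    have hA: "4 \<le> A * h" and eA: "8 \<le> \<epsilon> * A" using A' pos by (auto simp: field_simps)
    define r where "r = nat \<lfloor>A * h\<rfloor>"
    have r: "A * h - 1 \<le> real r" "real r \<le> A * h" using hA unfolding r_def by linarith+
    have e'A: "\<epsilon>' * A \<ge> 2" using eA by (simp add: \<epsilon>'_def)
    define n where "n = nat \<lfloor>\<epsilon>' * A\<rfloor>"
    have n: "n > 0" "real n \<le> \<epsilon>' * A" using e'A unfolding n_def by linarith+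
    have ax: "\<bar>A * x\<bar> = A * \<bar>x\<bar>" using A' by (simp add: abs_mult)
    then have j': "\<bar>\<bar>real_of_int j\<bar> - A * \<bar>x\<bar>\<bar> \<le> 1" using j by linarith
    have BA: "B * A = A * \<bar>x\<bar> + A * h + A" by (simp add: B_def algebra_simps)
    have xA: "0 \<le> A * \<bar>x\<bar>" using A' by simp
    define d1 where "d1 = r - of_bool (0 \<le> j)"
    define L1 where "L1 = nat (- 1 - j)"
    define L2 where "L2 = nat j"
    have d1: "real d1 \<ge> A * h - 2" "real d1 \<le> real r" using r hA by (auto simp: d1_def of_bool_def)
    have Ls: "real L1 \<le> \<bar>real_of_int j\<bar>" "real L2 \<le> \<bar>real_of_int j\<bar>" by (auto simp: L1_def L2_def)
    have hh: "h / 2 * A = A * h / 2" by simp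
    have c1: "h / 2 * A \<le> real d1 \<and> real d1 \<le> B * A \<and> real L1 \<le> B * A"
      unfolding BA hh using d1 r Ls j' xA hA A' by (intro conjI) linarith+
    have c2: "h / 2 * A \<le> real r \<and> real r \<le> B * A \<and> real L2 \<le> B * A"
      unfolding BA hh using r Ls j' xA hA A' by (intro conjI) linarith+
    have "r > 0" using r hA by (cases r) auto
    from stopped_profile_event[OF \<open>r > 0\<close> n, of j, folded d1_def L1_def L2_def]
    obtain E where E: "E \<in> sets M"
      and prob: "prob E = measure_pmf.prob (level_path (2 * d1 + 2 * L1 + n) L1 d1) {zs. follows_profile (\<epsilon>' * A) (2 * d1 + 2 * L1 + n) L1 d1 zs}
            * measure_pmf.prob (level_path (2 * r + 2 * L2 + n) L2 r) {zs. follows_profile (\<epsilon>' * A) (2 * r + 2 * L2 + n) L2 r zs}"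
      and prof: "\<And>\<omega>. \<omega> \<in> E \<Longrightarrow> profile_close (\<lambda>i. X i \<omega>) 1 j r (\<bar>real_of_int j\<bar> + 2 * real r) (\<epsilon>' * A + 3)"
      by blast
    define P1 where "P1 = measure_pmf.prob (level_path (2 * d1 + 2 * L1 + n) L1 d1) {zs. follows_profile (\<epsilon>' * A) (2 * d1 + 2 * L1 + n) L1 d1 zs}"
    define P2 where "P2 = measure_pmf.prob (level_path (2 * r + 2 * L2 + n) L2 r) {zs. follows_profile (\<epsilon>' * A) (2 * r + 2 * L2 + n) L2 r zs}"
    have P: "1 - \<theta> / 2 \<le> P1" "1 - \<theta> / 2 \<le> P2" "P1 \<le> 1" "P2 \<le> 1"
      using conc[OF A'(1) c1] conc[OF A'(1) c2] by (simp_all add: P1_def P2_def n_def)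
    \<comment> \<open>The two failure probabilities add up at most: \<open>P1 P2 \<ge> 1 - (1 - P1) - (1 - P2)\<close>.\<close>
    have "(1 - P1) * (1 - P2) \<ge> 0" using P by (intro mult_nonneg_nonneg) auto
    then have "P1 * P2 \<ge> P1 + P2 - 1" by (simp add: algebra_simps)
    then have "prob E \<ge> 1 - \<theta>" using P unfolding prob P1_def[symmetric] P2_def[symmetric] by linarith
    moreover have "profile_close (\<lambda>i. X i \<omega>) 1 j (nat \<lfloor>A * h\<rfloor>) (A * (\<bar>x\<bar> + 2 * h)) (\<epsilon> * A)" if "\<omega> \<in> E" for \<omega>
      unfolding r_def[symmetric]
    proof (rule profile_close_shift[OF prof[OF that]])
      have "A * (\<bar>x\<bar> + 2 * h) = A * \<bar>x\<bar> + 2 * (A * h)" by (simp add: algebra_simps)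
      then show "\<bar>\<bar>real_of_int j\<bar> + 2 * real r - A * (\<bar>x\<bar> + 2 * h)\<bar> \<le> 3"
        using j' r by linarith
      have "\<epsilon> * A = 4 * (\<epsilon>' * A)" by (simp add: \<epsilon>'_def)
      then show "\<epsilon>' * A + 3 + 3 \<le> \<epsilon> * A" using e'A by linarith
    qed
    ultimately show "\<exists>E\<in>sets M. prob E \<ge> 1 - \<theta> \<and>
      (\<forall>\<omega>\<in>E. profile_close (\<lambda>i. X i \<omega>) 1 j (nat \<lfloor>A * h\<rfloor>) (A * (\<bar>x\<bar> + 2 * h)) (\<epsilon> * A))"
      using E by blast
  qed
qed

end

lemma INF_Collect_eq: "(INF n\<in>{n. P n}. f n) = (INF n. if P n then f n else top)"
  for f :: "'b \<Rightarrow> 'c::complete_lattice"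
proof (rule antisym)
  show "(INF n\<in>{n. P n}. f n) \<le> (INF n. if P n then f n else top)"
    by (rule INF_greatest) (simp add: INF_lower)
  show "(INF n. if P n then f n else top) \<le> (INF n\<in>{n. P n}. f n)"
  proof (rule INF_greatest)
    fix n assume "n \<in> {n. P n}"
    then show "(INF n. if P n then f n else top) \<le> f n" by (intro INF_lower2[of n]) auto
  qed
qed

lemma SUP_Collect_eq: "(SUP n\<in>{n. P n}. f n) = (SUP n. if P n then f n else bot)"
  for f :: "'b \<Rightarrow> 'c::complete_lattice"
proof (rule antisym)
  show "(SUP n. if P n then f n else bot) \<le> (SUP n\<in>{n. P n}. f n)"
    by (rule SUP_least) (simp add: SUP_upper)
  show "(SUP n\<in>{n. P n}. f n) \<le> (SUP n. if P n then f n else bot)"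
  proof (rule SUP_least)
    fix n assume "n \<in> {n. P n}"
    then show "f n \<le> (SUP n. if P n then f n else bot)" by (intro SUP_upper2[of n]) auto
  qed
qed

context self_repelling_walk
begin

lemma stopped_profile:
  fixes x h \<epsilon> \<theta> :: real and s :: int
  assumes pos: "h > 0" "\<epsilon> > 0" "\<theta> > 0" and s: "s \<in> {1, -1}"
  shows "\<exists>A0>0. \<forall>A\<ge>A0. \<exists>E\<in>sets M. prob E \<ge> 1 - \<theta> \<and>
    (\<forall>\<omega>\<in>E. profile_close (\<lambda>i. X i \<omega>) s \<lfloor>A * x\<rfloor> (nat \<lfloor>A * h\<rfloor>) (A * (\<bar>x\<bar> + 2 * h)) (\<epsilon> * A))"
proof (cases "s = 1")
  case True
  have "\<bar>real_of_int \<lfloor>A * x\<rfloor> - A * x\<bar> \<le> 1" for A by linarith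
  with stopped_profile_right[OF pos, of x] show ?thesis unfolding True by blast
next
  case False
  with s have s: "s = -1" by simp
  interpret reflected: self_repelling_walk M w "\<lambda>n \<omega>. - X n \<omega>" by (rule reflect)
  have "\<epsilon> / 2 > 0" using pos by simp
  from reflected.stopped_profile_right[OF pos(1) this pos(3), of "- x"]
  obtain A1 where A1: "A1 > 0" and *: "\<And>A j. A \<ge> A1 \<Longrightarrow> \<bar>real_of_int j - A * (- x)\<bar> \<le> 1 \<Longrightarrow> \<exists>E\<in>sets M. prob E \<ge> 1 - \<theta> \<and>
    (\<forall>\<omega>\<in>E. profile_close (\<lambda>i. - X i \<omega>) 1 j (nat \<lfloor>A * h\<rfloor>) (A * (\<bar>- x\<bar> + 2 * h)) (\<epsilon> / 2 * A))"
    by blast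
  show ?thesis
  proof (intro exI[of _ "max A1 (2 / \<epsilon>)"] conjI allI impI)
    show "max A1 (2 / \<epsilon>) > 0" using A1 by simp
    fix A assume "max A1 (2 / \<epsilon>) \<le> A"
    then have A: "A1 \<le> A" "2 / \<epsilon> \<le> A" by auto
    have eA: "\<epsilon> / 2 * A + 1 \<le> \<epsilon> * A" using A(2) pos by (simp add: field_simps)
    have "\<bar>real_of_int (- \<lfloor>A * x\<rfloor>) - A * (- x)\<bar> \<le> 1" by simp linarith
    from *[OF A(1) this] obtain E where E: "E \<in> sets M" "prob E \<ge> 1 - \<theta>"
      and prof: "\<And>\<omega>. \<omega> \<in> E \<Longrightarrow>
        profile_close (\<lambda>i. - X i \<omega>) 1 (- \<lfloor>A * x\<rfloor>) (nat \<lfloor>A * h\<rfloor>) (A * (\<bar>- x\<bar> + 2 * h)) (\<epsilon> / 2 * A)"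
      by blast
    have "profile_close (\<lambda>i. X i \<omega>) s \<lfloor>A * x\<rfloor> (nat \<lfloor>A * h\<rfloor>) (A * (\<bar>x\<bar> + 2 * h)) (\<epsilon> * A)" if "\<omega> \<in> E" for \<omega>
      unfolding s
      by (rule profile_close_shift[OF reflect_profile_close[OF prof[OF that]], of _ 0]) (use eA in auto)
    then show "\<exists>E\<in>sets M. prob E \<ge> 1 - \<theta> \<and>
      (\<forall>\<omega>\<in>E. profile_close (\<lambda>i. X i \<omega>) s \<lfloor>A * x\<rfloor> (nat \<lfloor>A * h\<rfloor>) (A * (\<bar>x\<bar> + 2 * h)) (\<epsilon> * A))"
      using E by blast
  qed
qed

lemma oriented_local_time_measurable [measurable]:
  "(\<lambda>\<omega>. oriented_local_time (\<lambda>i. X i \<omega>) s n k) \<in> measurable M (count_space UNIV)"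
proof (induction n)
  case 0
  then show ?case by (simp add: oriented_local_time_def)
next
  case (Suc n)
  note [measurable] = Suc X_measurable
  show ?case unfolding oriented_local_time_Suc by measurable
qed

lemma edge_local_time_measurable [measurable]:
  "(\<lambda>\<omega>. edge_local_time (\<lambda>i. X i \<omega>) n k) \<in> measurable M (count_space UNIV)"
  unfolding edge_local_time_def by measurable

lemma inverse_local_time_measurable [measurable]:
  "(\<lambda>\<omega>. inverse_local_time (\<lambda>i. X i \<omega>) s j r) \<in> measurable M (count_space UNIV)"
  unfolding inverse_local_time_def INF_Collect_eq by measurable

lemma stopped_local_time_measurable [measurable]:
  "(\<lambda>\<omega>. stopped_local_time (\<lambda>i. X i \<omega>) s j r k) \<in> measurable M (count_space UNIV)"
proof -
  let ?f = "\<lambda>t \<omega>. case t of enat n \<Rightarrow> enat (edge_local_time (\<lambda>i. X i \<omega>) n k)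
        | \<infinity> \<Rightarrow> (SUP n. enat (edge_local_time (\<lambda>i. X i \<omega>) n k))"
  have "?f t \<in> measurable M (count_space UNIV)" for t
    by (cases t) simp_all
  then have "(\<lambda>\<omega>. ?f (inverse_local_time (\<lambda>i. X i \<omega>) s j r) \<omega>) \<in> measurable M (count_space UNIV)"
    by (rule measurable_compose_countable[where f = ?f]) (rule inverse_local_time_measurable)
  then show ?thesis by (simp only: stopped_local_time_def)
qed

lemma leftmost_edge_measurable [measurable]:
  "(\<lambda>\<omega>. leftmost_edge (\<lambda>i. X i \<omega>) s j r) \<in> borel_measurable M"
  unfolding leftmost_edge_def INF_Collect_eq by measurable

lemma rightmost_edge_measurable [measurable]:
  "(\<lambda>\<omega>. rightmost_edge (\<lambda>i. X i \<omega>) s j r) \<in> borel_measurable M"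
  unfolding rightmost_edge_def SUP_Collect_eq by measurable

text \<open>
  The supremum runs over uncountably many \<open>y\<close>, but the path enters only through countably many edges;
  taking the supremum over each set \<open>\<lfloor>A y\<rfloor> = k\<close> first leaves a countable one.
\<close>

lemma profile_distance_measurable:
  fixes g :: "real \<Rightarrow> enat \<Rightarrow> ereal"
  shows "(\<lambda>\<omega>. SUP y::real. g y (stopped_local_time (\<lambda>i. X i \<omega>) s j r \<lfloor>A * y\<rfloor>)) \<in> borel_measurable M"
proof -
  define H where "H k v = (SUP y\<in>{y. \<lfloor>A * y\<rfloor> = k}. g y v)" for k :: int and v
  have "(SUP y::real. g y (f \<lfloor>A * y\<rfloor>)) = (SUP k. H k (f k))" for f
  proof (rule antisym)
    show "(SUP y::real. g y (f \<lfloor>A * y\<rfloor>)) \<le> (SUP k. H k (f k))"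
    proof (rule SUP_least)
      fix y :: real
      have "g y (f \<lfloor>A * y\<rfloor>) \<le> H \<lfloor>A * y\<rfloor> (f \<lfloor>A * y\<rfloor>)" unfolding H_def by (rule SUP_upper) simp
      then show "g y (f \<lfloor>A * y\<rfloor>) \<le> (SUP k. H k (f k))" by (rule SUP_upper2[OF UNIV_I])
    qed
    show "(SUP k. H k (f k)) \<le> (SUP y::real. g y (f \<lfloor>A * y\<rfloor>))"
    proof (rule SUP_least)
      fix k :: int
      show "H k (f k) \<le> (SUP y::real. g y (f \<lfloor>A * y\<rfloor>))"
        unfolding H_def by (rule SUP_least) (auto intro: SUP_upper)
    qed
  qed
  moreover have "(\<lambda>\<omega>. SUP k. H k (stopped_local_time (\<lambda>i. X i \<omega>) s j r k)) \<in> borel_measurable M"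
  proof (rule borel_measurable_SUP)
    show "(\<lambda>\<omega>. H k (stopped_local_time (\<lambda>i. X i \<omega>) s j r k)) \<in> borel_measurable M" for k
      by (rule measurable_compose[OF stopped_local_time_measurable]) simp
  qed simp
  ultimately show ?thesis by simp
qed

lemma converges_in_probabilityI:
  assumes "\<And>A. Y A \<in> borel_measurable M"
    and "\<And>\<epsilon> \<theta>. \<epsilon> > 0 \<Longrightarrow> \<theta> > 0 \<Longrightarrow> \<exists>A0. \<forall>A\<ge>A0. \<exists>E\<in>sets M. prob E \<ge> 1 - \<theta> \<and> (\<forall>\<omega>\<in>E. \<bar>Y A \<omega> - ereal c\<bar> \<le> ereal \<epsilon>)"
  shows "converges_in_probability M Y c"
  unfolding converges_in_probability_def
proof (intro conjI allI impI)
  show "\<forall>\<^sub>F A in at_top. Y A \<in> borel_measurable M" using assms(1) by simp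
  fix \<epsilon> :: real assume \<epsilon>: "\<epsilon> > 0"
  show "((\<lambda>A. prob {\<omega> \<in> space M. \<bar>Y A \<omega> - ereal c\<bar> > ereal \<epsilon>}) \<longlongrightarrow> 0) at_top"
  proof (rule tendstoI)
    fix \<theta> :: real assume "\<theta> > 0"
    then obtain A0 where A0: "\<And>A. A \<ge> A0 \<Longrightarrow> \<exists>E\<in>sets M. prob E \<ge> 1 - \<theta> / 2 \<and> (\<forall>\<omega>\<in>E. \<bar>Y A \<omega> - ereal c\<bar> \<le> ereal \<epsilon>)"
      using assms(2)[OF \<epsilon>, of "\<theta> / 2"] by auto
    have "prob {\<omega> \<in> space M. \<bar>Y A \<omega> - ereal c\<bar> > ereal \<epsilon>} < \<theta>" if A: "A \<ge> A0" for A
    proof -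
      obtain E where E: "E \<in> sets M" "prob E \<ge> 1 - \<theta> / 2" "\<And>\<omega>. \<omega> \<in> E \<Longrightarrow> \<bar>Y A \<omega> - ereal c\<bar> \<le> ereal \<epsilon>"
        using A0[OF A] by blast
      have "prob {\<omega> \<in> space M. \<bar>Y A \<omega> - ereal c\<bar> > ereal \<epsilon>} \<le> prob (space M - E)"
        using E(1,3) by (intro finite_measure_mono) (auto simp: not_less[symmetric])
      also have "\<dots> = 1 - prob E" by (rule prob_compl[OF E(1)])
      finally show ?thesis using E(2) \<open>\<theta> > 0\<close> by linarith
    qed
    then show "\<forall>\<^sub>F A in at_top. dist (prob {\<omega> \<in> space M. \<bar>Y A \<omega> - ereal c\<bar> > ereal \<epsilon>}) 0 < \<theta>"
      by (auto simp: eventually_at_top_linorder intro!: exI[of _ A0])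
  qed
qed

end

text \<open>
  The tent exceeds \<open>b\<close> at distance \<open>\<lfloor>a - 2 b\<rfloor>\<close> from the origin, so the edges there are visited.
\<close>

lemma profile_extremes:
  assumes "profile_close \<xi> s j r a b" and ab: "0 < b" "2 * b \<le> a"
  shows "\<exists>q. leftmost_edge \<xi> s j r = ereal q \<and> \<bar>q - (- a)\<bar> \<le> 2 * b + 1"
    and "\<exists>q. rightmost_edge \<xi> s j r = ereal q \<and> \<bar>q - a\<bar> \<le> 2 * b + 1"
proof -
  obtain \<Lambda> where st: "\<And>k. stopped_local_time \<xi> s j r k = enat (\<Lambda> k)"
    and close: "\<And>k. \<bar>real (\<Lambda> k) - max 0 (a - \<bar>real_of_int k\<bar>)\<bar> \<le> b"
    and outside: "\<And>k. a + b \<le> \<bar>real_of_int k\<bar> \<Longrightarrow> \<Lambda> k = 0"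
    using assms(1) unfolding profile_close_def by blast
  define k where "k = \<lfloor>a - 2 * b\<rfloor>"
  have k: "0 \<le> k" "real_of_int k \<le> a - 2 * b" "a - 2 * b - 1 \<le> real_of_int k" using ab unfolding k_def by linarith+
  have pos: "\<Lambda> i > 0" if "\<bar>i\<bar> = k" for i
  proof (rule ccontr)
    assume "\<not> \<Lambda> i > 0"
    then have "max 0 (a - \<bar>real_of_int i\<bar>) \<le> b" using close[of i] by simp
    moreover have "\<bar>real_of_int i\<bar> = real_of_int k" using that by simp
    ultimately show False using k ab by simp
  qed
  have inside: "- (a + b) \<le> real_of_int i \<and> real_of_int i \<le> a + b" if "\<Lambda> i > 0" for i
    using outside[of i] that by (force simp: not_le)
  have S: "{i. stopped_local_time \<xi> s j r i > 0} = {i. \<Lambda> i > 0}" unfolding st by (simp add: zero_enat_def)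
  have l1: "ereal (- (a + b)) \<le> leftmost_edge \<xi> s j r" unfolding leftmost_edge_def S
    by (rule INF_greatest) (use inside in auto)
  have l2: "leftmost_edge \<xi> s j r \<le> ereal (real_of_int (- k))" unfolding leftmost_edge_def S
    by (rule INF_lower) (use pos[of "- k"] k in auto)
  have r1: "rightmost_edge \<xi> s j r \<le> ereal (a + b)" unfolding rightmost_edge_def S
    by (rule SUP_least) (use inside in auto)
  have r2: "ereal (real_of_int k) \<le> rightmost_edge \<xi> s j r" unfolding rightmost_edge_def S
    by (rule SUP_upper) (use pos[of k] k in auto)
  obtain q where q: "leftmost_edge \<xi> s j r = ereal q"
    using l1 l2 by (cases "leftmost_edge \<xi> s j r") auto
  show "\<exists>q. leftmost_edge \<xi> s j r = ereal q \<and> \<bar>q - (- a)\<bar> \<le> 2 * b + 1"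
    using l1 l2 k ab unfolding q by (intro exI[of _ q]) (simp add: abs_le_iff)
  obtain q where q: "rightmost_edge \<xi> s j r = ereal q"
    using r1 r2 by (cases "rightmost_edge \<xi> s j r") auto
  show "\<exists>q. rightmost_edge \<xi> s j r = ereal q \<and> \<bar>q - a\<bar> \<le> 2 * b + 1"
    using r1 r2 k ab unfolding q by (intro exI[of _ q]) (simp add: abs_le_iff)
qed

lemma profile_distance:
  fixes A x h b :: real
  assumes "profile_close \<xi> s j r (A * (\<bar>x\<bar> + 2 * h)) b" and A: "A > 0"
  shows "(SUP y::real. \<bar>ereal (inverse A) * ereal_of_enat (stopped_local_time \<xi> s j r \<lfloor>A * y\<rfloor>)
               - ereal (max 0 (\<bar>x\<bar> - \<bar>y\<bar> + 2 * h))\<bar>) \<le> ereal ((b + 1) / A)"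
proof (rule SUP_least)
  fix y :: real
  obtain \<Lambda> where st: "\<And>k. stopped_local_time \<xi> s j r k = enat (\<Lambda> k)"
    and close: "\<And>k. \<bar>real (\<Lambda> k) - max 0 (A * (\<bar>x\<bar> + 2 * h) - \<bar>real_of_int k\<bar>)\<bar> \<le> b"
    using assms(1) unfolding profile_close_def by blast
  let ?k = "\<lfloor>A * y\<rfloor>" and ?a = "A * (\<bar>x\<bar> + 2 * h)"
  have "\<bar>A * y\<bar> = A * \<bar>y\<bar>" using A by (simp add: abs_mult)
  then have k: "\<bar>\<bar>real_of_int ?k\<bar> - A * \<bar>y\<bar>\<bar> \<le> 1" by linarith
  have m: "max 0 (\<bar>x\<bar> - \<bar>y\<bar> + 2 * h) = inverse A * max 0 (?a - A * \<bar>y\<bar>)"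
  proof -
    have "?a - A * \<bar>y\<bar> = A * (\<bar>x\<bar> - \<bar>y\<bar> + 2 * h)" by (simp add: algebra_simps)
    then show ?thesis using A by (simp add: max_def zero_le_mult_iff)
  qed
  have "\<bar>real (\<Lambda> ?k) - max 0 (?a - A * \<bar>y\<bar>)\<bar> \<le> b + 1"
  proof (rule abs_diff_triangle[OF close[of ?k] _ order_refl])
    show "\<bar>max 0 (?a - \<bar>real_of_int ?k\<bar>) - max 0 (?a - A * \<bar>y\<bar>)\<bar> \<le> 1"
      by (rule order_trans[OF abs_diff_max_0]) (use k in linarith)
  qed
  then have "inverse A * \<bar>real (\<Lambda> ?k) - max 0 (?a - A * \<bar>y\<bar>)\<bar> \<le> inverse A * (b + 1)"
    using A by (intro mult_left_mono) auto
  also have "inverse A * \<bar>real (\<Lambda> ?k) - max 0 (?a - A * \<bar>y\<bar>)\<bar>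
      = \<bar>inverse A * real (\<Lambda> ?k) - max 0 (\<bar>x\<bar> - \<bar>y\<bar> + 2 * h)\<bar>"
    unfolding m right_diff_distrib[symmetric] abs_mult using A by simp
  finally show "\<bar>ereal (inverse A) * ereal_of_enat (stopped_local_time \<xi> s j r ?k)
               - ereal (max 0 (\<bar>x\<bar> - \<bar>y\<bar> + 2 * h))\<bar> \<le> ereal ((b + 1) / A)"
    by (simp only: st ereal_of_enat_simps times_ereal.simps ereal_minus abs_ereal.simps ereal_less_eq
        divide_inverse mult.commute[of "b + 1"])
qed

lemma (in self_repelling_walk) scaled_limits:
  fixes x h \<epsilon> \<theta> :: real and s :: int
  assumes h: "h > 0" and s: "s \<in> {1, -1}" and pos: "\<epsilon> > 0" "\<theta> > 0"
  defines "c \<equiv> \<bar>x\<bar> + 2 * h"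
  shows "\<exists>A0. \<forall>A\<ge>A0. \<exists>E\<in>sets M. prob E \<ge> 1 - \<theta> \<and> (\<forall>\<omega>\<in>E.
     \<bar>ereal (inverse A) * leftmost_edge (\<lambda>i. X i \<omega>) s \<lfloor>A * x\<rfloor> (nat \<lfloor>A * h\<rfloor>) - ereal (- c)\<bar> \<le> ereal \<epsilon> \<and>
     \<bar>ereal (inverse A) * rightmost_edge (\<lambda>i. X i \<omega>) s \<lfloor>A * x\<rfloor> (nat \<lfloor>A * h\<rfloor>) - ereal c\<bar> \<le> ereal \<epsilon> \<and>
     \<bar>(SUP y::real. \<bar>ereal (inverse A) *
         ereal_of_enat (stopped_local_time (\<lambda>i. X i \<omega>) s \<lfloor>A * x\<rfloor> (nat \<lfloor>A * h\<rfloor>) \<lfloor>A * y\<rfloor>)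
         - ereal (max 0 (\<bar>x\<bar> - \<bar>y\<bar> + 2 * h))\<bar>) - ereal 0\<bar> \<le> ereal \<epsilon>)"
proof -
  define \<delta> where "\<delta> = min (\<epsilon> / 4) h"
  have \<delta>: "0 < \<delta>" "\<delta> \<le> \<epsilon> / 4" "\<delta> \<le> h" using pos h by (auto simp: \<delta>_def)
  obtain A0 where A0: "A0 > 0" and *: "\<And>A. A \<ge> A0 \<Longrightarrow> \<exists>E\<in>sets M. prob E \<ge> 1 - \<theta> \<and>
    (\<forall>\<omega>\<in>E. profile_close (\<lambda>i. X i \<omega>) s \<lfloor>A * x\<rfloor> (nat \<lfloor>A * h\<rfloor>) (A * c) (\<delta> * A))"
    using stopped_profile[OF h \<delta>(1) pos(2) s, of x] unfolding c_def by blast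
  have scale: "\<bar>ereal (inverse A) * ereal q - ereal b\<bar> \<le> ereal \<epsilon>"
    if A: "A > 0" and q: "\<bar>q - A * b\<bar> \<le> \<epsilon> * A" for A q b :: real
  proof -
    have "\<bar>inverse A * q - b\<bar> = inverse A * \<bar>q - A * b\<bar>"
    proof -
      have "inverse A * q - b = inverse A * (q - A * b)" using A by (simp add: right_diff_distrib)
      then show ?thesis using A by (simp add: abs_mult)
    qed
    also have "\<dots> \<le> inverse A * (\<epsilon> * A)" using q A by (intro mult_left_mono) auto
    also have "\<dots> = \<epsilon>" using A by simp
    finally show ?thesis by simp
  qed
  show ?thesis
  proof (intro exI[of _ "max A0 (2 / \<epsilon>)"] allI impI)
    fix A assume "max A0 (2 / \<epsilon>) \<le> A"
    then have A: "A0 \<le> A" "2 / \<epsilon> \<le> A" by auto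
    have A_pos: "A > 0" using A A0 by simp
    have eA: "\<epsilon> * A \<ge> 2" using A(2) pos by (simp add: field_simps)
    have \<delta>A: "4 * (\<delta> * A) \<le> \<epsilon> * A" "\<delta> * A \<le> h * A" "0 < \<delta> * A"
      using mult_right_mono[OF \<delta>(2), of A] mult_right_mono[OF \<delta>(3), of A] \<delta>(1) A_pos by auto
    define a where "a = A * c"
    have a: "a = A * \<bar>x\<bar> + 2 * A * h" by (simp add: a_def c_def algebra_simps)
    have "0 \<le> A * \<bar>x\<bar>" using A_pos by simp
    moreover have "2 * A * h = 2 * (h * A)" by simp
    ultimately have ab: "2 * (\<delta> * A) \<le> a" using \<delta>A(2) unfolding a by linarith
    obtain E where E: "E \<in> sets M" "prob E \<ge> 1 - \<theta>"
      and prof: "\<And>\<omega>. \<omega> \<in> E \<Longrightarrow> profile_close (\<lambda>i. X i \<omega>) s \<lfloor>A * x\<rfloor> (nat \<lfloor>A * h\<rfloor>) a (\<delta> * A)"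
      using *[OF A(1)] unfolding a_def by blast
    show "\<exists>E\<in>sets M. prob E \<ge> 1 - \<theta> \<and> (\<forall>\<omega>\<in>E.
     \<bar>ereal (inverse A) * leftmost_edge (\<lambda>i. X i \<omega>) s \<lfloor>A * x\<rfloor> (nat \<lfloor>A * h\<rfloor>) - ereal (- c)\<bar> \<le> ereal \<epsilon> \<and>
     \<bar>ereal (inverse A) * rightmost_edge (\<lambda>i. X i \<omega>) s \<lfloor>A * x\<rfloor> (nat \<lfloor>A * h\<rfloor>) - ereal c\<bar> \<le> ereal \<epsilon> \<and>
     \<bar>(SUP y::real. \<bar>ereal (inverse A) *
         ereal_of_enat (stopped_local_time (\<lambda>i. X i \<omega>) s \<lfloor>A * x\<rfloor> (nat \<lfloor>A * h\<rfloor>) \<lfloor>A * y\<rfloor>)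
         - ereal (max 0 (\<bar>x\<bar> - \<bar>y\<bar> + 2 * h))\<bar>) - ereal 0\<bar> \<le> ereal \<epsilon>)"
    proof (intro bexI[of _ E] conjI ballI E)
      fix \<omega> assume \<omega>: "\<omega> \<in> E"
      note ext = profile_extremes[OF prof[OF \<omega>] \<delta>A(3) ab]
      have b: "2 * (\<delta> * A) + 1 \<le> \<epsilon> * A" using \<delta>A(1) eA by linarith
      obtain q where q: "leftmost_edge (\<lambda>i. X i \<omega>) s \<lfloor>A * x\<rfloor> (nat \<lfloor>A * h\<rfloor>) = ereal q" "\<bar>q - (- a)\<bar> \<le> 2 * (\<delta> * A) + 1"
        using ext(1) by blast
      show "\<bar>ereal (inverse A) * leftmost_edge (\<lambda>i. X i \<omega>) s \<lfloor>A * x\<rfloor> (nat \<lfloor>A * h\<rfloor>) - ereal (- c)\<bar> \<le> ereal \<epsilon>"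
        unfolding q(1)
      proof (rule scale[OF A_pos])
        show "\<bar>q - A * - c\<bar> \<le> \<epsilon> * A" using order_trans[OF q(2) b] by (simp add: a_def)
      qed
      obtain q where q: "rightmost_edge (\<lambda>i. X i \<omega>) s \<lfloor>A * x\<rfloor> (nat \<lfloor>A * h\<rfloor>) = ereal q" "\<bar>q - a\<bar> \<le> 2 * (\<delta> * A) + 1"
        using ext(2) by blast
      show "\<bar>ereal (inverse A) * rightmost_edge (\<lambda>i. X i \<omega>) s \<lfloor>A * x\<rfloor> (nat \<lfloor>A * h\<rfloor>) - ereal c\<bar> \<le> ereal \<epsilon>"
        unfolding q(1)
      proof (rule scale[OF A_pos])
        show "\<bar>q - A * c\<bar> \<le> \<epsilon> * A" using order_trans[OF q(2) b] by (simp add: a_def)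
      qed
      let ?f = "\<lambda>y. \<bar>ereal (inverse A) *
         ereal_of_enat (stopped_local_time (\<lambda>i. X i \<omega>) s \<lfloor>A * x\<rfloor> (nat \<lfloor>A * h\<rfloor>) \<lfloor>A * y\<rfloor>)
         - ereal (max 0 (\<bar>x\<bar> - \<bar>y\<bar> + 2 * h))\<bar>"
      have "(SUP y. ?f y) \<le> ereal ((\<delta> * A + 1) / A)"
        by (rule profile_distance[OF prof[OF \<omega>, unfolded a_def c_def] A_pos])
      also have "\<delta> * A + 1 \<le> \<epsilon> * A" using \<delta>A(1,3) eA by linarith
      then have "ereal ((\<delta> * A + 1) / A) \<le> ereal \<epsilon>" using A_pos by (simp add: divide_le_eq)
      finally have "(SUP y. ?f y) \<le> ereal \<epsilon>" .
      moreover have "0 \<le> (SUP y. ?f y)" by (rule SUP_upper2[of 0]) auto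
      ultimately show "\<bar>(SUP y. ?f y) - ereal 0\<bar> \<le> ereal \<epsilon>" by simp
    qed
  qed
qed

theorem theorem1:
  fixes M :: "'a measure" and w :: "int \<Rightarrow> real" and X :: "nat \<Rightarrow> 'a \<Rightarrow> int"
    and x h :: real and s :: int
  assumes "self_repelling_walk M w X"
    and "h > 0"
    and "s \<in> {1, -1}"
  shows "converges_in_probability M
           (\<lambda>A \<omega>. ereal (inverse A) *
              leftmost_edge (\<lambda>i. X i \<omega>) s \<lfloor>A * x\<rfloor> (nat \<lfloor>A * h\<rfloor>))
           (- \<bar>x\<bar> - 2 * h)
    \<and> converges_in_probability M
           (\<lambda>A \<omega>. ereal (inverse A) *
              rightmost_edge (\<lambda>i. X i \<omega>) s \<lfloor>A * x\<rfloor> (nat \<lfloor>A * h\<rfloor>))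
           (\<bar>x\<bar> + 2 * h)
    \<and> converges_in_probability M
           (\<lambda>A \<omega>. SUP y::real.
              \<bar>ereal (inverse A) *
                 ereal_of_enat (stopped_local_time (\<lambda>i. X i \<omega>) s \<lfloor>A * x\<rfloor> (nat \<lfloor>A * h\<rfloor>) \<lfloor>A * y\<rfloor>)
               - ereal (max 0 (\<bar>x\<bar> - \<bar>y\<bar> + 2 * h))\<bar>)
           0"
proof -
  interpret self_repelling_walk M w X by fact
  note limits = scaled_limits[OF assms(2,3), of _ _ x]
  have c: "- \<bar>x\<bar> - 2 * h = - (\<bar>x\<bar> + 2 * h)" by simp
  show ?thesis
  proof (intro conjI converges_in_probabilityI)
    fix A :: real
    show "(\<lambda>\<omega>. ereal (inverse A) * leftmost_edge (\<lambda>i. X i \<omega>) s \<lfloor>A * x\<rfloor> (nat \<lfloor>A * h\<rfloor>)) \<in> borel_measurable M"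
      by measurable
    show "(\<lambda>\<omega>. ereal (inverse A) * rightmost_edge (\<lambda>i. X i \<omega>) s \<lfloor>A * x\<rfloor> (nat \<lfloor>A * h\<rfloor>)) \<in> borel_measurable M"
      by measurable
    show "(\<lambda>\<omega>. SUP y::real. \<bar>ereal (inverse A) *
         ereal_of_enat (stopped_local_time (\<lambda>i. X i \<omega>) s \<lfloor>A * x\<rfloor> (nat \<lfloor>A * h\<rfloor>) \<lfloor>A * y\<rfloor>)
         - ereal (max 0 (\<bar>x\<bar> - \<bar>y\<bar> + 2 * h))\<bar>) \<in> borel_measurable M"
      by (rule profile_distance_measurable)
  next
    fix \<epsilon> \<theta> :: real assume pos: "\<epsilon> > 0" "\<theta> > 0"
    from limits[OF this]
    show "\<exists>A0. \<forall>A\<ge>A0. \<exists>E\<in>sets M. prob E \<ge> 1 - \<theta> \<and> (\<forall>\<omega>\<in>E. \<bar>ereal (inverse A) *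
        leftmost_edge (\<lambda>i. X i \<omega>) s \<lfloor>A * x\<rfloor> (nat \<lfloor>A * h\<rfloor>) - ereal (- \<bar>x\<bar> - 2 * h)\<bar> \<le> ereal \<epsilon>)"
      unfolding c by blast
    from limits[OF pos]
    show "\<exists>A0. \<forall>A\<ge>A0. \<exists>E\<in>sets M. prob E \<ge> 1 - \<theta> \<and> (\<forall>\<omega>\<in>E. \<bar>ereal (inverse A) *
        rightmost_edge (\<lambda>i. X i \<omega>) s \<lfloor>A * x\<rfloor> (nat \<lfloor>A * h\<rfloor>) - ereal (\<bar>x\<bar> + 2 * h)\<bar> \<le> ereal \<epsilon>)"
      by blast
    from limits[OF pos]
    show "\<exists>A0. \<forall>A\<ge>A0. \<exists>E\<in>sets M. prob E \<ge> 1 - \<theta> \<and> (\<forall>\<omega>\<in>E. \<bar>(SUP y::real. \<bar>ereal (inverse A) *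
         ereal_of_enat (stopped_local_time (\<lambda>i. X i \<omega>) s \<lfloor>A * x\<rfloor> (nat \<lfloor>A * h\<rfloor>) \<lfloor>A * y\<rfloor>)
         - ereal (max 0 (\<bar>x\<bar> - \<bar>y\<bar> + 2 * h))\<bar>) - ereal 0\<bar> \<le> ereal \<epsilon>)"
      by blast
  qed
qed

end
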